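(* Let $P\in\mathcal P_3$, and write $\sigma=\sigma(P)$, $\alpha=\alpha(P)$, $h=h(P)$. Then the limit on the left-hand side below exists and $$\lim_{n\to\infty}\sqrt n\,\sup_{I\in\mathfrak I}|P_n(I)-\mathrm N_{0,1}(I)|=\frac1{\sqrt{2\pi}}\cdot\begin{cases}\dfrac h\sigma & \text{if } |\alpha|\le h\sigma^2,\\[2mm] \dfrac h{2\sigma}+\dfrac{|\alpha|}{6\sigma^3}+\dfrac{|\alpha|}{3\sigma^3}\exp\Bigl(-\dfrac32\Bigl(1-\dfrac{h\sigma^2}{|\alpha|}\Bigr)\Bigr) & \text{if } |\alpha|>h\sigma^2.\end{cases}$$
   Context: $\mathrm{Prob}(\mathbb R)$ is the set of all (Borel) probability laws on $\mathbb R$, $\mathbb N=\{1,2,3,\dots\}$, and $\mathrm N_{0,1}$ is the standard normal law. For $P\in\mathrm{Prob}(\mathbb R)$ and $s\in[1,\infty)$, let $\mu(P)=\int x\,P(\mathrm dx)$ and $\beta_s(P)=\int|x-\mu(P)|^s\,P(\mathrm dx)$ if $\int|x|\,P(\mathrm dx)<\infty$, and $\beta_s(P)=\infty$ otherwise. Let $\sigma^2(P)=\beta_2(P)$ with $\sigma(P)\ge 0$, and $\alpha(P)=\int(x-\mu(P))^3\,P(\mathrm dx)$ if $\beta_3(P)<\infty$. Let $\mathcal P_3=\{P\in\mathrm{Prob}(\mathbb R):0<\beta_3(P)<\infty\}$. If $P$ is a lattice law (i.e. $P(a+\eta\mathbb Z)=1$ for some $a\in\mathbb R$, $\eta>0$),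 let $h(P)=\sup\bigcup_{a\in\mathbb R}\{\eta\in(0,\infty):P(a+\eta\mathbb Z)=1\}$; otherwise let $h(P)=0$. For $P\in\mathcal P_3$ and $n\in\mathbb N$, $P_n\in\mathrm{Prob}(\mathbb R)$ is defined by $P_n(A)=P^{*n}(\sigma\sqrt n\,A+n\mu)$ for Borel $A\subseteq\mathbb R$, where $\mu=\mu(P)$, $\sigma=\sigma(P)$ and $P^{*n}$ is the $n$-fold convolution power; that is, $P_n$ is the law of the standardized sum $(X_1+\dots+X_n-n\mu)/(\sigma\sqrt n)$ of independent random variables $X_1,\dots,X_n$ with law $P$. $\mathfrak I$ denotes the system of all intervals in $\mathbb R$ (bounded or unbounded; open, closed or half-open). *)

theory Defs
  imports "HOL-Probability.Probability"
begin

text \<open>Laws on the real line are Borel probability measures, i.e. \<open>P\<close> with \<open>real_distribution P\<close>.\<close>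

definition law_mean :: "real measure \<Rightarrow> real" where
  "law_mean P = (\<integral>x. x \<partial>P)"

definition abs_central_moment :: "real \<Rightarrow> real measure \<Rightarrow> ennreal" where
  "abs_central_moment s P =
     (if (\<integral>\<^sup>+x. ennreal \<bar>x\<bar> \<partial>P) < \<infinity>
      then (\<integral>\<^sup>+x. ennreal (\<bar>x - law_mean P\<bar> powr s) \<partial>P)
      else \<infinity>)"

text \<open>The following two are meaningful only when the second, respectively third, absolute
  central moment is finite.\<close>

definition std_dev :: "real measure \<Rightarrow> real" where
  "std_dev P = sqrt (enn2real (abs_central_moment 2 P))"

definition third_central_moment :: "real measure \<Rightarrow> real" where
  "third_central_moment P = (\<integral>x. (x - law_mean P) ^ 3 \<partial>P)"

definition P3 :: "real measure set" where
  "P3 = {P. real_distribution P \<and> 0 < abs_central_moment 3 P \<and> abs_central_moment 3 P < \<infinity>}"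

definition lattice_points :: "real \<Rightarrow> real \<Rightarrow> real set" where
  "lattice_points a \<eta> = {a + \<eta> * of_int k | k :: int. True}"

definition lattice_law :: "real measure \<Rightarrow> bool" where
  "lattice_law P \<longleftrightarrow> (\<exists>a \<eta>. \<eta> > 0 \<and> measure P (lattice_points a \<eta>) = 1)"

text \<open>If the lattice law \<open>P\<close> is not a Dirac law, in particular if \<open>P \<in> P3\<close>, then the set below is bounded by
  the distance of any two atoms, so that the real-valued supremum is the intended one. For Dirac
  laws, where the supremum would be infinite, the value is unspecified.\<close>

definition lattice_span :: "real measure \<Rightarrow> real" where
  "lattice_span P =
     (if lattice_law P
      then Sup (\<Union>a. {\<eta>. \<eta> > 0 \<and> measure P (lattice_points a \<eta>) = 1})
      else 0)"

primrec conv_power :: "real measure \<Rightarrow> nat \<Rightarrow> real measure" where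
  "conv_power P 0 = return borel 0"
| "conv_power P (Suc n) = convolution P (conv_power P n)"

text \<open>The preimage of \<open>A\<close> under the map below is \<open>\<sigma> \<surd>n A + n \<mu>\<close> for \<open>n \<ge> 1\<close> and \<open>\<sigma> > 0\<close>.\<close>

definition standardized_sum_law :: "real measure \<Rightarrow> nat \<Rightarrow> real measure" where
  "standardized_sum_law P n =
     distr (conv_power P n) borel
       (\<lambda>x. (x - real n * law_mean P) / (std_dev P * sqrt (real n)))"

end

theory Submission
  imports Defs "HOL-Real_Asymp.Real_Asymp"
begin

text \<open>Let \<open>f\<close> be the characteristic function of the standardized law of \<open>(X - \<mu>) / \<sigma>\<close>, so that \<open>P\<^sub>n\<close> has
characteristic function \<open>f (t / \<surd>n) ^ n\<close>; measure \<open>h\<close> and \<open>\<alpha>\<close> in units of \<open>\<sigma>\<close> and \<open>\<sigma>\<^sup>3\<close>. The limit is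
governed by Esseen's first-order expansion of the distribution functions,
uniformly in \<open>x\<close>,
\<open>F\<^sub>n x = \<Phi> x + (\<alpha> / 6 * (1 - x\<^sup>2) + h * S\<^sub>n x) * \<phi> x / \<surd>n + o (1 / \<surd>n)\<close>,
where \<open>S\<^sub>n\<close> is a saw-tooth with values between \<open>-1/2\<close> and \<open>1/2\<close> which jumps from one value to the other at the
points of the lattice of step \<open>\<eta> = h / \<surd>n\<close> that carries \<open>P\<^sub>n\<close>. An interval probability is a difference of
two values or left limits of \<open>F\<^sub>n\<close>. The upper end of an interval therefore contributes at most
\<open>V x = (\<alpha> / 6 * (1 - x\<^sup>2) + h / 2) * \<phi> x\<close> to \<open>\<surd>n * (P\<^sub>n I - N\<^sub>0\<^sub>1 I)\<close>, the lower end at most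
\<open>W x = (- \<alpha> / 6 * (1 - x\<^sup>2) + h / 2) * \<phi> x\<close>, and closed intervals between lattice points realize both
bounds in the limit. The limit is thus \<open>max V + max W\<close>. Both maxima are at \<open>0\<close> if \<open>\<bar>\<alpha>\<bar> \<le> h\<close>; otherwise one
of them sits at a point \<open>p\<close> with \<open>p\<^sup>2 = 3 * (1 - h / \<bar>\<alpha>\<bar>)\<close>, which produces the exponential
(\<open>extremal_points\<close>, \<open>interval_sup_limit\<close>).

The lattice and the non-lattice case are treated together by dithering: independent noise, uniform on an
interval of length \<open>\<eta>\<close>, is added to \<open>P\<^sub>n\<close>. At a lattice point \<open>g\<close> the value and the left limit of \<open>F\<^sub>n\<close> are
values of the dithered distribution function at \<open>g + \<eta> / 2\<close> and \<open>g - \<eta> / 2\<close> (\<open>dithered_node\<close>), so nothing is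
lost. On the Fourier side the noise contributes a factor that vanishes at every \<open>s \<noteq> 0\<close> with \<open>\<bar>f s\<bar> = 1\<close>:
these \<open>s\<close> are the nonzero multiples of \<open>2 * \<pi> / h\<close> (\<open>lattice_span_char\<close>). Hence the dithered laws \<open>N n\<close> satisfy the
expansion without the saw-tooth (\<open>edgeworth_N\<close>). By Esseen's smoothing inequality
(\<open>esseen_smoothing\<close>) this reduces to showing that the integral of
\<open>\<surd>n * \<bar>char (N n) t - (1 + \<alpha> / (6 * \<surd>n) * (\<i> * t) ^ 3) * exp (- t\<^sup>2 / 2)\<bar> / \<bar>t\<bar>\<close> over \<open>\<bar>t\<bar> \<le> a * \<surd>n\<close>
tends to \<open>0\<close> for every \<open>a\<close> (\<open>smoothing_error_limit\<close>). On \<open>\<bar>t\<bar> \<le> \<delta> * \<surd>n\<close> Taylor expansion of \<open>f\<close> and dominated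
convergence give this; on the remaining range, which in the variable \<open>s = t / \<surd>n\<close> is a fixed compact set
avoiding \<open>0\<close>, the product \<open>\<surd>n * \<bar>f s\<bar> ^ n * \<bar>w s\<bar>\<close> with the noise factor \<open>w\<close> is bounded and tends to \<open>0\<close> almost
everywhere.\<close>

section \<open>The Fejer kernel\<close>

definition triangle :: "real \<Rightarrow> real" where
  "triangle t = max 0 (1 - \<bar>t\<bar>)"

text \<open>The inverse Fourier transform of the triangle, up to a constant. It is nonnegative and integrable while its
transform has compact support, which is what smoothing needs. The value at \<open>0\<close> is the continuous extension.\<close>
definition fejer :: "real \<Rightarrow> real" where
  "fejer z = (if z = 0 then 1 else 2 * (1 - cos z) / z\<^sup>2)"

lemma triangle_measurable [measurable]: "triangle \<in> borel_measurable borel"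
  unfolding triangle_def by measurable

lemma fejer_measurable [measurable]: "fejer \<in> borel_measurable borel"
  unfolding fejer_def by measurable

lemma triangle_bounds: "0 \<le> triangle t" "triangle t \<le> indicator {-1..1} t"
  by (auto simp: triangle_def indicator_def)

lemma fejer_fourier:
  "(\<integral>t. of_real (triangle t) * iexp (- (t * z)) \<partial>lborel) = complex_of_real (fejer z)"
proof -
  define e where "e t = iexp (- (t * z))" for t :: real
  have de: "(e has_vector_derivative (- \<i> * z * e t)) (at t within S)" for t S
    unfolding e_def
    by (rule has_vector_derivative_real_field derivative_eq_intros refl | simp)+
  have cont: "continuous_on {-1..1} (\<lambda>t. of_real (triangle t) * e t)"
    unfolding triangle_def e_def by (intro continuous_intros)
  have ind: "of_real (triangle t) * e t = indicator {-1..1} t *\<^sub>R (of_real (triangle t) * e t)" for t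
    by (auto simp: indicator_def triangle_def)
  have set_int: "(\<integral>t. of_real (triangle t) * e t \<partial>lborel)
      = integral {-1..1} (\<lambda>t. of_real (triangle t) * e t)"
    by (subst ind, subst set_borel_integral_eq_integral(2)[unfolded set_lebesgue_integral_def, symmetric])
       (use borel_integrable_atLeastAtMost'[OF cont] in \<open>auto simp: set_lebesgue_integral_def\<close>)
  have "((\<lambda>t. of_real (triangle t) * e t) has_integral of_real (fejer z)) {-1..1}"
  proof (cases "z = 0")
    case True
    have 1: "((\<lambda>t. of_real (triangle t) * e t) has_integral
      (of_real (1 - 1^2/2) - of_real (0 - 0^2/2))) {0..1}"
      by (rule fundamental_theorem_of_calculus)
         (auto simp: True e_def triangle_def has_vector_derivative_complex_iff
               intro!: derivative_eq_intros)
    have 2: "((\<lambda>t. of_real (triangle t) * e t) has_integral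
      (of_real (0 + 0^2/2) - of_real (-1 + (-1)^2/2))) {-1..0}"
      by (rule fundamental_theorem_of_calculus)
         (auto simp: True e_def triangle_def has_vector_derivative_complex_iff
               intro!: derivative_eq_intros)
    show ?thesis using has_integral_combine[OF _ _ 2 1] by (simp add: True fejer_def)
  next
    case False
    \<comment> \<open>antiderivatives on the two sides of the kink of the triangle at \<open>0\<close>\<close>
    define A where "A t = (1 - t) * (\<i> / z) * e t - e t / z^2" for t
    define B where "B t = (1 + t) * (\<i> / z) * e t + e t / z^2" for t
    have 1: "((\<lambda>t. of_real (triangle t) * e t) has_integral (A 1 - A 0)) {0..1}"
    proof (rule fundamental_theorem_of_calculus)
      fix t :: real assume t: "t \<in> {0..1}"
      have "(A has_vector_derivative (- (\<i> / z) * e t + (1 - t) * (\<i> / z) * (- \<i> * z * e t)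
          - (- \<i> * z * e t) / z^2)) (at t within {0..1})"
        unfolding A_def
        by (rule derivative_eq_intros de has_vector_derivative_mult has_vector_derivative_divide refl | simp)+
      also have "(- (\<i> / z) * e t + (1 - t) * (\<i> / z) * (- \<i> * z * e t)
          - (- \<i> * z * e t) / z^2) = of_real (triangle t) * e t"
        using t False by (simp add: triangle_def field_simps power2_eq_square)
      finally show "(A has_vector_derivative of_real (triangle t) * e t) (at t within {0..1})" .
    qed simp
    have 2: "((\<lambda>t. of_real (triangle t) * e t) has_integral (B 0 - B (-1))) {-1..0}"
    proof (rule fundamental_theorem_of_calculus)
      fix t :: real assume t: "t \<in> {-1..0}"
      have "(B has_vector_derivative ((\<i> / z) * e t + (1 + t) * (\<i> / z) * (- \<i> * z * e t)
          + (- \<i> * z * e t) / z^2)) (at t within {-1..0})"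
        unfolding B_def
        by (rule derivative_eq_intros de has_vector_derivative_mult has_vector_derivative_divide refl | simp)+
      also have "((\<i> / z) * e t + (1 + t) * (\<i> / z) * (- \<i> * z * e t)
          + (- \<i> * z * e t) / z^2) = of_real (triangle t) * e t"
        using t False by (simp add: triangle_def field_simps power2_eq_square)
      finally show "(B has_vector_derivative of_real (triangle t) * e t) (at t within {-1..0})" .
    qed simp
    have "B 0 - B (-1) + (A 1 - A 0) = of_real (fejer z)"
      using False
      by (simp add: A_def B_def e_def fejer_def complex_eq_iff Re_exp Im_exp field_simps)
    then show ?thesis using has_integral_combine[OF _ _ 2 1] by simp
  qed
  then show ?thesis using set_int unfolding e_def by (simp add: integral_unique)
qed

lemma fejer_nonneg: "0 \<le> fejer z"
  unfolding fejer_def by simp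

lemma fejer_le: "fejer z \<le> 5 * inverse (1 + z\<^sup>2)"
proof (cases "z = 0")
  case False
  have "1 - cos z = 2 * (sin (z/2))^2"
    using cos_double_sin[of "z/2"] by simp
  moreover have "\<bar>sin (z/2)\<bar> \<le> \<bar>z/2\<bar>" by (rule abs_sin_x_le_abs_x)
  then have "(sin (z/2))^2 \<le> (z/2)^2" by (metis abs_le_square_iff)
  ultimately have 1: "2 * (1 - cos z) \<le> z^2" by (simp add: power_divide)
  have 2: "2 * (1 - cos z) \<le> 4" using cos_ge_minus_one[of z] by argo
  have "2 * (1 - cos z) * (1 + z\<^sup>2) \<le> 5 * z\<^sup>2"
    using 1 mult_right_mono[OF 2, of "z^2"] by (simp add: algebra_simps)
  then show ?thesis using False
    by (simp add: fejer_def field_simps add_pos_nonneg)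
qed (simp add: fejer_def)

lemma integrable_fejer: "integrable lborel fejer"
proof (rule Bochner_Integration.integrable_bound)
  show "integrable lborel (\<lambda>z::real. 5 * inverse (1 + z\<^sup>2))"
    using integrable_inverse_1_plus_square by (simp add: set_integrable_def)
  show "AE z in lborel. norm (fejer z) \<le> norm (5 * inverse (1 + z\<^sup>2))"
    using fejer_nonneg fejer_le by (auto simp: order.trans)
qed simp

text \<open>The total mass is \<open>2 * \<pi>\<close>; only its positivity matters, because it is divided out.\<close>
definition fejer_mass :: real where
  "fejer_mass = (\<integral>z. fejer z \<partial>lborel)"

lemma fejer_mass_pos: "0 < fejer_mass"
proof -
  have pos: "0 < fejer z" if "z \<in> {0<..<1}" for z
  proof -
    have "cos z < 1" using cos_monotone_0_pi[of 0 z] that pi_gt3 by simp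
    then show ?thesis using that by (simp add: fejer_def)
  qed
  have "fejer_mass \<noteq> 0"
  proof
    assume "fejer_mass = 0"
    then have "AE z in lborel. fejer z = 0"
      unfolding fejer_mass_def
      by (subst (asm) integral_nonneg_eq_0_iff_AE) (auto simp: integrable_fejer fejer_nonneg)
    then have "AE z in lborel. z \<notin> {0<..<(1::real)}"
      by eventually_elim (use pos in fastforce)
    then have "emeasure lborel {0<..<(1::real)} = 0"
      by (subst (asm) AE_iff_measurable[where N="{0<..<1}"]) auto
    then show False by simp
  qed
  moreover have "0 \<le> fejer_mass" unfolding fejer_mass_def
    by (simp add: fejer_nonneg)
  ultimately show ?thesis by simp
qed

definition fejer_kernel :: "real \<Rightarrow> real" where
  "fejer_kernel z = fejer z / fejer_mass"

lemma fejer_kernel_measurable [measurable]: "fejer_kernel \<in> borel_measurable borel"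
  unfolding fejer_kernel_def by measurable

lemma fejer_kernel_nonneg: "0 \<le> fejer_kernel z"
  using fejer_nonneg fejer_mass_pos by (simp add: fejer_kernel_def)

lemma integrable_fejer_kernel: "integrable lborel fejer_kernel"
  unfolding fejer_kernel_def[abs_def] by (simp add: integrable_fejer)

lemma integral_fejer_kernel: "(\<integral>z. fejer_kernel z \<partial>lborel) = 1"
  using fejer_mass_pos unfolding fejer_kernel_def fejer_mass_def[symmetric]
  by (simp add: fejer_mass_def)

text \<open>Concentration of the kernel: in the de-smoothing argument a majority of the mass must lie where the
smoothed function is controlled, and three quarters are enough to absorb the rest.\<close>
lemma fejer_kernel_tail:
  obtains b where "b > 0"
    "(\<integral>z. fejer_kernel z * indicator {-b..b} z \<partial>lborel) \<ge> 3 / 4"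
proof -
  have "(\<lambda>n. \<integral>z. fejer_kernel z * indicator {-real n..real n} z \<partial>lborel)
     \<longlonglongrightarrow> (\<integral>z. fejer_kernel z \<partial>lborel)"
  proof (rule integral_dominated_convergence[where w = fejer_kernel])
    show "AE z in lborel. (\<lambda>n. fejer_kernel z * indicator {-real n..real n} z) \<longlonglongrightarrow> fejer_kernel z"
    proof (rule AE_I2)
      fix z :: real
      have "\<forall>\<^sub>F n in sequentially. fejer_kernel z * indicator {-real n..real n} z = fejer_kernel z"
        using eventually_ge_at_top[of "nat \<lceil>\<bar>z\<bar>\<rceil>"]
      proof eventually_elim
        case (elim n)
        then have "\<bar>z\<bar> \<le> real n" by linarith
        then show ?case by (simp add: indicator_def abs_le_iff)
      qed
      then show "(\<lambda>n. fejer_kernel z * indicator {-real n..real n} z) \<longlonglongrightarrow> fejer_kernel z"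
        by (rule tendsto_eventually)
    qed
  qed (auto simp: integrable_fejer_kernel fejer_kernel_nonneg indicator_def)
  then have "\<forall>\<^sub>F n in sequentially. 3/4 < (\<integral>z. fejer_kernel z * indicator {-real n..real n} z \<partial>lborel)"
    by (intro order_tendstoD) (auto simp: integral_fejer_kernel)
  then have "\<forall>\<^sub>F n in sequentially. 3/4 < (\<integral>z. fejer_kernel z * indicator {-real n..real n} z \<partial>lborel) \<and> n > 0"
    using eventually_gt_at_top[of "0::nat"] by eventually_elim simp
  then obtain n where "3/4 < (\<integral>z. fejer_kernel z * indicator {-real n..real n} z \<partial>lborel)" "n > 0"
    using eventually_happens'[OF sequentially_bot] by blast
  then show ?thesis using that[of "real n"] by simp
qed

section \<open>Smoothing of distribution functions\<close>

lemma integrable_product: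
  fixes f :: "'a \<Rightarrow> complex" and g :: "'b \<Rightarrow> complex"
  assumes "sigma_finite_measure M" "sigma_finite_measure N"
    and f: "integrable M f" and g: "integrable N g"
  shows "integrable (M \<Otimes>\<^sub>M N) (\<lambda>(x, y). f x * g y)"
proof -
  interpret M: sigma_finite_measure M by fact
  interpret N: sigma_finite_measure N by fact
  interpret pair_sigma_finite M N ..
  have [measurable]: "f \<in> borel_measurable M" "g \<in> borel_measurable N" using f g by auto
  show ?thesis
  proof (rule Fubini_integrable)
    show "(\<lambda>(x, y). f x * g y) \<in> borel_measurable (M \<Otimes>\<^sub>M N)" by measurable
    have "integrable M (\<lambda>x. norm (f x) * (\<integral>y. norm (g y) \<partial>N))"
      using f by simp
    then show "integrable M (\<lambda>x. \<integral>y. norm (case (x, y) of (x, y) \<Rightarrow> f x * g y) \<partial>N)"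
      by (simp add: norm_mult)
  qed (use g in simp)
qed

lemma integrable_product_bounded:
  fixes f :: "'a \<Rightarrow> complex" and g :: "'b \<Rightarrow> complex" and h :: "'a \<Rightarrow> 'b \<Rightarrow> complex"
  assumes sf: "sigma_finite_measure M" "sigma_finite_measure N"
    and f: "integrable M f" and g: "integrable N g"
    and [measurable]: "case_prod h \<in> borel_measurable (M \<Otimes>\<^sub>M N)"
    and bd: "\<And>x y. norm (h x y) \<le> 1"
  shows "integrable (M \<Otimes>\<^sub>M N) (\<lambda>(x, y). f x * g y * h x y)"
proof (rule Bochner_Integration.integrable_bound[OF integrable_product[OF sf f g]])
  have [measurable]: "f \<in> borel_measurable M" "g \<in> borel_measurable N" using f g by auto
  show "(\<lambda>(x, y). f x * g y * h x y) \<in> borel_measurable (M \<Otimes>\<^sub>M N)" by measurable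
  show "AE x in M \<Otimes>\<^sub>M N. norm (case x of (x, y) \<Rightarrow> f x * g y * h x y)
      \<le> norm (case x of (x, y) \<Rightarrow> f x * g y)"
    using bd by (auto simp: norm_mult mult_left_le)
qed

text \<open>All exchanges of integrals below concern integrands \<open>f x * g y * h x y\<close> with integrable \<open>f\<close>, \<open>g\<close> and
a bounded \<open>h\<close>: an indicator or a complex exponential.\<close>
lemma Fubini_product_bounded:
  fixes f :: "'a \<Rightarrow> complex" and g :: "'b \<Rightarrow> complex" and h :: "'a \<Rightarrow> 'b \<Rightarrow> complex"
  assumes sf: "sigma_finite_measure M" "sigma_finite_measure N"
    and f: "integrable M f" and g: "integrable N g"
    and h: "case_prod h \<in> borel_measurable (M \<Otimes>\<^sub>M N)"
    and bd: "\<And>x y. norm (h x y) \<le> 1"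
  shows "(\<integral>x. f x * (\<integral>y. g y * h x y \<partial>N) \<partial>M) = (\<integral>y. g y * (\<integral>x. f x * h x y \<partial>M) \<partial>N)"
proof -
  interpret M: sigma_finite_measure M by fact
  interpret N: sigma_finite_measure N by fact
  interpret pair_sigma_finite M N ..
  have "(\<integral>x. \<integral>y. f x * g y * h x y \<partial>N \<partial>M) = (\<integral>y. \<integral>x. f x * g y * h x y \<partial>M \<partial>N)"
    using Fubini_integral[OF integrable_product_bounded[OF assms]] by simp
  moreover have "(\<integral>y. f x * g y * h x y \<partial>N) = f x * (\<integral>y. g y * h x y \<partial>N)" for x
    by (simp add: mult.assoc)
  moreover have "(\<integral>x. f x * g y * h x y \<partial>M) = g y * (\<integral>x. f x * h x y \<partial>M)" for y
    by (subst integral_mult_right_zero[symmetric]) (simp add: mult.assoc mult.left_commute)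
  ultimately show ?thesis by simp
qed

text \<open>The distribution function and the Fourier transform of the signed measure with density \<open>w\<close> with respect to
\<open>M\<close>. The Edgeworth expansion is not a distribution function, since its density takes negative values; in this
form (with \<open>M\<close> Lebesgue measure) it is treated by the same formula as the laws (with \<open>w = 1\<close>).\<close>
definition wcdf :: "real measure \<Rightarrow> (real \<Rightarrow> real) \<Rightarrow> real \<Rightarrow> real" where
  "wcdf M w x = (\<integral>y. w y * indicator {..x} y \<partial>M)"

definition wchar :: "real measure \<Rightarrow> (real \<Rightarrow> real) \<Rightarrow> real \<Rightarrow> complex" where
  "wchar M w t = (\<integral>y. of_real (w y) * iexp (t * y) \<partial>M)"

definition smooth :: "real \<Rightarrow> (real \<Rightarrow> real) \<Rightarrow> real \<Rightarrow> real" where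
  "smooth T H x = (\<integral>z. fejer_kernel z * H (x - z / T) \<partial>lborel)"

text \<open>The Fourier transform of the interval \<open>(a, b]\<close>, left as an integral so that it makes sense at \<open>s = 0\<close>.\<close>
definition iexp_interval :: "real \<Rightarrow> real \<Rightarrow> real \<Rightarrow> complex" where
  "iexp_interval a b s = (\<integral>u. indicator {a<..b} u * iexp (- (s * u)) \<partial>lborel)"

lemma iexp_interval_measurable [measurable]: "iexp_interval a b \<in> borel_measurable borel"
  unfolding iexp_interval_def by measurable

lemma integrable_indicator_Ioc: "integrable lborel (indicator {a<..b::real} :: real \<Rightarrow> complex)"
  proof -
  have "integrable lborel (\<lambda>u. complex_of_real (indicator {a<..b} u))"
    by (cases "a \<le> b") (auto simp: integrable_indicator_iff)
  moreover have "(\<lambda>u. complex_of_real (indicator {a<..b} u)) = indicator {a<..b}"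
    by (auto simp: fun_eq_iff indicator_def)
  ultimately show ?thesis by simp
qed

lemma norm_iexp_interval_le:
  assumes "a \<le> b" "s \<noteq> 0"
  shows "norm (iexp_interval a b s) \<le> 2 / \<bar>s\<bar>"
proof -
  have "iexp_interval a b s = (\<integral>u. indicator {a..b} u *\<^sub>R iexp (- (s * u)) \<partial>lborel)"
    unfolding iexp_interval_def
  proof (rule integral_cong_AE)
    show "AE u in lborel. indicator {a<..b} u * iexp (- (s * u)) = indicator {a..b} u *\<^sub>R iexp (- (s * u))"
      using AE_lborel_singleton[of a] by eventually_elim (auto simp: indicator_def)
  qed auto
  also have "\<dots> = (\<i> / s) * iexp (- (s * b)) - (\<i> / s) * iexp (- (s * a))"
  proof (rule integral_FTC_atLeastAtMost[OF assms(1)])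
    have ii: "(\<i> / s) * (- \<i> * s * z) = z" for z
    proof -
      have "(\<i> / s) * (- \<i> * s * z) = (\<i> * (- \<i>)) * (of_real s / of_real s) * z" by simp
      then show ?thesis using assms by simp
    qed
    fix x
    have "((\<lambda>u. iexp (- (s * u))) has_vector_derivative (- \<i> * s * iexp (- (s * x)))) (at x within {a..b})"
      by (rule has_vector_derivative_real_field derivative_eq_intros refl | simp)+
    from has_vector_derivative_mult_right[OF this, of "\<i> / s"]
    show "((\<lambda>u. (\<i> / s) * iexp (- (s * u))) has_vector_derivative iexp (- (s * x))) (at x within {a..b})"
      by (simp only: ii)
  qed (intro continuous_intros)
  also have "norm \<dots> \<le> norm ((\<i> / s) * iexp (- (s * b))) + norm ((\<i> / s) * iexp (- (s * a)))"
    by (rule norm_triangle_ineq4)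
  also have "\<dots> = 2 / \<bar>s\<bar>"
    by (simp add: norm_mult norm_divide del: of_real_minus of_real_mult)
  finally show ?thesis .
qed

lemma wcdf_measurable [measurable]:
  assumes "sigma_finite_measure M" "sets M = sets borel" "integrable M w"
  shows "wcdf M w \<in> borel_measurable borel"
proof -
  interpret sigma_finite_measure M by fact
  note [measurable_cong] = assms(2)
  have [measurable]: "w \<in> borel_measurable borel" using assms(3)
    by (metis borel_measurable_integrable assms(2) measurable_cong_sets)
  have "(\<lambda>x. \<integral>y. w y * (if y \<le> x then 1 else 0) \<partial>M) \<in> borel_measurable borel"
    by measurable
  then show ?thesis unfolding wcdf_def[abs_def] indicator_def by simp
qed

lemma wcdf_bounded:
  assumes "integrable M w" "sets M = sets borel"
  shows "\<bar>wcdf M w x\<bar> \<le> (\<integral>y. \<bar>w y\<bar> \<partial>M)"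
proof -
  note [measurable_cong] = assms(2)
  have "\<bar>wcdf M w x\<bar> \<le> (\<integral>y. \<bar>w y * indicator {..x} y\<bar> \<partial>M)"
    unfolding wcdf_def by (rule integral_abs_bound)
  also have "\<dots> \<le> (\<integral>y. \<bar>w y\<bar> \<partial>M)"
  proof (rule integral_mono)
    show "integrable M (\<lambda>y. \<bar>w y * indicator {..x} y\<bar>)"
      using assms by (intro integrable_abs integrable_real_mult_indicator) auto
  qed (use assms in \<open>auto simp: indicator_def\<close>)
  finally show ?thesis .
qed

lemma wcdf_at_bot:
  assumes "integrable M w" "sets M = sets borel"
  shows "(\<lambda>k. wcdf M w (x - real k)) \<longlonglongrightarrow> 0"
proof -
  note [measurable_cong] = assms(2)
  have [measurable]: "w \<in> borel_measurable M" using assms(1) by simp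
  have "(\<lambda>k. \<integral>y. w y * indicator {..x - real k} y \<partial>M) \<longlonglongrightarrow> (\<integral>y. 0 \<partial>M)"
  proof (rule integral_dominated_convergence[where w = "\<lambda>y. \<bar>w y\<bar>"])
    show "AE y in M. (\<lambda>k. w y * indicator {..x - real k} y) \<longlonglongrightarrow> 0"
    proof (rule AE_I2)
      fix y
      have "\<forall>\<^sub>F k in sequentially. w y * indicator {..x - real k} y = 0"
        using eventually_gt_at_top[of "nat \<lceil>x - y\<rceil>"]
      proof eventually_elim
        case (elim k)
        then have "x - y < real k" by linarith
        then show ?case by (simp add: indicator_def)
      qed
      then show "(\<lambda>k. w y * indicator {..x - real k} y) \<longlonglongrightarrow> 0" by (rule tendsto_eventually)
    qed
  qed (use assms in \<open>auto simp: indicator_def\<close>)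
  then show ?thesis by (simp add: wcdf_def)
qed

lemma wchar_measurable [measurable]:
  assumes "sigma_finite_measure M" "sets M = sets borel" "integrable M w"
  shows "wchar M w \<in> borel_measurable borel"
proof -
  interpret sigma_finite_measure M by fact
  note [measurable_cong] = assms(2)
  have [measurable]: "w \<in> borel_measurable borel" using assms(3)
    by (metis borel_measurable_integrable assms(2) measurable_cong_sets)
  show ?thesis unfolding wchar_def[abs_def] by measurable
qed

lemma norm_wchar_le:
  "norm (wchar M w t) \<le> (\<integral>y. \<bar>w y\<bar> \<partial>M)"
proof -
  have "norm (wchar M w t) \<le> (\<integral>y. norm (of_real (w y) * iexp (t * y)) \<partial>M)"
    unfolding wchar_def by (rule integral_norm_bound)
  then show ?thesis by (simp add: norm_mult del: of_real_mult)
qed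

lemma integrable_triangle: "integrable lborel (\<lambda>t. complex_of_real (triangle t))"
proof -
  have "integrable lborel triangle"
    by (rule Bochner_Integration.integrable_bound[of _ "indicator {-1..1} :: real \<Rightarrow> real"])
       (use triangle_bounds in \<open>auto simp: integrable_indicator_iff\<close>)
  then show ?thesis by simp
qed

lemma norm_iexp_interval_le_length:
  assumes "a \<le> b"
  shows "norm (iexp_interval a b s) \<le> b - a"
proof -
  have "norm (iexp_interval a b s) \<le> (\<integral>u. norm (indicator {a<..b} u * iexp (- (s * u))) \<partial>lborel)"
    unfolding iexp_interval_def by (rule integral_norm_bound)
  also have "\<dots> = (\<integral>u. indicator {a<..b} u \<partial>lborel)"
    by (intro Bochner_Integration.integral_cong) (auto simp: norm_mult indicator_def simp del: of_real_minus of_real_mult)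
  finally show ?thesis using \<open>a \<le> b\<close> by simp
qed

lemma integrable_triangle_interval:
  assumes "a \<le> b"
  shows "integrable lborel (\<lambda>t. of_real (triangle t) * iexp_interval a b (t * T))"
proof (rule Bochner_Integration.integrable_bound[OF integrable_mult_right[OF integrable_triangle, of "of_real (b - a)"]])
  show "AE t in lborel. norm (of_real (triangle t) * iexp_interval a b (t * T))
      \<le> norm (complex_of_real (b - a) * complex_of_real (triangle t))"
    using norm_iexp_interval_le_length triangle_bounds(1) \<open>a \<le> b\<close>
    by (intro AE_I2) (auto simp: norm_mult mult.commute[of "triangle _"] intro!: mult_right_mono simp del: of_real_diff)
qed simp

lemma integrable_triangle_interval_wchar:
  assumes "sigma_finite_measure M" "sets M = sets borel" "integrable M w" "a \<le> b"
  shows "integrable lborel (\<lambda>t. of_real (triangle t) * iexp_interval a b (t * T) * wchar M w (t * T))"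
proof (rule Bochner_Integration.integrable_bound[OF integrable_mult_right[OF integrable_triangle_interval[OF assms(4), of T], of "of_real (\<integral>y. \<bar>w y\<bar> \<partial>M)"]])
  note [measurable] = wchar_measurable[OF assms(1-3)]
  show "(\<lambda>t. of_real (triangle t) * iexp_interval a b (t * T) * wchar M w (t * T)) \<in> borel_measurable lborel"
    by measurable
  show "AE t in lborel. norm (of_real (triangle t) * iexp_interval a b (t * T) * wchar M w (t * T))
     \<le> norm (complex_of_real (\<integral>y. \<bar>w y\<bar> \<partial>M) * (of_real (triangle t) * iexp_interval a b (t * T)))"
    unfolding norm_mult[of _ "wchar M w _"] norm_mult[of "complex_of_real (\<integral>y. \<bar>w y\<bar> \<partial>M)"]
    using norm_wchar_le[of M w]
    by (intro AE_I2) (subst mult.commute, auto intro!: mult_right_mono)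
qed

text \<open>Increments of smoothed distribution functions in terms of Fourier transforms on a compact set. The left-hand
side integrates the smoothed indicator of \<open>(a, b]\<close> against the measure; that indicator is an integral of
exponentials by \<open>fejer_fourier\<close>, and integrating these against the measure first gives the right-hand side.
Working with increments avoids inverting a Fourier transform with its singularity at \<open>0\<close>.\<close>
lemma smooth_diff_wcdf:
  assumes sf: "sigma_finite_measure M" and M [measurable_cong]: "sets M = sets borel"
    and w: "integrable M w" and T: "T > 0" and "a \<le> b"
  shows "complex_of_real (\<integral>z. fejer_kernel z * (wcdf M w (b - z / T) - wcdf M w (a - z / T)) \<partial>lborel)
    = of_real (T / fejer_mass) *
        (\<integral>t. of_real (triangle t) * iexp_interval a b (t * T) * wchar M w (t * T) \<partial>lborel)"
proof -
  note lb = lborel.sigma_finite_measure_axioms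
  have [measurable]: "w \<in> borel_measurable borel" using w
    by (metis borel_measurable_integrable M measurable_cong_sets)
  have wc: "integrable M (\<lambda>y. complex_of_real (w y))" using w by simp
  have Kc: "integrable lborel (\<lambda>z. complex_of_real (fejer_kernel z))"
    using integrable_fejer_kernel by simp
  have wint: "integrable M (\<lambda>y. w y * indicator {..x} y)" for x
    using w by (intro integrable_real_mult_indicator) auto
  have diff: "wcdf M w (b - z / T) - wcdf M w (a - z / T)
     = (\<integral>y. w y * indicator {a<..b} (y + z / T) \<partial>M)" for z
    unfolding wcdf_def
    by (subst Bochner_Integration.integral_diff[symmetric, OF wint wint],
        rule Bochner_Integration.integral_cong)
       (use \<open>a \<le> b\<close> in \<open>auto simp: indicator_def\<close>)
  have E: "iexp_interval a b s = (\<integral>u. indicator {a<..b} u * iexp (- (s * u)) \<partial>lborel)" for s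
    by (simp add: iexp_interval_def)
  \<comment> \<open>The smoothed indicator of the interval at \<open>y\<close> depends on \<open>y\<close> through an exponential only.\<close>
  have A: "(\<integral>z. complex_of_real (fejer_kernel z) * indicator {a<..b} (y + z / T) \<partial>lborel)
    = of_real (T / fejer_mass) * (\<integral>t. of_real (triangle t) * iexp_interval a b (t * T) * iexp (t * T * y) \<partial>lborel)"
    for y
  proof -
    have "(\<integral>z. complex_of_real (fejer_kernel z) * indicator {a<..b} (y + z / T) \<partial>lborel)
      = T * (\<integral>u. complex_of_real (fejer_kernel (T * (u - y))) * indicator {a<..b} u \<partial>lborel)"
      using T by (subst lborel_integral_real_affine[where c = T and t = "- T * y"])
        (auto simp: scaleR_conv_of_real field_simps intro!: Bochner_Integration.integral_cong)
    also have "(\<integral>u. complex_of_real (fejer_kernel (T * (u - y))) * indicator {a<..b} u \<partial>lborel)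
      = (\<integral>u. indicator {a<..b} u * (\<integral>t. of_real (triangle t) * iexp (- (t * (T * (u - y)))) \<partial>lborel) \<partial>lborel) / fejer_mass"
      unfolding fejer_fourier fejer_kernel_def of_real_divide
      by (subst integral_divide_zero[symmetric]) (simp add: mult.commute)
    also have "(\<integral>u. indicator {a<..b} u * (\<integral>t. of_real (triangle t) * iexp (- (t * (T * (u - y)))) \<partial>lborel) \<partial>lborel)
      = (\<integral>t. of_real (triangle t) * (\<integral>u. indicator {a<..b} u * iexp (- (t * (T * (u - y)))) \<partial>lborel) \<partial>lborel)"
      by (rule Fubini_product_bounded[OF lb lb integrable_indicator_Ioc integrable_triangle]) (simp_all del: of_real_minus of_real_mult of_real_diff)
    also have "(\<lambda>t. \<integral>u. indicator {a<..b} u * iexp (- (t * (T * (u - y)))) \<partial>lborel)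
      = (\<lambda>t. iexp_interval a b (t * T) * iexp (t * T * y))"
      unfolding E
      by (subst integral_mult_left_zero[symmetric])
         (simp add: mult.assoc exp_add[symmetric] algebra_simps)
    finally show ?thesis by (simp add: mult.assoc)
  qed
  have "complex_of_real (\<integral>z. fejer_kernel z * (wcdf M w (b - z / T) - wcdf M w (a - z / T)) \<partial>lborel)
    = (\<integral>z. of_real (fejer_kernel z) * (\<integral>y. of_real (w y) * indicator {a<..b} (y + z / T) \<partial>M) \<partial>lborel)"
    unfolding diff integral_complex_of_real[symmetric] of_real_mult of_real_indicator ..
  also have "\<dots> = (\<integral>y. of_real (w y) * (\<integral>z. of_real (fejer_kernel z) * indicator {a<..b} (y + z / T) \<partial>lborel) \<partial>M)"
    by (rule Fubini_product_bounded[OF lb sf Kc wc]) (auto simp: indicator_def)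
  also have "\<dots> = of_real (T / fejer_mass) * (\<integral>y. of_real (w y) *
      (\<integral>t. (of_real (triangle t) * iexp_interval a b (t * T)) * iexp (t * T * y) \<partial>lborel) \<partial>M)"
    unfolding A by (simp add: mult.left_commute[of "complex_of_real (w _)"])
  also have "(\<integral>y. of_real (w y) *
      (\<integral>t. (of_real (triangle t) * iexp_interval a b (t * T)) * iexp (t * T * y) \<partial>lborel) \<partial>M)
     = (\<integral>t. (of_real (triangle t) * iexp_interval a b (t * T)) * wchar M w (t * T) \<partial>lborel)"
    unfolding wchar_def
    by (rule Fubini_product_bounded[OF sf lb wc integrable_triangle_interval[OF \<open>a \<le> b\<close>]]) (simp_all del: of_real_mult)
  finally show ?thesis .
qed

lemma integrable_kernel_bounded:
  assumes [measurable]: "H \<in> borel_measurable borel" and "\<And>x. \<bar>H x\<bar> \<le> B" and "T > 0"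
  shows "integrable lborel (\<lambda>z. fejer_kernel z * H (x - z / T))"
proof (rule Bochner_Integration.integrable_bound[of _ "\<lambda>z. fejer_kernel z * B"])
  show "AE z in lborel. norm (fejer_kernel z * H (x - z / T)) \<le> norm (fejer_kernel z * B)"
    using assms(2) fejer_kernel_nonneg
    by (intro AE_I2) (auto simp: abs_mult intro!: mult_left_mono intro: order.trans[OF _ abs_ge_self])
qed (use integrable_fejer_kernel in auto)

text \<open>A bound on a smoothed function bounds the function itself, if that function can decrease only at a bounded
rate. Where \<open>H\<close> is large and positive, it stays large for a while to the right; the kernel centred a little to
the right sees this with at least three quarters of its mass, and the rest costs at most a quarter of the
supremum \<open>\<Delta>\<close> of \<open>\<bar>H\<bar>\<close>. Symmetrically for negative values, to the left. The resulting inequality for \<open>\<Delta>\<close> is then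
solved for \<open>\<Delta>\<close>.\<close>
lemma desmoothing:
  fixes H :: "real \<Rightarrow> real"
  assumes [measurable]: "H \<in> borel_measurable borel"
    and bd: "\<And>x. \<bar>H x\<bar> \<le> B"
    and up: "\<And>x s. 0 \<le> s \<Longrightarrow> H (x + s) \<ge> H x - m * s"
    and T: "T > 0" and m: "m \<ge> 0" and b: "b > 0"
    and tail: "(\<integral>z. fejer_kernel z * indicator {-b..b} z \<partial>lborel) \<ge> 3 / 4"
    and sm: "\<And>x. \<bar>smooth T H x\<bar> \<le> \<eta>"
  shows "\<bar>H x\<bar> \<le> 2 * \<eta> + 4 * m * b / T"
proof -
  define \<Delta> where "\<Delta> = (SUP x. \<bar>H x\<bar>)"
  define p where "p = (\<integral>z. fejer_kernel z * indicator {-b..b} z \<partial>lborel)"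
  define l where "l = 2 * m * b / T"
  have l: "l \<ge> 0" using m b T by (simp add: l_def)
  have bdd: "bdd_above (range (\<lambda>x. \<bar>H x\<bar>))" using bd by (auto intro!: bdd_aboveI)
  have \<Delta>: "\<bar>H x\<bar> \<le> \<Delta>" for x
    unfolding \<Delta>_def by (rule cSUP_upper) (auto simp: bdd)
  have intp: "integrable lborel (\<lambda>z. fejer_kernel z * indicator {-b..b} z)"
    by (intro integrable_real_mult_indicator integrable_fejer_kernel) auto
  have p1: "p \<le> 1"
    unfolding p_def integral_fejer_kernel[symmetric]
    by (intro integral_mono intp integrable_fejer_kernel) (auto simp: indicator_def fejer_kernel_nonneg)
  have \<Delta>0: "\<Delta> \<ge> 0" using \<Delta>[of 0] by simp
  have low: "(\<integral>z. fejer_kernel z * (c * indicator {-b..b} z - \<Delta> * (1 - indicator {-b..b} z)) \<partial>lborel) = c * p - \<Delta> * (1 - p)" for c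
  proof -
    have "(\<integral>z. fejer_kernel z * (c * indicator {-b..b} z - \<Delta> * (1 - indicator {-b..b} z)) \<partial>lborel)
      = (\<integral>z. c * (fejer_kernel z * indicator {-b..b} z) - \<Delta> * (fejer_kernel z - fejer_kernel z * indicator {-b..b} z) \<partial>lborel)"
      by (simp add: algebra_simps)
    also have "\<dots> = c * p - \<Delta> * (1 - p)"
      using intp integrable_fejer_kernel by (simp add: p_def integral_fejer_kernel)
    finally show ?thesis .
  qed
  have intlow: "integrable lborel (\<lambda>z. fejer_kernel z * (c * indicator {-b..b} z - \<Delta> * (1 - indicator {-b..b} z)))" for c
  proof -
    have "integrable lborel (\<lambda>z. c * (fejer_kernel z * indicator {-b..b} z) - \<Delta> * (fejer_kernel z - fejer_kernel z * indicator {-b..b} z))"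
      using intp integrable_fejer_kernel by simp
    then show ?thesis by (simp add: algebra_simps)
  qed
  have key: "(d - l) * p - \<Delta> * (1 - p) \<le> \<eta> \<Longrightarrow> 0 \<le> d \<Longrightarrow> 3/4 * d \<le> \<eta> + l + \<Delta> / 4" for d
  proof -
    assume 1: "(d - l) * p - \<Delta> * (1 - p) \<le> \<eta>" and d: "0 \<le> d"
    have "3/4 * d \<le> p * d" using tail d by (intro mult_right_mono) (auto simp: p_def)
    moreover have "l * p \<le> l" using l p1 by (simp add: mult_left_le)
    moreover have "\<Delta> * (1 - p) \<le> \<Delta> * (1/4)"
      using \<Delta>0 tail by (intro mult_left_mono) (auto simp: p_def)
    ultimately show ?thesis using 1 by (simp add: algebra_simps)
  qed
  have bound: "3/4 * \<bar>H x\<bar> \<le> \<eta> + l + \<Delta> / 4" for x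
  proof (cases "H x \<ge> 0")
    case True
    have "(H x - l) * p - \<Delta> * (1 - p) \<le> smooth T H (x + b / T)"
      unfolding low[symmetric] smooth_def
    proof (intro integral_mono intlow integrable_kernel_bounded[OF _ bd T] mult_left_mono fejer_kernel_nonneg)
      fix z
      show "(H x - l) * indicator {-b..b} z - \<Delta> * (1 - indicator {-b..b} z) \<le> H (x + b / T - z / T)"
      proof (cases "z \<in> {-b..b}")
        case True
        then have "(b - z) / T \<ge> 0" "(b - z) / T \<le> 2 * b / T" using T by (auto simp: divide_right_mono)
        then have "H (x + (b - z) / T) \<ge> H x - m * ((b - z) / T)" "m * ((b - z) / T) \<le> m * (2 * b / T)"
          using up m by (blast, blast intro: mult_left_mono)
        then show ?thesis using True by (simp add: l_def diff_divide_distrib algebra_simps)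
      next
        case False
        then show ?thesis using \<Delta>[of "x + b / T - z / T"] by simp
      qed
    qed simp
    also have "\<dots> \<le> \<eta>" using sm[of "x + b / T"] by simp
    finally show ?thesis using key True by simp
  next
    case False
    have "smooth T H (x - b / T) \<le> - ((- H x - l) * p - \<Delta> * (1 - p))"
      unfolding low[symmetric] smooth_def Bochner_Integration.integral_minus[symmetric] mult_minus_right[symmetric]
    proof (intro integral_mono integrable_kernel_bounded[OF _ bd T] mult_left_mono fejer_kernel_nonneg)
      show "integrable lborel (\<lambda>z. fejer_kernel z * - ((- H x - l) * indicator {-b..b} z - \<Delta> * (1 - indicator {-b..b} z)))"
        using intlow[of "- H x - l"] by (simp only: mult_minus_right Bochner_Integration.integrable_minus)
      fix z
      show "H (x - b / T - z / T) \<le> - ((- H x - l) * indicator {-b..b} z - \<Delta> * (1 - indicator {-b..b} z))"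
      proof (cases "z \<in> {-b..b}")
        case True
        then have "(b + z) / T \<ge> 0" "(b + z) / T \<le> 2 * b / T" using T by (auto simp: divide_right_mono)
        then have "H (x - (b + z) / T + (b + z) / T) \<ge> H (x - (b + z) / T) - m * ((b + z) / T)" "m * ((b + z) / T) \<le> m * (2 * b / T)"
          using up m by (blast, blast intro: mult_left_mono)
        then show ?thesis using True by (simp add: l_def add_divide_distrib algebra_simps)
      next
        case False
        then show ?thesis using \<Delta>[of "x - b / T - z / T"] by simp
      qed
    qed simp
    then have "(- H x - l) * p - \<Delta> * (1 - p) \<le> \<eta>" using sm[of "x - b / T"] by linarith
    then show ?thesis using key[of "- H x"] False by simp
  qed
  have *: "\<bar>H x\<bar> \<le> 4/3 * (\<eta> + l + \<Delta> / 4)" for x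
    using bound[of x] by simp
  have "\<Delta> \<le> 4/3 * (\<eta> + l + \<Delta> / 4)"
    unfolding \<Delta>_def by (rule cSUP_least) (use * in \<open>auto simp: \<Delta>_def\<close>)
  then have "\<Delta> \<le> 2 * \<eta> + 2 * l" by argo
  then show ?thesis using \<Delta>[of x] by (simp add: l_def)
qed

lemma wcdf_one: "real_distribution M \<Longrightarrow> wcdf M (\<lambda>_. 1) = cdf M"
proof -
  assume "real_distribution M"
  then interpret real_distribution M .
  show ?thesis by (auto simp: wcdf_def cdf_def fun_eq_iff)
qed

lemma wchar_one: "wchar M (\<lambda>_. 1) = char M"
  by (simp add: wchar_def char_def fun_eq_iff)

text \<open>The weighted distance of two Fourier transforms on \<open>\<bar>t\<bar> \<le> T\<close> in the smoothing inequality, rescaled to the unit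
interval; it is extended-real-valued, so that no integrability at \<open>0\<close> has to be established in advance.\<close>
definition smoothing_error :: "(real \<Rightarrow> complex) \<Rightarrow> (real \<Rightarrow> complex) \<Rightarrow> real \<Rightarrow> ennreal" where
  "smoothing_error f g T =
    (\<integral>\<^sup>+t. ennreal (norm (f (t * T) - g (t * T)) / \<bar>t\<bar>) * indicator {-1..1} t \<partial>lborel)"

lemma smooth_at_bot:
  assumes [measurable]: "H \<in> borel_measurable borel" and bd: "\<And>x. \<bar>H x\<bar> \<le> B" and T: "T > 0"
    and lim: "\<And>x. (\<lambda>k. H (x - real k)) \<longlonglongrightarrow> 0"
  shows "(\<lambda>k. smooth T H (x - real k)) \<longlonglongrightarrow> 0"
proof -
  have "(\<lambda>k. \<integral>z. fejer_kernel z * H (x - real k - z / T) \<partial>lborel) \<longlonglongrightarrow> (\<integral>z. 0 \<partial>(lborel::real measure))"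
  proof (rule integral_dominated_convergence[where w = "\<lambda>z. fejer_kernel z * B"])
    show "AE z in lborel. (\<lambda>k. fejer_kernel z * H (x - real k - z / T)) \<longlonglongrightarrow> 0"
      using tendsto_mult_right_zero[OF lim[of "x - z / T" for z]]
      by (intro AE_I2) (simp add: algebra_simps)
    show "AE z in lborel. norm (fejer_kernel z * H (x - real k - z / T)) \<le> fejer_kernel z * B" for k
      using bd fejer_kernel_nonneg by (intro AE_I2) (auto simp: abs_mult intro!: mult_left_mono)
  qed (use integrable_fejer_kernel in auto)
  then show ?thesis by (simp add: smooth_def)
qed

text \<open>Esseen's smoothing inequality. The increments of the smoothed difference \<open>H\<close> are bounded by the Fourier
integral; letting the left endpoint tend to \<open>-\<infinity>\<close>, where \<open>H\<close> vanishes, bounds the smoothed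
difference itself, and \<open>desmoothing\<close> applies because a distribution function increases and its approximation is
Lipschitz.\<close>
theorem esseen_smoothing:
  obtains C :: real where "C > 0"
    and "\<And>M N w m T x. real_distribution M \<Longrightarrow> sigma_finite_measure N \<Longrightarrow> sets N = sets borel \<Longrightarrow> integrable N w \<Longrightarrow>
     (\<And>x y. \<bar>wcdf N w x - wcdf N w y\<bar> \<le> m * \<bar>x - y\<bar>) \<Longrightarrow> T > 0 \<Longrightarrow>
     ennreal \<bar>cdf M x - wcdf N w x\<bar> \<le> C * smoothing_error (char M) (wchar N w) T + ennreal (C * m / T)"
proof -
  obtain b where b: "b > 0" and tail: "(\<integral>z. fejer_kernel z * indicator {-b..b} z \<partial>lborel) \<ge> 3 / 4"
    by (rule fejer_kernel_tail)
  define C where "C = max (4 / fejer_mass) (4 * b)"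
  have C: "C > 0" "4 / fejer_mass \<le> C" "4 * b \<le> C" using b by (auto simp: C_def)
  show ?thesis
  proof (rule that[OF C(1)])
    fix M N :: "real measure" and w :: "real \<Rightarrow> real" and m T x :: real
    assume M: "real_distribution M" and N: "sigma_finite_measure N" "sets N = sets borel" and w: "integrable N w"
      and lip: "\<And>x y. \<bar>wcdf N w x - wcdf N w y\<bar> \<le> m * \<bar>x - y\<bar>" and T: "T > 0"
    interpret M: real_distribution M by fact
    have one: "integrable M (\<lambda>_. 1::real)" by simp
    have Ms: "sigma_finite_measure M" "sets M = sets borel" by unfold_locales simp
    define H where "H x = wcdf M (\<lambda>_. 1) x - wcdf N w x" for x
    define B where "B = 1 + (\<integral>y. \<bar>w y\<bar> \<partial>N)"
    note [measurable] = wcdf_measurable[OF Ms one] wcdf_measurable[OF N w]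
    have [measurable]: "H \<in> borel_measurable borel" unfolding H_def[abs_def] by measurable
    have B: "\<bar>H x\<bar> \<le> B" for x
      using wcdf_bounded[OF one Ms(2), of x] wcdf_bounded[OF w N(2), of x] M.prob_space
      by (simp add: H_def B_def)
    have m: "m \<ge> 0" using lip[of 1 0] by simp
    define I where "I = smoothing_error (char M) (wchar N w) T"
    have up: "H (x + s) \<ge> H x - m * s" if "0 \<le> s" for x s
      using lip[of "x + s" x] that M.cdf_nondecreasing[of x "x + s"]
      by (simp add: H_def wcdf_one[OF M])
    have Hlim: "(\<lambda>k. H (x - real k)) \<longlonglongrightarrow> 0" for x
      unfolding H_def using tendsto_diff[OF wcdf_at_bot[OF one Ms(2)] wcdf_at_bot[OF w N(2)]] by simp
    show "ennreal \<bar>cdf M x - wcdf N w x\<bar> \<le> C * smoothing_error (char M) (wchar N w) T + ennreal (C * m / T)"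
    proof (cases "I = \<infinity>")
      case True
      then show ?thesis using C by (simp add: I_def[symmetric] ennreal_mult_top)
    next
      case False
      then obtain i where i: "i \<ge> 0" "I = ennreal i" by (cases I) auto
      \<comment> \<open>This bound is uniform in \<open>u\<close>, which is sent to \<open>-\<infinity>\<close> below.\<close>
      have incr: "\<bar>smooth T H v - smooth T H u\<bar> \<le> 2 / fejer_mass * i" if "u \<le> v" for u v
      proof -
        let ?G = "\<lambda>t. of_real (triangle t) * iexp_interval u v (t * T)"
        have "smooth T H v - smooth T H u
          = (\<integral>z. fejer_kernel z * (H (v - z / T) - H (u - z / T)) \<partial>lborel)"
          unfolding smooth_def
          by (subst Bochner_Integration.integral_diff[symmetric])
             (auto intro!: integrable_kernel_bounded B T simp: algebra_simps)
        also have "\<dots> = (\<integral>z. fejer_kernel z * (wcdf M (\<lambda>_. 1) (v - z / T) - wcdf M (\<lambda>_. 1) (u - z / T)) \<partial>lborel)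
           - (\<integral>z. fejer_kernel z * (wcdf N w (v - z / T) - wcdf N w (u - z / T)) \<partial>lborel)"
          unfolding H_def
          by (subst Bochner_Integration.integral_diff[symmetric])
             (auto simp: algebra_simps intro!: integrable_kernel_bounded wcdf_bounded one w Ms N T)
        finally have diff: "smooth T H v - smooth T H u = \<dots>" .
        have eq: "complex_of_real (smooth T H v - smooth T H u) = of_real (T / fejer_mass) *
           ((\<integral>t. ?G t * wchar M (\<lambda>_. 1) (t * T) \<partial>lborel) - (\<integral>t. ?G t * wchar N w (t * T) \<partial>lborel))"
          unfolding diff of_real_diff smooth_diff_wcdf[OF Ms one T that, unfolded of_real_diff]
            smooth_diff_wcdf[OF N w T that, unfolded of_real_diff]
          by (rule right_diff_distrib[symmetric])
        have "complex_of_real (smooth T H v - smooth T H u) = of_real (T / fejer_mass) *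
           (\<integral>t. ?G t * (char M (t * T) - wchar N w (t * T)) \<partial>lborel)"
          unfolding eq wchar_one[symmetric]
          by (subst Bochner_Integration.integral_diff[symmetric])
             (rule integrable_triangle_interval_wchar[OF Ms one that] integrable_triangle_interval_wchar[OF N w that]
                | simp only: right_diff_distrib)+
        then have "norm (complex_of_real (smooth T H v - smooth T H u)) = T / fejer_mass *
            norm (\<integral>t. ?G t * (char M (t * T) - wchar N w (t * T)) \<partial>lborel)"
          using T fejer_mass_pos by (simp only: norm_mult norm_of_real) simp
        then have 1: "\<bar>smooth T H v - smooth T H u\<bar> = T / fejer_mass *
            norm (\<integral>t. ?G t * (char M (t * T) - wchar N w (t * T)) \<partial>lborel)"
          by (simp only: norm_of_real)
        have "ennreal (norm (\<integral>t. ?G t * (char M (t * T) - wchar N w (t * T)) \<partial>lborel))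
           \<le> (\<integral>\<^sup>+t. norm (?G t * (char M (t * T) - wchar N w (t * T))) \<partial>lborel)"
          unfolding wchar_one[symmetric] right_diff_distrib
          by (intro integral_norm_bound_ennreal Bochner_Integration.integrable_diff integrable_triangle_interval_wchar one w Ms N that)
        also have "\<dots> \<le> (\<integral>\<^sup>+t. ennreal (2 / T) * (ennreal (norm (char M (t * T) - wchar N w (t * T)) / \<bar>t\<bar>) * indicator {-1..1} t) \<partial>lborel)"
        proof (rule nn_integral_mono_AE)
          show "AE t in lborel. ennreal (norm (?G t * (char M (t * T) - wchar N w (t * T))))
             \<le> ennreal (2 / T) * (ennreal (norm (char M (t * T) - wchar N w (t * T)) / \<bar>t\<bar>) * indicator {-1..1} t)"
            using AE_lborel_singleton[of 0]
          proof eventually_elim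
            case (elim t)
            have "norm (iexp_interval u v (t * T)) \<le> 2 / \<bar>t * T\<bar>"
              using elim T by (intro norm_iexp_interval_le[OF that]) auto
            then have "norm (?G t) \<le> indicator {-1..1} t * (2 / \<bar>t * T\<bar>)"
              unfolding norm_mult norm_of_real using triangle_bounds[of t]
              by (intro mult_mono) auto
            then have "norm (?G t * (char M (t * T) - wchar N w (t * T))) \<le>
               indicator {-1..1} t * (2 / \<bar>t * T\<bar>) * norm (char M (t * T) - wchar N w (t * T))"
              unfolding norm_mult[of "?G t"] by (rule mult_right_mono) simp
            also have "\<dots> = 2 / T * (norm (char M (t * T) - wchar N w (t * T)) / \<bar>t\<bar> * indicator {-1..1} t)"
              using T by (simp add: abs_mult ac_simps)
            finally show ?case using T
              by (auto simp: ennreal_mult[symmetric] indicator_def split: if_splits intro!: ennreal_leI)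
          qed
        qed
        also have "\<dots> = ennreal (2 / T) * I"
          unfolding I_def smoothing_error_def
          by (rule nn_integral_cmult) (use wchar_measurable[OF N w] in measurable)
        also have "\<dots> = ennreal (2 / T * i)" using i T by (simp add: ennreal_mult[symmetric])
        finally have "norm (\<integral>t. ?G t * (char M (t * T) - wchar N w (t * T)) \<partial>lborel) \<le> 2 / T * i"
          using i T by simp
        then have "T / fejer_mass * norm (\<integral>t. ?G t * (char M (t * T) - wchar N w (t * T)) \<partial>lborel) \<le> T / fejer_mass * (2 / T * i)"
          using T fejer_mass_pos by (intro mult_left_mono) auto
        then show ?thesis unfolding 1 using T by simp
      qed
      have sm: "\<bar>smooth T H v\<bar> \<le> 2 / fejer_mass * i" for v
      proof (rule LIMSEQ_le_const2)
        have "(\<lambda>k. \<bar>smooth T H v - smooth T H (v - real k)\<bar>) \<longlonglongrightarrow> \<bar>smooth T H v - 0\<bar>"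
          by (intro tendsto_intros smooth_at_bot[OF _ B T Hlim]) simp
        then show "(\<lambda>k. \<bar>smooth T H v - smooth T H (v - real k)\<bar>) \<longlonglongrightarrow> \<bar>smooth T H v\<bar>" by simp
      qed (use incr in auto)
      have "\<bar>H x\<bar> \<le> 2 * (2 / fejer_mass * i) + 4 * m * b / T"
        by (rule desmoothing[OF _ B up T m b tail sm]) simp
      also have "\<dots> \<le> C * i + C * m / T"
        using mult_right_mono[OF C(2) i(1)] mult_right_mono[OF C(3) m] T
        by (intro add_mono divide_right_mono) (auto simp: algebra_simps)
      finally show ?thesis using i C m T
        by (simp add: I_def[symmetric] H_def wcdf_one[OF M] ennreal_mult[symmetric] ennreal_plus[symmetric] del: ennreal_plus)
    qed
  qed
qed

section \<open>The Edgeworth correction of the normal law\<close>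

lemma DERIV_std_normal_density:
  "(std_normal_density has_real_derivative - (x * std_normal_density x)) (at x within S)"
  unfolding std_normal_density_def[abs_def]
  by (auto intro!: derivative_eq_intros simp: field_simps)

lemma continuous_on_std_normal_density [continuous_intros]:
  "continuous_on S std_normal_density"
  by (rule DERIV_continuous_on) (rule DERIV_std_normal_density)

lemma tendsto_std_normal_density_poly:
  "((\<lambda>x. x ^ k * std_normal_density x) \<longlongrightarrow> 0) at_top"
  "((\<lambda>x. x ^ k * std_normal_density x) \<longlongrightarrow> 0) at_bot"
proof -
  have "((\<lambda>x::real. x ^ k * (1 / sqrt (2 * pi) * exp (- x\<^sup>2 / 2))) \<longlongrightarrow> 0) at_top"
    by real_asymp
  then show *: "((\<lambda>x. x ^ k * std_normal_density x) \<longlongrightarrow> 0) at_top"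
    unfolding std_normal_density_def .
  have "((\<lambda>x. (-1) ^ k * ((- x) ^ k * std_normal_density (- x))) \<longlongrightarrow> (-1)^k * 0) at_bot"
    by (intro tendsto_mult_left filterlim_compose[OF * filterlim_uminus_at_top_at_bot])
  then show "((\<lambda>x. x ^ k * std_normal_density x) \<longlongrightarrow> 0) at_bot"
    by (simp add: std_normal_density_def mult.assoc[symmetric] power_mult_distrib[symmetric])
qed

text \<open>Integration by parts against the normal density \<open>\<phi>\<close>. The hypothesis on \<open>p\<close> says that \<open>(p * \<phi>)' = - q * \<phi>\<close>, so
that passing from \<open>p\<close> to \<open>q\<close> multiplies the Fourier transform by \<open>\<i> * t\<close>. It is used for consecutive Hermite
polynomials.\<close>
lemma std_normal_parts:
  fixes p q :: "real \<Rightarrow> real"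
  assumes p: "\<And>x. (p has_real_derivative x * p x - q x) (at x)"
    and cq: "continuous_on UNIV q"
    and ip: "integrable lborel (\<lambda>x. p x * std_normal_density x)"
    and iq: "integrable lborel (\<lambda>x. q x * std_normal_density x)"
    and top: "((\<lambda>x. p x * std_normal_density x) \<longlongrightarrow> 0) at_top"
    and bot: "((\<lambda>x. p x * std_normal_density x) \<longlongrightarrow> 0) at_bot"
  shows "wchar lborel (\<lambda>x. q x * std_normal_density x) t
     = \<i> * t * wchar lborel (\<lambda>x. p x * std_normal_density x) t"
    and "wcdf lborel (\<lambda>x. q x * std_normal_density x) x = - (p x * std_normal_density x)"
proof -
  let ?n = std_normal_density
  have D: "((\<lambda>x. p x * ?n x) has_real_derivative - (q x * ?n x)) (at x)" for x
    by (rule derivative_eq_intros DERIV_std_normal_density p refl)+ (simp add: algebra_simps)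
  have cp: "continuous_on UNIV p" by (rule DERIV_continuous_on) (rule p)
  have cont: "isCont p x" "isCont q x" "isCont ?n x" for x
    using cp cq continuous_on_std_normal_density[of UNIV]
    by (auto simp: continuous_on_eq_continuous_at)
  have Dc: "((\<lambda>x. of_real (p x * ?n x) * iexp (t * x)) has_vector_derivative
      (\<i> * t * (of_real (p x * ?n x) * iexp (t * x)) - of_real (q x * ?n x) * iexp (t * x))) (at x)" for x
  proof -
    have 1: "((\<lambda>x. complex_of_real (p x * ?n x)) has_vector_derivative of_real (- (q x * ?n x))) (at x)"
      using D[of x] by (auto simp: has_vector_derivative_complex_iff)
    have 2: "((\<lambda>x. iexp (t * x)) has_vector_derivative (\<i> * t * iexp (t * x))) (at x)"
      by (auto intro!: derivative_eq_intros simp: Re_exp Im_exp has_vector_derivative_complex_iff)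
    show ?thesis
      using has_vector_derivative_mult[OF 1 2] by (simp add: algebra_simps)
  qed
  have int: "integrable lborel (\<lambda>x. of_real (r x) * iexp (t * x))" if "integrable lborel r" for r :: "real \<Rightarrow> real"
  proof (rule Bochner_Integration.integrable_bound)
    show "integrable lborel r" by fact
    then have [measurable]: "r \<in> borel_measurable borel" by auto
    show "(\<lambda>x. of_real (r x) * iexp (t * x)) \<in> borel_measurable lborel" by measurable
  qed (simp add: norm_mult del: of_real_mult)
  have lim: "((\<lambda>x. of_real (p x * ?n x) * iexp (t * x)) \<longlongrightarrow> 0) F"
    if "((\<lambda>x. p x * ?n x) \<longlongrightarrow> 0) F" for F
    using tendsto_norm_zero[OF that] by (rule_tac tendsto_norm_zero_cancel) (simp add: norm_mult abs_mult del: of_real_mult)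
  have "(LBINT x=-\<infinity>..\<infinity>. \<i> * t * (of_real (p x * ?n x) * iexp (t * x)) - of_real (q x * ?n x) * iexp (t * x)) = 0 - 0"
  proof (rule interval_integral_FTC_integrable)
    show "isCont (\<lambda>x. \<i> * t * (of_real (p x * ?n x) * iexp (t * x)) - of_real (q x * ?n x) * iexp (t * x)) x" for x
      using cont by (intro continuous_intros) auto
    show "set_integrable lborel (einterval (- \<infinity>) \<infinity>)
      (\<lambda>x. \<i> * t * (of_real (p x * ?n x) * iexp (t * x)) - of_real (q x * ?n x) * iexp (t * x))"
      using int[OF ip] int[OF iq] by (simp add: set_integrable_def del: of_real_mult)
  qed (use Dc lim[OF top] lim[OF bot] in \<open>simp_all add: ereal_tendsto_simps del: of_real_mult\<close>)
  then have "(\<integral>x. \<i> * t * (of_real (p x * ?n x) * iexp (t * x)) - of_real (q x * ?n x) * iexp (t * x) \<partial>lborel) = 0"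
    by (simp add: interval_lebesgue_integral_def set_lebesgue_integral_def del: of_real_mult)
  then show "wchar lborel (\<lambda>x. q x * std_normal_density x) t
     = \<i> * t * wchar lborel (\<lambda>x. p x * std_normal_density x) t"
    unfolding wchar_def
    by (subst (asm) Bochner_Integration.integral_diff) (use int[OF ip] int[OF iq] in \<open>auto simp del: of_real_mult simp: mult.assoc\<close>)
  have "(LBINT y=-\<infinity>..ereal x. - (q y * ?n y)) = p x * ?n x - 0"
  proof (rule interval_integral_FTC_integrable)
    show "isCont (\<lambda>y. - (q y * ?n y)) y" for y
      using cont by (intro continuous_intros) auto
    show "set_integrable lborel (einterval (- \<infinity>) (ereal x)) (\<lambda>y. - (q y * ?n y))"
      unfolding set_integrable_def by (intro integrable_mult_indicator) (use iq in auto)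
    have "isCont (\<lambda>y. p y * ?n y) x" using cont by (intro continuous_intros) auto
    then have "((\<lambda>y. p y * ?n y) \<longlongrightarrow> p x * ?n x) (at_left x)"
      by (simp add: isCont_def filterlim_at_split)
    then show "(((\<lambda>y. p y * ?n y) \<circ> real_of_ereal) \<longlongrightarrow> p x * ?n x) (at_left (ereal x))"
      by (simp only: ereal_tendsto_simps)
    show "((\<lambda>y. p y * ?n y) has_vector_derivative - (q y * ?n y)) (at y)" for y
      using D by (simp only: has_real_derivative_iff_has_vector_derivative)
    show "(((\<lambda>y. p y * ?n y) \<circ> real_of_ereal) \<longlongrightarrow> 0) (at_right (- \<infinity>))"
      using bot by (simp only: ereal_tendsto_simps)
  qed simp
  moreover have "wcdf lborel (\<lambda>x. q x * ?n x) x = (LBINT y=-\<infinity>..ereal x. q y * ?n y)"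
    unfolding wcdf_def interval_lebesgue_integral_def set_lebesgue_integral_def
  proof -
    have "(\<integral>y. q y * ?n y * indicator {..x} y \<partial>lborel)
        = (\<integral>y. indicator (einterval (-\<infinity>) (ereal x)) y *\<^sub>R (q y * ?n y) \<partial>lborel)"
    proof (rule integral_cong_AE)
      show "AE y in lborel. q y * ?n y * indicator {..x} y = indicator (einterval (-\<infinity>) (ereal x)) y *\<^sub>R (q y * ?n y)"
        using AE_lborel_singleton[of x] by eventually_elim (auto simp: indicator_def einterval_def)
      have [measurable]: "(\<lambda>y. q y * ?n y) \<in> borel_measurable borel" using iq by auto
      show "(\<lambda>y. q y * ?n y * indicator {..x} y) \<in> borel_measurable lborel"
        "(\<lambda>y. indicator (einterval (-\<infinity>) (ereal x)) y *\<^sub>R (q y * ?n y)) \<in> borel_measurable lborel"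
        by measurable
    qed
    then show "(\<integral>y. q y * ?n y * indicator {..x} y \<partial>lborel) =
       (if - \<infinity> \<le> ereal x then \<integral>y. indicator (einterval (-\<infinity>) (ereal x)) y *\<^sub>R (q y * ?n y) \<partial>lborel
        else - (\<integral>y. indicator (einterval (ereal x) (-\<infinity>)) y *\<^sub>R (q y * ?n y) \<partial>lborel))"
      by simp
  qed
  ultimately show "wcdf lborel (\<lambda>x. q x * std_normal_density x) x = - (p x * std_normal_density x)"
    by (simp add: interval_lebesgue_integral_def set_lebesgue_integral_def)
qed

lemma wchar_std_normal: "wchar lborel std_normal_density t = exp (- (t\<^sup>2) / 2)"
proof -
  have "wchar lborel std_normal_density t = char std_normal_distribution t"
    unfolding wchar_def char_def by (subst integral_density) (auto simp: scaleR_conv_of_real)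
  then show ?thesis by (simp add: char_std_normal_distribution)
qed

lemma wcdf_std_normal: "wcdf lborel std_normal_density x = cdf std_normal_distribution x"
proof -
  interpret real_distribution std_normal_distribution by (rule real_dist_normal_dist)
  have "cdf std_normal_distribution x = (\<integral>y. indicator {..x} y \<partial>std_normal_distribution)"
    by (simp add: cdf_def)
  also have "\<dots> = wcdf lborel std_normal_density x"
    unfolding wcdf_def by (subst integral_density) auto
  finally show ?thesis ..
qed

lemma integrable_poly_normal:
  "integrable lborel (\<lambda>x. x ^ k * std_normal_density x)"
  using integrable_std_normal_moment[of k] by (simp add: mult.commute)

definition hermite3 :: "real \<Rightarrow> real" where
  "hermite3 x = x ^ 3 - 3 * x"

lemma hermite_integrable:
  "integrable lborel (\<lambda>x. x * std_normal_density x)"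
  "integrable lborel (\<lambda>x. (x\<^sup>2 - 1) * std_normal_density x)"
  "integrable lborel (\<lambda>x. hermite3 x * std_normal_density x)"
  using integrable_poly_normal[of 1] integrable_poly_normal[of 2] integrable_poly_normal[of 3]
  by (auto simp: hermite3_def left_diff_distrib mult.assoc)

lemma hermite3_normal:
  shows wchar_hermite3: "wchar lborel (\<lambda>x. hermite3 x * std_normal_density x) t = (\<i> * t) ^ 3 * exp (- (t\<^sup>2) / 2)"
    and wcdf_hermite3: "wcdf lborel (\<lambda>x. hermite3 x * std_normal_density x) x = (1 - x\<^sup>2) * std_normal_density x"
proof -
  have cont: "continuous_on UNIV (\<lambda>x::real. x)" "continuous_on UNIV (\<lambda>x::real. x\<^sup>2 - 1)" "continuous_on UNIV hermite3"
    unfolding hermite3_def[abs_def] by (intro continuous_intros)+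
  have lim: "((\<lambda>x. 1 * std_normal_density x) \<longlongrightarrow> 0) F" "((\<lambda>x. x * std_normal_density x) \<longlongrightarrow> 0) F"
     "((\<lambda>x. (x\<^sup>2 - 1) * std_normal_density x) \<longlongrightarrow> 0) F" if "F = at_top \<or> F = at_bot" for F
  proof -
    have k: "((\<lambda>x. x ^ k * std_normal_density x) \<longlongrightarrow> 0) F" for k
      using that tendsto_std_normal_density_poly by blast
    show "((\<lambda>x. 1 * std_normal_density x) \<longlongrightarrow> 0) F" "((\<lambda>x. x * std_normal_density x) \<longlongrightarrow> 0) F"
     "((\<lambda>x. (x\<^sup>2 - 1) * std_normal_density x) \<longlongrightarrow> 0) F"
      using k[of 0] k[of 1] tendsto_diff[OF k[of 2] k[of 0]] by (simp_all add: left_diff_distrib)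
  qed
  have 1: "wchar lborel (\<lambda>x. x * std_normal_density x) t = \<i> * t * wchar lborel (\<lambda>x. 1 * std_normal_density x) t"
    using lim by (intro std_normal_parts(1)) (auto intro!: derivative_eq_intros hermite_integrable cont)
  have 2: "wchar lborel (\<lambda>x. (x\<^sup>2 - 1) * std_normal_density x) t = \<i> * t * wchar lborel (\<lambda>x. x * std_normal_density x) t"
    using lim by (intro std_normal_parts(1)) (auto intro!: derivative_eq_intros hermite_integrable cont, simp add: power2_eq_square)
  have D3: "((\<lambda>x. x\<^sup>2 - 1) has_real_derivative x * (x\<^sup>2 - 1) - hermite3 x) (at x)" for x
    by (auto intro!: derivative_eq_intros simp: hermite3_def power2_eq_square power3_eq_cube algebra_simps)
  have 3: "wchar lborel (\<lambda>x. hermite3 x * std_normal_density x) t = \<i> * t * wchar lborel (\<lambda>x. (x\<^sup>2 - 1) * std_normal_density x) t"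
    using lim by (intro std_normal_parts(1) D3) (auto intro!: hermite_integrable cont)
  show "wchar lborel (\<lambda>x. hermite3 x * std_normal_density x) t = (\<i> * t) ^ 3 * exp (- (t\<^sup>2) / 2)"
    unfolding 3 2 1 by (simp add: wchar_std_normal power3_eq_cube exp_of_real[symmetric])
  have "wcdf lborel (\<lambda>x. hermite3 x * std_normal_density x) x = - ((x\<^sup>2 - 1) * std_normal_density x)"
    using lim by (intro std_normal_parts(2) D3) (auto intro!: hermite_integrable cont)
  then show "wcdf lborel (\<lambda>x. hermite3 x * std_normal_density x) x = (1 - x\<^sup>2) * std_normal_density x"
    by (simp add: algebra_simps)
qed

text \<open>The density whose distribution function is the expansion without saw-tooth; \<open>\<kappa>\<close> stands for
\<open>\<alpha> / (6 * \<surd>n)\<close>.\<close>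
definition edgeworth_density :: "real \<Rightarrow> real \<Rightarrow> real" where
  "edgeworth_density \<kappa> x = std_normal_density x + \<kappa> * (hermite3 x * std_normal_density x)"

lemma integrable_edgeworth_density: "integrable lborel (edgeworth_density \<kappa>)"
  unfolding edgeworth_density_def[abs_def] using hermite_integrable(3) by simp

lemma wcdf_add_mult:
  assumes "integrable lborel v" "integrable lborel w"
  shows "wcdf lborel (\<lambda>x. v x + c * w x) x = wcdf lborel v x + c * wcdf lborel w x"
proof -
  have "integrable lborel (\<lambda>y. r y * indicator {..x} y)" if "integrable lborel r" for r :: "real \<Rightarrow> real"
    using that by (intro integrable_real_mult_indicator) auto
  from this[OF assms(1)] this[OF assms(2)] show ?thesis
    by (simp add: wcdf_def distrib_right mult.assoc)
qed

lemma wchar_add_mult: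
  assumes "integrable lborel v" "integrable lborel w"
  shows "wchar lborel (\<lambda>x. v x + c * w x) t = wchar lborel v t + c * wchar lborel w t"
proof -
  have "integrable lborel (\<lambda>x. of_real (r x) * iexp (t * x))" if "integrable lborel r" for r :: "real \<Rightarrow> real"
  proof (rule Bochner_Integration.integrable_bound)
    show "integrable lborel r" by fact
    then have [measurable]: "r \<in> borel_measurable borel" by auto
    show "(\<lambda>x. of_real (r x) * iexp (t * x)) \<in> borel_measurable lborel" by measurable
  qed (simp add: norm_mult del: of_real_mult)
  from this[OF assms(1)] this[OF assms(2)] show ?thesis
    by (simp add: wchar_def distrib_right mult.assoc)
qed

definition gaussian_edgeworth_char :: "real \<Rightarrow> real \<Rightarrow> complex" where
  "gaussian_edgeworth_char \<kappa> t = complex_of_real (exp (- (t\<^sup>2) / 2)) * (1 + \<kappa> * (\<i> * t) ^ 3)"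

lemma wchar_edgeworth: "wchar lborel (edgeworth_density \<kappa>) = gaussian_edgeworth_char \<kappa>"
proof
  fix t
  show "wchar lborel (edgeworth_density \<kappa>) t = gaussian_edgeworth_char \<kappa> t"
    unfolding edgeworth_density_def[abs_def] gaussian_edgeworth_char_def
    by (subst wchar_add_mult)
       (auto simp: hermite_integrable wchar_std_normal wchar_hermite3 algebra_simps exp_of_real[symmetric])
qed

lemma wcdf_edgeworth:
  "wcdf lborel (edgeworth_density \<kappa>) x = cdf std_normal_distribution x + \<kappa> * ((1 - x\<^sup>2) * std_normal_density x)"
  unfolding edgeworth_density_def[abs_def]
  by (subst wcdf_add_mult)
     (auto simp: hermite_integrable wcdf_std_normal wcdf_hermite3)

lemma std_normal_density_le_1: "std_normal_density x \<le> 1"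
proof -
  have "1 \<le> 2 * pi" using pi_gt3 by simp
  then have "1 / sqrt (2 * pi) \<le> 1" by simp
  moreover have "exp (- x\<^sup>2 / 2) \<le> 1" by simp
  ultimately show ?thesis unfolding std_normal_density_def by (intro mult_le_one) auto
qed

lemma std_normal_density_mult_exp: "std_normal_density x * exp (x\<^sup>2 / 2) \<le> 1"
proof -
  have "1 \<le> 2 * pi" using pi_gt3 by simp
  then have "1 / sqrt (2 * pi) \<le> 1" by simp
  then show ?thesis by (simp add: std_normal_density_def exp_minus field_simps)
qed

text \<open>Since \<open>u\<^sup>2 / 2 \<le> exp u\<close> for \<open>u = x\<^sup>2 / 2\<close>, the function \<open>x ^ 4 * \<phi> x\<close> is at most \<open>8\<close>; the constant is crude, and any
bound would do.\<close>
lemma hermite3_normal_bound: "\<bar>hermite3 x * std_normal_density x\<bar> \<le> 36"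
proof -
  have "(x\<^sup>2/2)\<^sup>2 / 2 \<le> exp (x\<^sup>2 / 2)"
    using exp_lower_Taylor_quadratic[of "x\<^sup>2/2"] zero_le_power2[of x] by linarith
  then have "x ^ 4 / 8 \<le> exp (x\<^sup>2 / 2)" by (simp add: power_divide)
  then have "std_normal_density x * (x ^ 4 / 8) \<le> 1"
    using std_normal_density_mult_exp[of x] by (elim order.trans[OF mult_left_mono]) simp
  then have 4: "x ^ 4 * std_normal_density x \<le> 8" by (simp add: mult.commute)
  have "\<bar>hermite3 x\<bar> \<le> 4 * (1 + x ^ 4)"
  proof (cases "\<bar>x\<bar> \<le> 1")
    case True
    have "\<bar>hermite3 x\<bar> \<le> \<bar>x\<bar> ^ 3 + 3 * \<bar>x\<bar>" by (simp add: hermite3_def power_abs[symmetric] abs_triangle_ineq4[THEN order.trans] abs_mult)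
    also have "\<dots> \<le> 1 + 3 * 1" using True by (intro add_mono mult_left_mono power_le_one) auto
    finally have "\<bar>hermite3 x\<bar> \<le> 4" by simp
    moreover have "0 \<le> x ^ 4" by simp
    ultimately show ?thesis by argo
  next
    case False
    have "\<bar>hermite3 x\<bar> \<le> \<bar>x\<bar> ^ 3 + 3 * \<bar>x\<bar> ^ 1" by (simp add: hermite3_def power_abs[symmetric] abs_triangle_ineq4[THEN order.trans] abs_mult)
    also have "\<dots> \<le> \<bar>x\<bar> ^ 4 + 3 * \<bar>x\<bar> ^ 4" using False by (intro add_mono mult_left_mono power_increasing) auto
    finally show ?thesis by (simp add: power_even_abs)
  qed
  then have "\<bar>hermite3 x\<bar> * std_normal_density x \<le> 4 * (1 + x ^ 4) * std_normal_density x"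
    by (rule mult_right_mono) simp
  also have "\<dots> \<le> 36" using 4 std_normal_density_le_1[of x] by (simp add: algebra_simps)
  finally show ?thesis by (simp add: abs_mult)
qed

lemma edgeworth_density_bound: "\<bar>edgeworth_density \<kappa> x\<bar> \<le> 1 + 36 * \<bar>\<kappa>\<bar>"
proof -
  have "\<bar>edgeworth_density \<kappa> x\<bar> \<le> \<bar>std_normal_density x\<bar> + \<bar>\<kappa>\<bar> * \<bar>hermite3 x * std_normal_density x\<bar>"
    unfolding edgeworth_density_def abs_mult[of \<kappa>, symmetric] by (rule abs_triangle_ineq)
  also have "\<dots> \<le> 1 + \<bar>\<kappa>\<bar> * 36"
    using std_normal_density_le_1 hermite3_normal_bound by (intro add_mono mult_left_mono) auto
  finally show ?thesis by simp
qed

lemma wcdf_diff: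
  assumes "integrable lborel w" "a \<le> b"
  shows "wcdf lborel w b - wcdf lborel w a = (\<integral>u. w u * indicator {a<..b} u \<partial>lborel)"
proof -
  have "integrable lborel (\<lambda>y. w y * indicator {..x} y)" for x
    using assms by (intro integrable_real_mult_indicator) auto
  note int = this
  show ?thesis unfolding wcdf_def
    by (subst Bochner_Integration.integral_diff[symmetric, OF int int], rule Bochner_Integration.integral_cong)
       (use assms in \<open>auto simp: indicator_def\<close>)
qed

lemma wcdf_lipschitz_aux:
  assumes w: "integrable lborel w" and ab: "a \<le> b" and bd: "\<And>u. u \<in> {a..b} \<Longrightarrow> \<bar>w u - c\<bar> \<le> m"
  shows "\<bar>wcdf lborel w b - wcdf lborel w a - c * (b - a)\<bar> \<le> m * (b - a)"
proof -
  have ind: "integrable lborel (indicator {a<..b} :: real \<Rightarrow> real)"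
    using ab by (auto simp: integrable_indicator_iff)
  have "integrable lborel (\<lambda>y. w y * indicator {a<..b} y)"
    using w by (intro integrable_real_mult_indicator) auto
  then have "wcdf lborel w b - wcdf lborel w a - c * (b - a) = (\<integral>u. w u * indicator {a<..b} u - c * indicator {a<..b} u \<partial>lborel)"
    using ind ab by (simp add: wcdf_diff[OF w ab])
  also have "\<bar>\<dots>\<bar> \<le> (\<integral>u. \<bar>w u * indicator {a<..b} u - c * indicator {a<..b} u\<bar> \<partial>lborel)"
    by (rule integral_abs_bound)
  also have "\<dots> \<le> (\<integral>u. m * indicator {a<..b} u \<partial>lborel)"
  proof (rule integral_mono)
    show "integrable lborel (\<lambda>u. \<bar>w u * indicator {a<..b} u - c * indicator {a<..b} u\<bar>)"
      using w ind by (intro integrable_abs Bochner_Integration.integrable_diff integrable_real_mult_indicator integrable_mult_right) auto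
    show "integrable lborel (\<lambda>u. m * indicator {a<..b} u)" using ind by simp
  qed (use bd in \<open>auto simp: indicator_def\<close>)
  also have "\<dots> = m * (b - a)" using ab by simp
  finally show ?thesis .
qed

lemma wcdf_lipschitz:
  assumes w: "integrable lborel w" and bd: "\<And>u. \<bar>w u\<bar> \<le> m"
  shows "\<bar>wcdf lborel w x - wcdf lborel w y\<bar> \<le> m * \<bar>x - y\<bar>"
proof (cases "x \<le> y")
  case True
  then show ?thesis using wcdf_lipschitz_aux[OF w True, of 0 m] bd by simp
next
  case False
  then show ?thesis using wcdf_lipschitz_aux[OF w, of y x 0 m] bd by simp
qed

lemma std_normal_density_lipschitz: "\<bar>std_normal_density x - std_normal_density y\<bar> \<le> \<bar>x - y\<bar>"
proof -
  have bd: "\<bar>x * std_normal_density x\<bar> \<le> 1" for x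
  proof -
    have "0 \<le> (\<bar>x\<bar> - 1)\<^sup>2" by simp
    then have "\<bar>x\<bar> \<le> 1 + x\<^sup>2 / 2" by (simp add: power2_eq_square algebra_simps abs_mult[symmetric])
    also have "\<dots> \<le> exp (x\<^sup>2 / 2)" by (rule exp_ge_add_one_self)
    finally have "std_normal_density x * \<bar>x\<bar> \<le> std_normal_density x * exp (x\<^sup>2 / 2)" by (rule mult_left_mono) simp
    then show ?thesis using std_normal_density_mult_exp[of x] by (simp add: abs_mult mult.commute)
  qed
  have "norm (std_normal_density x - std_normal_density y) \<le> 1 * norm (x - y)"
    using DERIV_std_normal_density bd
    by (intro field_differentiable_bound[of UNIV _ "\<lambda>x. - (x * std_normal_density x)"]) auto
  then show ?thesis by simp
qed

text \<open>Moving from a lattice point by half a step changes \<open>\<Phi>\<close> by a first-order term, the saw-tooth, up to a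
quadratic error.\<close>
lemma cdf_std_normal_linearisation:
  "\<bar>cdf std_normal_distribution y - cdf std_normal_distribution x - std_normal_density x * (y - x)\<bar> \<le> (y - x)\<^sup>2"
proof -
  have lip: "\<bar>std_normal_density u - std_normal_density x\<bar> \<le> \<bar>y - x\<bar>" if "\<bar>u - x\<bar> \<le> \<bar>y - x\<bar>" for u
    using std_normal_density_lipschitz[of u x] that by simp
  show ?thesis
  proof (cases "x \<le> y")
    case True
    then have "\<bar>wcdf lborel std_normal_density y - wcdf lborel std_normal_density x - std_normal_density x * (y - x)\<bar> \<le> \<bar>y - x\<bar> * (y - x)"
      by (intro wcdf_lipschitz_aux lip) auto
    then show ?thesis using True by (simp add: wcdf_std_normal power2_eq_square)
  next
    case False
    then have "\<bar>wcdf lborel std_normal_density x - wcdf lborel std_normal_density y - std_normal_density x * (x - y)\<bar> \<le> \<bar>y - x\<bar> * (x - y)"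
      by (intro wcdf_lipschitz_aux lip) auto
    then show ?thesis using False by (simp add: wcdf_std_normal power2_eq_square algebra_simps abs_if split: if_splits)
  qed
qed

lemma edgeworth_term_lipschitz:
  "\<bar>(1 - x\<^sup>2) * std_normal_density x - (1 - y\<^sup>2) * std_normal_density y\<bar> \<le> 36 * \<bar>x - y\<bar>"
  unfolding wcdf_hermite3[symmetric] using hermite3_normal_bound
  by (intro wcdf_lipschitz hermite_integrable) auto

section \<open>Powers of complex numbers close to one\<close>

lemma norm_power_diff_scaled:
  fixes u v :: complex
  assumes "norm u \<le> r" "norm v \<le> r" "r > 0" "n \<ge> 1"
  shows "norm (u ^ n - v ^ n) \<le> real n * r ^ (n - 1) * norm (u - v)"
proof -
  have "norm ((u / r) ^ n - (v / r) ^ n) \<le> real n * norm (u / r - v / r)"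
    using assms by (intro norm_power_diff) (auto simp: norm_divide)
  moreover have "(u / r) ^ n - (v / r) ^ n = (u ^ n - v ^ n) / complex_of_real (r ^ n)"
    by (simp add: power_divide diff_divide_distrib)
  moreover have "u / r - v / r = (u - v) / complex_of_real r"
    by (simp add: diff_divide_distrib)
  ultimately have "norm (u ^ n - v ^ n) / r ^ n \<le> real n * (norm (u - v) / r)"
    using assms by (simp add: norm_divide norm_power)
  then have "norm (u ^ n - v ^ n) \<le> real n * (norm (u - v) / r) * r ^ n"
    using assms by (simp add: pos_divide_le_eq)
  also have "r ^ n = r * r ^ (n - 1)" using assms by (cases n) auto
  finally show ?thesis using assms by (simp add: mult_ac)
qed

text \<open>The remainder satisfies \<open>R (n + 1) = (1 + z) * R n + n * z\<^sup>2\<close>, which gives the bound by induction.\<close>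
lemma norm_one_plus_power_le:
  fixes z :: complex
  shows "norm ((1 + z) ^ n - 1 - of_nat n * z) \<le> (real n * norm z)\<^sup>2 * exp (real n * norm z)"
proof -
  have "norm ((1 + z) ^ n - 1 - of_nat n * z) \<le> (real n * norm z)\<^sup>2 * (1 + norm z) ^ n"
  proof (induction n)
    case (Suc n)
    let ?x = "norm z"
    have "(1 + z) ^ Suc n - 1 - of_nat (Suc n) * z
        = (1 + z) * ((1 + z) ^ n - 1 - of_nat n * z) + of_nat n * z\<^sup>2"
      by (simp add: algebra_simps power2_eq_square)
    also have "norm \<dots> \<le> norm (1 + z) * norm ((1 + z) ^ n - 1 - of_nat n * z) + real n * ?x\<^sup>2"
      by (rule order.trans[OF norm_triangle_ineq]) (simp add: norm_mult norm_power)
    also have "\<dots> \<le> (1 + ?x) * ((real n * ?x)\<^sup>2 * (1 + ?x) ^ n) + real n * ?x\<^sup>2 * (1 + ?x) ^ Suc n"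
    proof (rule add_mono, rule mult_mono)
      show "norm ((1 + z) ^ n - 1 - of_nat n * z) \<le> (real n * ?x)\<^sup>2 * (1 + ?x) ^ n" by (rule Suc.IH)
      show "norm (1 + z) \<le> 1 + ?x" using norm_triangle_ineq[of 1 z] by simp
      have "real n * ?x\<^sup>2 * 1 \<le> real n * ?x\<^sup>2 * (1 + ?x) ^ Suc n"
        by (intro mult_left_mono one_le_power) auto
      then show "real n * ?x\<^sup>2 \<le> real n * ?x\<^sup>2 * (1 + ?x) ^ Suc n" by simp
    qed auto
    also have "\<dots> = (real n * real n + real n) * (?x\<^sup>2 * (1 + ?x) ^ Suc n)"
      by (simp add: power2_eq_square algebra_simps)
    also have "\<dots> \<le> (real (Suc n))\<^sup>2 * (?x\<^sup>2 * (1 + ?x) ^ Suc n)"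
      by (intro mult_right_mono) (auto simp: power2_eq_square algebra_simps)
    finally show ?case by (simp add: power_mult_distrib mult.assoc)
  qed simp
  also have "\<dots> \<le> (real n * norm z)\<^sup>2 * exp (real n * norm z)"
  proof (rule mult_left_mono)
    have "(1 + norm z) ^ n \<le> exp (norm z) ^ n"
      by (intro power_mono exp_ge_add_one_self) auto
    then show "(1 + norm z) ^ n \<le> exp (real n * norm z)" by (simp add: exp_of_nat_mult)
  qed simp
  finally show ?thesis .
qed

lemma inverse_sqrt_tendsto_0: "(\<lambda>n. 1 / sqrt (real n)) \<longlonglongrightarrow> 0"
  by real_asymp

text \<open>The power of a quotient of two characteristic functions that agree up to order \<open>n powr (- 3/2)\<close>, linearized.\<close>
lemma tendsto_sqrt_one_plus_power:
  fixes a :: "nat \<Rightarrow> complex"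
  assumes "a \<longlonglongrightarrow> L"
  shows "(\<lambda>n. sqrt n * ((1 + a n / (n * sqrt n)) ^ n - 1)) \<longlonglongrightarrow> L"
proof -
  define R where "R n = sqrt n * ((1 + a n / (n * sqrt n)) ^ n - 1 - of_nat n * (a n / (n * sqrt n)))" for n :: nat
  have "R \<longlonglongrightarrow> 0"
  proof (rule Lim_null_comparison)
    have "(\<lambda>n. (norm (a n))\<^sup>2 * (1 / sqrt n) * exp (norm (a n) * (1 / sqrt n))) \<longlonglongrightarrow> (norm L)\<^sup>2 * 0 * exp (norm L * 0)"
      by (intro tendsto_intros assms inverse_sqrt_tendsto_0)
    then show "(\<lambda>n. (norm (a n))\<^sup>2 * (1 / sqrt n) * exp (norm (a n) * (1 / sqrt n))) \<longlonglongrightarrow> 0" by simp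
    show "\<forall>\<^sub>F n in sequentially. norm (R n) \<le> (norm (a n))\<^sup>2 * (1 / sqrt n) * exp (norm (a n) * (1 / sqrt n))"
      using eventually_gt_at_top[of 0]
    proof eventually_elim
      case (elim n)
      let ?z = "a n / complex_of_real (n * sqrt n)"
      have nz: "real n * norm ?z = norm (a n) / sqrt n"
        using elim by (simp add: norm_divide norm_mult)
      have "norm (R n) = sqrt n * norm ((1 + ?z) ^ n - 1 - of_nat n * ?z)"
        by (simp add: R_def norm_mult)
      also have "\<dots> \<le> sqrt n * ((real n * norm ?z)\<^sup>2 * exp (real n * norm ?z))"
        by (intro mult_left_mono norm_one_plus_power_le) simp
      also have "\<dots> = (norm (a n))\<^sup>2 * (1 / sqrt n) * exp (norm (a n) * (1 / sqrt n))"
        unfolding nz using elim by (simp add: power_divide field_simps real_sqrt_pow2 power2_eq_square)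
      finally show ?case .
    qed
  qed
  then have "(\<lambda>n. R n + a n) \<longlonglongrightarrow> 0 + L" by (intro tendsto_add assms)
  moreover have "\<forall>\<^sub>F n in sequentially. R n + a n = sqrt n * ((1 + a n / (n * sqrt n)) ^ n - 1)"
    using eventually_gt_at_top[of 0]
  proof eventually_elim
    case (elim n)
    then have "complex_of_real (sqrt n) * (of_nat n * (a n / complex_of_real (n * sqrt n))) = a n"
      by simp
    then show ?case by (simp only: R_def right_diff_distrib) simp
  qed
  ultimately show ?thesis by (simp cong: filterlim_cong)
qed

section \<open>Uniform noise\<close>

definition centred_uniform :: "real measure" where
  "centred_uniform = uniform_measure lborel {-1/2..1/2}"

lemma real_distribution_centred_uniform: "real_distribution centred_uniform"
  unfolding centred_uniform_def real_distribution_def real_distribution_axioms_def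
  by (auto intro!: prob_space_uniform_measure)

lemma AE_centred_uniform: "AE u in centred_uniform. \<bar>u\<bar> < 1/2"
proof -
  have "AE u in lborel. u \<in> {-1/2..1/2} \<longrightarrow> \<bar>u\<bar> < (1/2::real)"
    using AE_lborel_singleton[of "-1/2"] AE_lborel_singleton[of "1/2"]
    by eventually_elim auto
  then show ?thesis unfolding centred_uniform_def by (intro AE_uniform_measureI) auto
qed

lemma integral_centred_uniform:
  fixes f :: "real \<Rightarrow> 'a::{banach, second_countable_topology}"
  assumes "f \<in> borel_measurable borel"
  shows "(\<integral>u. f u \<partial>centred_uniform) = (\<integral>u. indicator {-1/2..1/2} u *\<^sub>R f u \<partial>lborel)"
proof -
  have eq: "centred_uniform = density lborel (\<lambda>u. ennreal (indicator {-1/2..1/2} u))"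
    unfolding centred_uniform_def uniform_measure_def by (intro arg_cong[of _ _ "density lborel"]) (auto simp: fun_eq_iff indicator_def divide_ennreal_def)
  show ?thesis unfolding eq by (subst integral_density) (use assms in auto)
qed

lemma integrable_centred_uniform:
  fixes f :: "real \<Rightarrow> 'a::{banach, second_countable_topology}"
  assumes "f \<in> borel_measurable borel" "\<And>u. \<bar>u\<bar> < 1/2 \<Longrightarrow> norm (f u) \<le> B"
  shows "integrable centred_uniform f"
proof -
  interpret real_distribution centred_uniform by (rule real_distribution_centred_uniform)
  show ?thesis
    using AE_centred_uniform assms by (intro integrable_const_bound[of _ B]) auto
qed

text \<open>The zeros of the noise factor; they match the points where the characteristic function of a lattice law has
modulus one.\<close>
lemma char_centred_uniform_zero:
  assumes "k \<noteq> 0"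
  shows "char centred_uniform (2 * pi * of_int k) = 0"
proof -
  let ?s = "2 * pi * of_int k"
  have s: "?s \<noteq> 0" using assms by simp
  have "char centred_uniform ?s = (\<integral>u. indicator {-1/2..1/2} u *\<^sub>R iexp (?s * u) \<partial>lborel)"
    unfolding char_def by (rule integral_centred_uniform) simp
  also have "\<dots> = iexp (?s * (1/2)) / (\<i> * ?s) - iexp (?s * (-1/2)) / (\<i> * ?s)"
  proof (rule integral_FTC_atLeastAtMost)
    fix x
    have "((\<lambda>x. iexp (?s * x)) has_vector_derivative \<i> * ?s * iexp (?s * x)) (at x within {-1/2..1/2})"
      by (auto intro!: derivative_eq_intros simp: Re_exp Im_exp has_vector_derivative_complex_iff)
    from has_vector_derivative_divide[OF this, of "\<i> * ?s"]
    show "((\<lambda>x. iexp (?s * x) / (\<i> * ?s)) has_vector_derivative iexp (?s * x)) (at x within {-1/2..1/2})"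
      using s by simp
  qed (auto intro!: continuous_intros)
  also have "iexp (?s * (1/2)) = iexp (?s * (-1/2))"
  proof -
    have "?s * (1/2) = ?s * (-1/2) + ?s" by simp
    then have "iexp (?s * (1/2)) = iexp (?s * (-1/2) + ?s)" by (rule arg_cong)
    also have "\<dots> = iexp (?s * (-1/2)) * iexp ?s"
      by (simp only: of_real_add ring_distribs exp_add)
    also have "iexp ?s = 1" using exp_integer_2pi[of "of_int k"] by (simp add: mult_ac)
    finally show ?thesis by (simp only: mult_1_right)
  qed
  finally show ?thesis by simp
qed

lemma char_centred_uniform_lipschitz:
  "norm (char centred_uniform s - char centred_uniform t) \<le> \<bar>s - t\<bar>"
proof -
  interpret real_distribution centred_uniform by (rule real_distribution_centred_uniform)
  have int: "integrable centred_uniform (\<lambda>u. iexp (s * u))" for s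
    by (intro integrable_const_bound[of _ 1]) auto
  have "norm (char centred_uniform s - char centred_uniform t) = norm (\<integral>u. iexp (s * u) - iexp (t * u) \<partial>centred_uniform)"
    unfolding char_def using int by simp
  also have "\<dots> \<le> (\<integral>u. norm (iexp (s * u) - iexp (t * u)) \<partial>centred_uniform)"
    by (rule integral_norm_bound)
  also have "\<dots> \<le> (\<integral>u. \<bar>s - t\<bar> \<partial>centred_uniform)"
  proof (rule integral_mono_AE)
    show "AE u in centred_uniform. norm (iexp (s * u) - iexp (t * u)) \<le> \<bar>s - t\<bar>"
      using AE_centred_uniform
    proof eventually_elim
      case (elim u)
      have "iexp (s * u) - iexp (t * u) = iexp (t * u) * (iexp ((s - t) * u) - 1)"
        by (simp add: algebra_simps exp_add[symmetric])
      then have "norm (iexp (s * u) - iexp (t * u)) = norm (iexp ((s - t) * u) - 1)"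
        by (simp add: norm_mult del: of_real_mult of_real_diff)
      also have "\<dots> \<le> \<bar>(s - t) * u\<bar>" using iexp_approx1[of "(s - t) * u" 0] by simp
      also have "\<dots> \<le> \<bar>s - t\<bar> * 1" unfolding abs_mult using elim by (intro mult_left_mono) auto
      finally show ?case by simp
    qed
  qed (use int in auto)
  finally show ?thesis by (simp add: prob_space del: space_eq_univ)
qed

lemma char_centred_uniform_quadratic:
  "norm (char centred_uniform s - 1) \<le> s\<^sup>2"
proof -
  interpret real_distribution centred_uniform by (rule real_distribution_centred_uniform)
  have int: "integrable centred_uniform (\<lambda>u. iexp (s * u))"
    by (intro integrable_const_bound[of _ 1]) auto
  have int1: "integrable centred_uniform (\<lambda>u. u)"
    by (rule integrable_centred_uniform[of _ 1]) auto
  have mean: "(\<integral>u. u \<partial>centred_uniform) = 0"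
  proof -
    have "(\<integral>u. u \<partial>centred_uniform) = (\<integral>u. indicator {-1/2..1/2} u *\<^sub>R u \<partial>lborel)"
      by (rule integral_centred_uniform) simp
    also have "\<dots> = (1/2)\<^sup>2 / 2 - (-1/2)\<^sup>2 / 2"
      by (rule integral_FTC_atLeastAtMost)
         (auto intro!: derivative_eq_intros continuous_intros simp: has_real_derivative_iff_has_vector_derivative[symmetric])
    finally show ?thesis by simp
  qed
  have "norm (char centred_uniform s - 1) = norm (\<integral>u. iexp (s * u) - 1 - \<i> * of_real (s * u) \<partial>centred_uniform)"
    unfolding char_def using int int1 by (simp add: mean prob_space del: space_eq_univ)
  also have "\<dots> \<le> (\<integral>u. norm (iexp (s * u) - 1 - \<i> * of_real (s * u)) \<partial>centred_uniform)"
    by (rule integral_norm_bound)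
  also have "\<dots> \<le> (\<integral>u. s\<^sup>2 \<partial>centred_uniform)"
  proof (rule integral_mono_AE)
    show "AE u in centred_uniform. norm (iexp (s * u) - 1 - \<i> * of_real (s * u)) \<le> s\<^sup>2"
      using AE_centred_uniform
    proof eventually_elim
      case (elim u)
      have "norm (iexp (s * u) - 1 - \<i> * of_real (s * u)) \<le> \<bar>s * u\<bar>\<^sup>2 / 2"
        using iexp_approx1[of "s * u" 1] by (simp add: diff_diff_eq numeral_2_eq_2)
      also have "\<dots> \<le> s\<^sup>2 * 1 / 2"
      proof -
        have "\<bar>u\<bar>\<^sup>2 \<le> 1" using elim by (intro power_le_one) auto
        then show ?thesis unfolding abs_mult power_mult_distrib
          by (intro divide_right_mono mult_mono) auto
      qed
      also have "\<dots> \<le> s\<^sup>2" by simp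
      finally show ?case .
    qed
  qed (use int int1 in auto)
  finally show ?thesis by (simp add: prob_space del: space_eq_univ)
qed

section \<open>The characteristic function of a standardized law\<close>
locale standardized_law = real_distribution Q for Q :: "real measure" +
  assumes int3: "integrable Q (\<lambda>x. \<bar>x\<bar> ^ 3)"
    and mean_0: "expectation (\<lambda>x. x) = 0"
    and var_1: "expectation (\<lambda>x. x\<^sup>2) = 1"
begin

abbreviation f where "f \<equiv> char Q"
definition \<rho> where "\<rho> = expectation (\<lambda>x. \<bar>x\<bar> ^ 3)"
definition \<alpha> where "\<alpha> = expectation (\<lambda>x. x ^ 3)"

lemma integrable_moment: "k \<le> 3 \<Longrightarrow> integrable Q (\<lambda>x. x ^ k)"
proof (rule Bochner_Integration.integrable_bound)
  assume k: "k \<le> 3"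
  show "integrable Q (\<lambda>x. 1 + \<bar>x\<bar> ^ 3)" using int3 by simp
  show "AE x in Q. norm (x ^ k) \<le> norm (1 + \<bar>x\<bar> ^ 3)"
  proof (rule AE_I2)
    fix x :: real
    have "\<bar>x\<bar> ^ k \<le> 1 + \<bar>x\<bar> ^ 3"
    proof (cases "\<bar>x\<bar> \<le> 1")
      case True
      then have "\<bar>x\<bar> ^ k \<le> 1" by (intro power_le_one) auto
      then show ?thesis by (simp add: add_increasing2)
    next
      case False
      then have "\<bar>x\<bar> ^ k \<le> \<bar>x\<bar> ^ 3" using k by (intro power_increasing) auto
      then show ?thesis by simp
    qed
    then show "norm (x ^ k) \<le> norm (1 + \<bar>x\<bar> ^ 3)" by (simp add: power_abs)
  qed
qed simp

lemma \<rho>_nonneg: "0 \<le> \<rho>"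
  unfolding \<rho>_def by simp

lemma abs_\<alpha>_le: "\<bar>\<alpha>\<bar> \<le> \<rho>"
  unfolding \<alpha>_def \<rho>_def power_abs[symmetric] by (rule integral_abs_bound)

lemma char_taylor2: "norm (f s - (1 - s\<^sup>2 / 2)) \<le> \<rho> * \<bar>s\<bar> ^ 3 / 6"
proof -
  define m where "m = expectation (\<lambda>x. min (2 * \<bar>x\<bar>^2 * Suc 2) (\<bar>s\<bar> * \<bar>x\<bar>^Suc 2))"
  have "norm (f s - (\<Sum>k\<le>2. ((\<i> * s)^k / fact k) * expectation (\<lambda>x. x^k))) \<le> \<bar>s\<bar>^2 / fact (Suc 2) * m"
    unfolding m_def by (rule char_approx2) (rule integrable_moment, simp)
  also have "(\<Sum>k\<le>2. ((\<i> * s)^k / fact k) * expectation (\<lambda>x. x^k)) = 1 - s\<^sup>2 / 2"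
  proof -
    have "{..2::nat} = {0, 1, 2}" by auto
    then show ?thesis
      using mean_0 var_1 by (simp add: prob_space fact_numeral power_mult_distrib del: space_eq_univ)
  qed
  also have "\<bar>s\<bar>^2 / fact (Suc 2) * m \<le> \<bar>s\<bar>^2 / fact (Suc 2) * (\<bar>s\<bar> * \<rho>)"
  proof (rule mult_left_mono)
    have "m \<le> expectation (\<lambda>x. \<bar>s\<bar> * \<bar>x\<bar>^3)"
      unfolding m_def
    proof (rule integral_mono)
      show "integrable Q (\<lambda>x. \<bar>s\<bar> * \<bar>x\<bar>^3)" using int3 by simp
      then show "integrable Q (\<lambda>x. min (2 * \<bar>x\<bar>^2 * Suc 2) (\<bar>s\<bar> * \<bar>x\<bar>^Suc 2))"
        by (rule Bochner_Integration.integrable_bound) (auto simp: eval_nat_numeral)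
    qed (simp add: eval_nat_numeral)
    then show "m \<le> \<bar>s\<bar> * \<rho>" by (simp add: \<rho>_def)
  qed simp
  also have "\<dots> = \<rho> * \<bar>s\<bar> ^ 3 / 6"
    by (simp add: fact_numeral eval_nat_numeral)
  finally show ?thesis .
qed

text \<open>Third-order Taylor expansion without a fourth moment: the remainder integrand is bounded by a multiple of
\<open>\<bar>x\<bar> ^ 3\<close> and tends to \<open>0\<close> pointwise.\<close>
lemma char_taylor3:
  "(\<lambda>n. (real n * sqrt n) * (f (t / sqrt n) - complex_of_real (1 - t\<^sup>2 / (2 * real n)))) \<longlonglongrightarrow> \<alpha> * (\<i> * t) ^ 3 / 6"
proof -
  define m where "m n = expectation (\<lambda>x. min (2 * \<bar>x\<bar>^3 * Suc 3) (\<bar>t / sqrt n\<bar> * \<bar>x\<bar>^Suc 3))" for n :: nat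
  have "m \<longlonglongrightarrow> expectation (\<lambda>x. 0)"
    unfolding m_def[abs_def]
  proof (rule integral_dominated_convergence[where w = "\<lambda>x. 8 * \<bar>x\<bar>^3"])
    show "AE x in Q. (\<lambda>n. min (2 * \<bar>x\<bar>^3 * Suc 3) (\<bar>t / sqrt (real n)\<bar> * \<bar>x\<bar>^Suc 3)) \<longlonglongrightarrow> 0"
    proof (rule AE_I2)
      fix x :: real
      have "(\<lambda>n. min (2 * \<bar>x\<bar>^3 * Suc 3) (\<bar>t * (1 / sqrt (real n))\<bar> * \<bar>x\<bar>^Suc 3))
         \<longlonglongrightarrow> min (2 * \<bar>x\<bar>^3 * Suc 3) (\<bar>t * 0\<bar> * \<bar>x\<bar>^Suc 3)"
        by (intro tendsto_intros inverse_sqrt_tendsto_0)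
      then show "(\<lambda>n. min (2 * \<bar>x\<bar>^3 * Suc 3) (\<bar>t / sqrt (real n)\<bar> * \<bar>x\<bar>^Suc 3)) \<longlonglongrightarrow> 0"
        by simp
    qed
  qed (use int3 in auto)
  then have m: "m \<longlonglongrightarrow> 0" by simp
  define p where "p s = (\<Sum>k\<le>3. ((\<i> * complex_of_real s)^k / fact k) * expectation (\<lambda>x. x^k))" for s :: real
  have p: "p s = complex_of_real (1 - s\<^sup>2 / 2) + of_real \<alpha> * (\<i> * of_real s) ^ 3 / 6" for s
  proof -
    have "{..3::nat} = {0, 1, 2, 3}" by auto
    then show ?thesis
      using mean_0 var_1 unfolding p_def
      by (simp add: prob_space fact_numeral \<alpha>_def power_mult_distrib[where n = 2] mult.commute del: space_eq_univ)
  qed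
  have bd: "norm ((real n * sqrt n) * (f (t / sqrt n) - p (t / sqrt n))) \<le> \<bar>t\<bar> ^ 3 * m n" if "n > 0" for n :: nat
  proof -
    have 1: "norm (f (t / sqrt n) - p (t / sqrt n)) \<le> \<bar>t / sqrt n\<bar>^3 / fact (Suc 3) * m n"
      unfolding m_def p_def by (rule char_approx2) (rule integrable_moment)
    have m0: "0 \<le> m n" unfolding m_def by simp
    have c: "real n * sqrt n * (\<bar>t / sqrt n\<bar>^3) = \<bar>t\<bar> ^ 3"
      using that by (simp add: power_divide power3_eq_cube)
    have "norm ((real n * sqrt n) * (f (t / sqrt n) - p (t / sqrt n))) \<le> real n * sqrt n * (\<bar>t / sqrt n\<bar>^3 / fact (Suc 3) * m n)"
      unfolding norm_mult using 1 by (intro mult_mono) (auto simp: norm_mult)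
    also have "\<dots> = \<bar>t\<bar> ^ 3 * m n / 24" unfolding c[symmetric] by (simp add: fact_numeral eval_nat_numeral)
    also have "\<dots> \<le> \<bar>t\<bar> ^ 3 * m n" using m0 by simp
    finally show ?thesis .
  qed
  have "(\<lambda>n. (real n * sqrt n) * (f (t / sqrt n) - p (t / sqrt n))) \<longlonglongrightarrow> 0"
  proof (rule Lim_null_comparison)
    show "(\<lambda>n. \<bar>t\<bar> ^ 3 * m n) \<longlonglongrightarrow> 0" using tendsto_mult_left[OF m, of "\<bar>t\<bar> ^ 3"] by simp
    show "\<forall>\<^sub>F n in sequentially. norm ((real n * sqrt n) * (f (t / sqrt n) - p (t / sqrt n))) \<le> \<bar>t\<bar> ^ 3 * m n"
      using eventually_gt_at_top[of 0] by eventually_elim (rule bd)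
  qed
  then have "(\<lambda>n. (real n * sqrt n) * (f (t / sqrt n) - p (t / sqrt n)) + \<alpha> * (\<i> * t) ^ 3 / 6) \<longlonglongrightarrow> \<alpha> * (\<i> * t) ^ 3 / 6"
    by (drule_tac tendsto_add[OF _ tendsto_const[of "of_real \<alpha> * (\<i> * of_real t) ^ 3 / 6"]]) (simp only: add_0)
  moreover have "\<forall>\<^sub>F n in sequentially. (real n * sqrt n) * (f (t / sqrt n) - p (t / sqrt n)) + \<alpha> * (\<i> * t) ^ 3 / 6
     = (real n * sqrt n) * (f (t / sqrt n) - complex_of_real (1 - t\<^sup>2 / (2 * real n)))"
    using eventually_gt_at_top[of 0]
  proof eventually_elim
    case (elim n)
    have c: "complex_of_real (real n * sqrt n) * ((\<i> * complex_of_real (t / sqrt n)) ^ 3) = (\<i> * t) ^ 3"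
    proof -
      have "real n * sqrt n * (t / sqrt n) ^ 3 = t ^ 3"
        using elim by (simp add: power_divide power3_eq_cube)
      then have "complex_of_real (real n * sqrt n * (t / sqrt n) ^ 3) = of_real (t ^ 3)" by (rule arg_cong)
      then show ?thesis
        unfolding power_mult_distrib of_real_power[symmetric] mult.left_commute[of _ "\<i> ^ 3"] of_real_mult[symmetric]
        by (simp only:)
    qed
    have gen: "X * (F - (S + A * C / 6)) = X * (F - S) - A * (X * C) / 6" for X F S A C :: complex
      by (simp add: field_simps)
    have sq: "(t / sqrt n)\<^sup>2 / 2 = t\<^sup>2 / (2 * real n)" by (simp add: power_divide)
    have "complex_of_real (real n * sqrt n) * (f (t / sqrt n) - p (t / sqrt n))
      = complex_of_real (real n * sqrt n) * (f (t / sqrt n) - complex_of_real (1 - t\<^sup>2 / (2 * real n)))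
        - \<alpha> * (complex_of_real (real n * sqrt n) * ((\<i> * complex_of_real (t / sqrt n)) ^ 3)) / 6"
      unfolding p sq by (rule gen)
    then show ?case unfolding c by simp
  qed
  ultimately show ?thesis by (rule Lim_transform_eventually)
qed

text \<open>On \<open>\<bar>s\<bar> \<le> \<delta>\<close> the third-order error is at most half of the quadratic term \<open>s\<^sup>2 / 2\<close>, so that \<open>f\<close> has a Gaussian
bound there.\<close>
definition \<delta> where "\<delta> = min 1 (3 / (2 * (\<rho> + 1)))"

lemma \<delta>: "0 < \<delta>" "\<delta> \<le> 1" "\<rho> * \<delta> \<le> 3 / 2"
proof -
  show "0 < \<delta>" "\<delta> \<le> 1" using \<rho>_nonneg by (auto simp: \<delta>_def)
  have "\<rho> * \<delta> \<le> \<rho> * (3 / (2 * (\<rho> + 1)))" using \<rho>_nonneg by (intro mult_left_mono) (auto simp: \<delta>_def)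
  also have "\<dots> \<le> 3 / 2" using \<rho>_nonneg by (simp add: field_simps)
  finally show "\<rho> * \<delta> \<le> 3 / 2" .
qed

lemma char_gaussian_bound:
  assumes "\<bar>s\<bar> \<le> \<delta>"
  shows "norm (f s) \<le> exp (- (s\<^sup>2) / 4)"
proof -
  have s1: "\<bar>s\<bar> \<le> 1" using assms \<delta>(2) by simp
  then have "s\<^sup>2 \<le> 1" by (simp add: abs_square_le_1)
  then have n: "norm (1 - complex_of_real (s\<^sup>2 / 2)) = 1 - s\<^sup>2 / 2"
    using norm_of_real[of "1 - s\<^sup>2 / 2", where 'a = complex] by simp
  have "norm (f s) \<le> norm (1 - complex_of_real (s\<^sup>2 / 2)) + norm (f s - (1 - complex_of_real (s\<^sup>2 / 2)))"
    using norm_triangle_ineq[of "1 - complex_of_real (s\<^sup>2 / 2)" "f s - (1 - complex_of_real (s\<^sup>2 / 2))"] by simp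
  also have "\<dots> \<le> 1 - s\<^sup>2 / 2 + \<rho> * \<bar>s\<bar> ^ 3 / 6"
    using char_taylor2[of s] unfolding n by simp
  also have "\<rho> * \<bar>s\<bar> ^ 3 / 6 \<le> s\<^sup>2 / 4"
  proof -
    have "\<rho> * \<bar>s\<bar> \<le> 3 / 2" using mult_left_mono[OF assms \<rho>_nonneg] \<delta>(3) by simp
    then have "\<rho> * \<bar>s\<bar> * (s\<^sup>2 / 6) \<le> 3 / 2 * (s\<^sup>2 / 6)" by (rule mult_right_mono) simp
    then show ?thesis by (simp add: power3_eq_cube power2_eq_square mult.assoc)
  qed
  also have "1 - s\<^sup>2 / 2 + s\<^sup>2 / 4 = 1 + (- (s\<^sup>2) / 4)" by simp
  also have "\<dots> \<le> exp (- (s\<^sup>2) / 4)" by (rule exp_ge_add_one_self)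
  finally show ?thesis by simp
qed

lemma exp_quadratic_remainder:
  fixes y :: real
  assumes "0 \<le> y"
  shows "\<bar>exp (- y) - (1 - y)\<bar> \<le> y\<^sup>2"
proof (cases "y \<le> 1")
  case True
  have "1 + y \<le> exp y" by (rule exp_ge_add_one_self)
  then have "exp (- y) \<le> 1 / (1 + y)" using assms by (simp add: exp_minus field_simps)
  also have "\<dots> \<le> 1 - y + y\<^sup>2" using assms by (simp add: field_simps power2_eq_square)
  finally show ?thesis using exp_ge_add_one_self[of "- y"] by simp
next
  case False
  have "exp (- y) \<le> 1" using assms by simp
  moreover have "y * 1 \<le> y * y" using False by (intro mult_left_mono) auto
  ultimately have "exp (- y) - (1 - y) \<le> y\<^sup>2" unfolding power2_eq_square by argo
  moreover have "0 \<le> exp (- y) - (1 - y)" using exp_ge_add_one_self[of "- y"] by simp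
  ultimately show ?thesis by simp
qed

lemma char_minus_gaussian_bound:
  assumes n: "n > 0" and t: "\<bar>t\<bar> \<le> sqrt n"
  shows "norm (f (t / sqrt n) - complex_of_real (exp (- (t\<^sup>2) / (2 * real n)))) \<le> (\<rho> + 1) * \<bar>t\<bar> ^ 3 / (real n * sqrt n)"
proof -
  define s where "s = t / sqrt n"
  have s2: "s\<^sup>2 = t\<^sup>2 / real n" by (simp add: s_def power_divide)
  have s1: "\<bar>s\<bar> \<le> 1" using n t by (simp add: s_def field_simps)
  have s3: "\<bar>s\<bar> ^ 3 = \<bar>t\<bar> ^ 3 / (real n * sqrt n)" using n by (simp add: s_def power_divide power3_eq_cube)
  have "norm (f s - of_real (exp (- (s\<^sup>2) / 2)))
     \<le> norm (f s - (1 - complex_of_real (s\<^sup>2 / 2))) + norm (complex_of_real (exp (- (s\<^sup>2 / 2)) - (1 - s\<^sup>2 / 2)))"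
    using norm_triangle_ineq4[of "f s - (1 - complex_of_real (s\<^sup>2 / 2))" "complex_of_real (exp (- (s\<^sup>2 / 2)) - (1 - s\<^sup>2 / 2))"]
    by simp
  also have "\<dots> \<le> \<rho> * \<bar>s\<bar> ^ 3 / 6 + (s\<^sup>2 / 2)\<^sup>2"
    unfolding norm_of_real
    by (rule add_mono[OF _ exp_quadratic_remainder]) (use char_taylor2[of s] in simp_all)
  also have "\<dots> \<le> \<rho> * \<bar>s\<bar> ^ 3 + 1 * \<bar>s\<bar> ^ 3"
  proof (rule add_mono)
    show "\<rho> * \<bar>s\<bar> ^ 3 / 6 \<le> \<rho> * \<bar>s\<bar> ^ 3" using \<rho>_nonneg by simp
    have "\<bar>s\<bar> ^ 4 \<le> \<bar>s\<bar> ^ 3" using s1 by (intro power_decreasing) auto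
    moreover have "(s\<^sup>2 / 2)\<^sup>2 = \<bar>s\<bar> ^ 4 / 4" by (simp add: power_divide power_even_abs)
    moreover have "0 \<le> \<bar>s\<bar> ^ 4" by simp
    ultimately show "(s\<^sup>2 / 2)\<^sup>2 \<le> 1 * \<bar>s\<bar> ^ 3" by linarith
  qed
  also have "\<dots> = (\<rho> + 1) * \<bar>t\<bar> ^ 3 / (real n * sqrt n)" unfolding s3 by (simp add: distrib_right add_divide_distrib)
  finally have "norm (f s - of_real (exp (- (s\<^sup>2) / 2))) \<le> (\<rho> + 1) * \<bar>t\<bar> ^ 3 / (real n * sqrt n)" .
  moreover have "- (s\<^sup>2) / 2 = - (t\<^sup>2) / (2 * real n)" by (simp add: s2)
  ultimately show ?thesis by (simp only: s_def)
qed

text \<open>The dominating function. Both \<open>f (t / \<surd>n)\<close> and the Gaussian factor are at most \<open>exp (- t\<^sup>2 / (4 * n))\<close>, so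
the difference of the \<open>n\<close>-th powers is \<open>n\<close> times the difference of the bases times the \<open>(n - 1)\<close>-th power of this
bound; for \<open>n \<ge> 2\<close> the latter is at most \<open>exp (- t\<^sup>2 / 8)\<close>.\<close>
lemma power_char_minus_gaussian_bound:
  assumes n: "n \<ge> 2" and t: "\<bar>t\<bar> \<le> \<delta> * sqrt n"
  shows "sqrt n * norm (f (t / sqrt n) ^ n - complex_of_real (exp (- (t\<^sup>2) / 2))) \<le> (\<rho> + 1) * \<bar>t\<bar> ^ 3 * exp (- (t\<^sup>2) / 8)"
proof -
  define u where "u = f (t / sqrt n)"
  define v where "v = complex_of_real (exp (- (t\<^sup>2) / (2 * real n)))"
  define r where "r = exp (- (t\<^sup>2) / (4 * real n))"
  have n0: "real n > 0" using n by simp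
  have ts: "\<bar>t\<bar> \<le> sqrt n" using t mult_right_mono[OF \<delta>(2), of "sqrt n"] by simp
  have u: "norm u \<le> r"
  proof -
    have "\<bar>t / sqrt n\<bar> \<le> \<delta>" using t n0 by (simp add: field_simps)
    from char_gaussian_bound[OF this] show ?thesis
      by (simp add: u_def r_def power_divide mult.commute)
  qed
  have v: "norm v \<le> r"
    unfolding v_def r_def using n0 by (simp add: field_simps)
  have vn: "v ^ n = complex_of_real (exp (- (t\<^sup>2) / 2))"
    unfolding v_def of_real_power[symmetric] exp_of_nat_mult[symmetric] using n0 by simp
  have rn: "r ^ (n - 1) \<le> exp (- (t\<^sup>2) / 8)"
  proof -
    have "r ^ (n - 1) = exp (real (n - 1) * (- (t\<^sup>2) / (4 * real n)))"
      unfolding r_def by (rule exp_of_nat_mult[symmetric])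
    also have "real (n - 1) * (- (t\<^sup>2) / (4 * real n)) \<le> - (t\<^sup>2) / 8"
    proof -
      have "t\<^sup>2 * real n \<le> t\<^sup>2 * (2 * (real n - 1))" using n by (intro mult_left_mono) auto
      then show ?thesis using n by (simp add: of_nat_diff field_simps)
    qed
    finally show ?thesis by simp
  qed
  have "norm (u ^ n - v ^ n) \<le> real n * r ^ (n - 1) * norm (u - v)"
    using u v n by (intro norm_power_diff_scaled) (auto simp: r_def)
  also have "\<dots> \<le> real n * exp (- (t\<^sup>2) / 8) * ((\<rho> + 1) * \<bar>t\<bar> ^ 3 / (real n * sqrt n))"
    using rn char_minus_gaussian_bound[of n t] n ts
    by (intro mult_mono) (auto simp: u_def v_def r_def simp del: of_real_exp)
  finally have "sqrt n * norm (u ^ n - v ^ n) \<le> sqrt n * (real n * exp (- (t\<^sup>2) / 8) * ((\<rho> + 1) * \<bar>t\<bar> ^ 3 / (real n * sqrt n)))"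
    by (rule mult_left_mono) simp
  also have "\<dots> = (\<rho> + 1) * \<bar>t\<bar> ^ 3 * exp (- (t\<^sup>2) / 8)" using n0 by simp
  finally show ?thesis unfolding vn u_def .
qed

text \<open>The pointwise limit. With \<open>v n ^ n = exp (- t\<^sup>2 / 2)\<close>, the quotient \<open>f (t / \<surd>n) / v n\<close> has the form
\<open>1 + a n / (n * \<surd>n)\<close> with convergent \<open>a\<close>.\<close>
lemma power_char_minus_gaussian_limit:
  "(\<lambda>n. sqrt n * (f (t / sqrt n) ^ n - complex_of_real (exp (- (t\<^sup>2) / 2)))) \<longlonglongrightarrow> \<alpha> * (\<i> * t) ^ 3 / 6 * complex_of_real (exp (- (t\<^sup>2) / 2))"
proof -
  define v where "v n = exp (- (t\<^sup>2) / (2 * real n))" for n :: nat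
  define a where "a n = (real n * sqrt n) * (f (t / sqrt n) - v n) / v n" for n :: nat
  have v1: "v \<longlonglongrightarrow> 1" unfolding v_def[abs_def] by real_asymp
  have v2: "(\<lambda>n. (real n * sqrt n) * (v n - (1 - t\<^sup>2 / (2 * real n)))) \<longlonglongrightarrow> 0"
  proof (rule Lim_null_comparison)
    show "(\<lambda>n. t ^ 4 / 4 * (1 / sqrt (real n))) \<longlonglongrightarrow> 0"
      using tendsto_mult_left[OF inverse_sqrt_tendsto_0, of "t ^ 4 / 4"] by simp
    show "\<forall>\<^sub>F n in sequentially. norm ((real n * sqrt n) * (v n - (1 - t\<^sup>2 / (2 * real n)))) \<le> t ^ 4 / 4 * (1 / sqrt (real n))"
      using eventually_gt_at_top[of 0]
    proof eventually_elim
      case (elim n)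
      have "\<bar>v n - (1 - t\<^sup>2 / (2 * real n))\<bar> \<le> (t\<^sup>2 / (2 * real n))\<^sup>2"
        using exp_quadratic_remainder[of "t\<^sup>2 / (2 * real n)"] by (simp add: v_def)
      then have "norm ((real n * sqrt n) * (v n - (1 - t\<^sup>2 / (2 * real n)))) \<le> (real n * sqrt n) * (t\<^sup>2 / (2 * real n))\<^sup>2"
        unfolding norm_mult by (intro mult_mono) auto
      also have "\<dots> = t ^ 4 / 4 * (1 / sqrt (real n))"
      proof -
        have "sqrt n * sqrt n = real n" by simp
        then show ?thesis using elim by (simp add: power_divide power2_eq_square field_simps power4_eq_xxxx)
      qed
      finally show ?case .
    qed
  qed
  have "(\<lambda>n. ((real n * sqrt n) * (f (t / sqrt n) - complex_of_real (1 - t\<^sup>2 / (2 * real n))) -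
        of_real ((real n * sqrt n) * (v n - (1 - t\<^sup>2 / (2 * real n))))) / of_real (v n)) \<longlonglongrightarrow>
        (\<alpha> * (\<i> * t) ^ 3 / 6 - of_real 0) / of_real 1"
    by (intro tendsto_intros char_taylor3 v1 v2) simp
  moreover have "X * (F - C) - X * (V - C) = X * (F - V)" for X F V C :: complex
    by (simp add: algebra_simps)
  ultimately have "a \<longlonglongrightarrow> \<alpha> * (\<i> * t) ^ 3 / 6"
    unfolding a_def[abs_def] by (simp only: of_real_mult[of "real _ * sqrt _"] of_real_diff of_real_0 of_real_1 div_by_1 diff_0_right)
  from tendsto_mult_right[OF tendsto_sqrt_one_plus_power[OF this], of "complex_of_real (exp (- (t\<^sup>2) / 2))"]
  have "(\<lambda>n. sqrt n * ((1 + a n / (n * sqrt n)) ^ n - 1) * complex_of_real (exp (- (t\<^sup>2) / 2))) \<longlonglongrightarrow> \<alpha> * (\<i> * t) ^ 3 / 6 * complex_of_real (exp (- (t\<^sup>2) / 2))"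
    by simp
  moreover have "\<forall>\<^sub>F n in sequentially. sqrt n * ((1 + a n / (n * sqrt n)) ^ n - 1) * complex_of_real (exp (- (t\<^sup>2) / 2))
     = sqrt n * (f (t / sqrt n) ^ n - complex_of_real (exp (- (t\<^sup>2) / 2)))"
    using eventually_gt_at_top[of 0]
  proof eventually_elim
    case (elim n)
    have v0: "complex_of_real (v n) \<noteq> 0" by (simp add: v_def)
    have vn: "complex_of_real (v n) ^ n = complex_of_real (exp (- (t\<^sup>2) / 2))"
    proof -
      have "v n ^ n = exp (- (t\<^sup>2) / 2)"
        unfolding v_def exp_of_nat_mult[symmetric] using elim by simp
      then show ?thesis by (simp only: of_real_power[symmetric])
    qed
    have "1 + a n / (n * sqrt n) = f (t / sqrt n) / v n"
      using elim v0 by (simp add: a_def field_simps)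
    then have "(1 + a n / (n * sqrt n)) ^ n * complex_of_real (exp (- (t\<^sup>2) / 2)) = f (t / sqrt n) ^ n"
      unfolding vn[symmetric] using v0 by (simp add: power_divide)
    moreover have gen: "s * (A - 1) * E = s * (A * E - E)" for s A E :: complex by (simp add: algebra_simps)
    ultimately show ?case by (simp only: gen)
  qed
  ultimately show ?thesis by (rule Lim_transform_eventually)
qed

end

section \<open>The smoothing error of the dithered sums\<close>

text \<open>The measure \<open>dt / \<bar>t\<bar>\<close> is invariant under scaling.\<close>
lemma smoothing_error_eq:
  assumes T: "T > 0" and [measurable]: "F \<in> borel_measurable borel" "G \<in> borel_measurable borel"
  shows "smoothing_error F G T = (\<integral>\<^sup>+t. ennreal (norm (F t - G t) / \<bar>t\<bar>) * indicator {-T..T} t \<partial>lborel)"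
proof -
  have "(\<integral>\<^sup>+t. ennreal (norm (F t - G t) / \<bar>t\<bar>) * indicator {-T..T} t \<partial>lborel)
    = \<bar>T\<bar> * (\<integral>\<^sup>+t. ennreal (norm (F (0 + T * t) - G (0 + T * t)) / \<bar>0 + T * t\<bar>) * indicator {-T..T} (0 + T * t) \<partial>lborel)"
    using T by (intro nn_integral_real_affine) auto
  also have "\<dots> = (\<integral>\<^sup>+t. \<bar>T\<bar> * (ennreal (norm (F (0 + T * t) - G (0 + T * t)) / \<bar>0 + T * t\<bar>) * indicator {-T..T} (0 + T * t)) \<partial>lborel)"
    by (rule nn_integral_cmult[symmetric]) measurable
  also have "\<dots> = smoothing_error F G T"
    unfolding smoothing_error_def
  proof (rule nn_integral_cong)
    fix t :: real
    have "indicator {-T..T} (0 + T * t) = (indicator {-1..1} t :: ennreal)"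
    proof -
      have "-T \<le> T * t \<longleftrightarrow> -1 \<le> t" "T * t \<le> T \<longleftrightarrow> t \<le> 1"
        using T mult_le_cancel_left_pos[of T "-1" t] mult_le_cancel_left_pos[of T t 1] by auto
      then show ?thesis by (simp add: indicator_def)
    qed
    moreover have "ennreal \<bar>T\<bar> * ennreal (norm (F (0 + T * t) - G (0 + T * t)) / \<bar>0 + T * t\<bar>)
       = ennreal (norm (F (t * T) - G (t * T)) / \<bar>t\<bar>)"
      using T by (simp add: ennreal_mult[symmetric] abs_mult mult.commute)
    ultimately show "ennreal \<bar>T\<bar> * (ennreal (norm (F (0 + T * t) - G (0 + T * t)) / \<bar>0 + T * t\<bar>) * indicator {-T..T} (0 + T * t))
       = ennreal (norm (F (t * T) - G (t * T)) / \<bar>t\<bar>) * indicator {-1..1} t"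
      by (simp only: mult.assoc[symmetric])
  qed
  finally show ?thesis ..
qed

lemma integrable_gaussian_moment8: "integrable lborel (\<lambda>t::real. \<bar>t\<bar> ^ k * exp (- (t\<^sup>2) / 8))"
proof -
  have "integrable lborel (\<lambda>t. normal_density 0 2 t * \<bar>t - 0\<bar> ^ k)"
    by (rule integrable_normal_moment_abs) simp
  then have "integrable lborel (\<lambda>t. sqrt (8 * pi) * (normal_density 0 2 t * \<bar>t - 0\<bar> ^ k))"
    by (rule integrable_mult_right)
  then show ?thesis by (simp add: normal_density_def mult.commute)
qed

lemma sqrt_mult_power_tendsto_0:
  assumes "0 \<le> q" "q < (1::real)"
  shows "(\<lambda>n. sqrt (real n) * q ^ n) \<longlonglongrightarrow> 0"
proof (rule Lim_null_comparison)
  show "(\<lambda>n. real n * q ^ n) \<longlonglongrightarrow> 0" using powser_times_n_limit_0[of q] assms by simp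
  show "\<forall>\<^sub>F n in sequentially. norm (sqrt (real n) * q ^ n) \<le> real n * q ^ n"
    using eventually_gt_at_top[of 0]
  proof eventually_elim
    case (elim n)
    then have "sqrt (real n) \<le> real n" by (simp add: sqrt_le_D real_le_lsqrt power2_eq_square)
    then show ?case using assms by (simp add: mult_right_mono)
  qed
qed

text \<open>The case of equality in \<open>\<bar>E (iexp (s * X))\<bar> \<le> 1\<close>: after a rotation the real part has mean one and is at most
one.\<close>
lemma (in real_distribution) AE_iexp_eq_char:
  assumes "norm (char M s) = 1"
  shows "AE x in M. iexp (s * x) = char M s"
proof -
  define c where "c = cnj (char M s)"
  have nc: "norm c = 1" using assms by (simp add: c_def)
  have cc: "c * char M s = 1" unfolding c_def
    using assms complex_norm_square[of "char M s"] by (simp add: mult.commute)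
  have int: "integrable M (\<lambda>x. c * iexp (s * x))" by (intro integrable_const_bound[of _ 1]) (auto simp: norm_mult nc)
  define R where "R x = Re (c * iexp (s * x))" for x
  have intR: "integrable M R" unfolding R_def[abs_def] by (rule integrable_Re[OF int])
  have "(\<integral>x. R x \<partial>M) = Re (\<integral>x. c * iexp (s * x) \<partial>M)"
    unfolding R_def by (rule integral_Re[OF int])
  also have "(\<integral>x. c * iexp (s * x) \<partial>M) = 1" using cc by (simp add: char_def)
  finally have "(\<integral>x. 1 - R x \<partial>M) = 0" using intR by (simp add: prob_space del: space_eq_univ)
  moreover have "R x \<le> 1" for x
    unfolding R_def using complex_Re_le_cmod[of "c * iexp (s * x)"] by (simp add: norm_mult nc)
  ultimately have "AE x in M. 1 - R x = 0"
    using intR by (subst (asm) integral_nonneg_eq_0_iff_AE) auto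
  then show ?thesis
  proof eventually_elim
    case (elim x)
    define z where "z = c * iexp (s * x)"
    have "norm z = 1" by (simp add: z_def norm_mult nc)
    moreover have Re: "Re z = 1" using elim by (simp add: R_def z_def)
    ultimately have "Im z = 0" using cmod_power2[of z] by simp
    then have "z = c * char M s" using Re cc by (simp add: complex_eq_iff)
    moreover have "c \<noteq> 0" using nc by auto
    ultimately show ?case unfolding z_def by simp
  qed
qed

text \<open>Hence the points where the modulus is one are periods of the modulus, and \<open>f\<close> looks near each of them as it
does near \<open>0\<close>.\<close>
lemma (in real_distribution) norm_char_shift:
  assumes "norm (char M s\<^sub>0) = 1"
  shows "norm (char M s) = norm (char M (s - s\<^sub>0))"
proof -
  have ae: "AE x in M. iexp (s\<^sub>0 * x) = char M s\<^sub>0"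
    by (rule AE_iexp_eq_char[OF assms])
  have "char M s = (\<integral>x. char M s\<^sub>0 * iexp ((s - s\<^sub>0) * x) \<partial>M)"
    unfolding char_def[of M s]
  proof (rule integral_cong_AE)
    show "AE x in M. iexp (s * x) = char M s\<^sub>0 * iexp ((s - s\<^sub>0) * x)"
      using ae
    proof eventually_elim
      case (elim x)
      show ?case unfolding elim[symmetric] exp_add[symmetric] by (simp add: algebra_simps)
    qed
  qed auto
  also have "\<dots> = char M s\<^sub>0 * char M (s - s\<^sub>0)" unfolding char_def[of M "s - s\<^sub>0"] by simp
  finally show ?thesis using assms by (simp add: norm_mult)
qed

text \<open>The number \<open>h\<close> is such that the noise of width \<open>h\<close> annihilates all points \<open>s \<noteq> 0\<close> with \<open>\<bar>f s\<bar> = 1\<close>. For the span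
\<open>h\<close> of a lattice law this holds; \<open>h = 0\<close> says that there are no such points.\<close>
locale spanned_law = standardized_law +
  fixes h :: real
  assumes h_nonneg: "h \<ge> 0"
    and span: "\<And>s. s \<noteq> 0 \<Longrightarrow> norm (f s) = 1 \<Longrightarrow> \<exists>k::int. k \<noteq> 0 \<and> h * s = 2 * pi * of_int k"
begin

text \<open>The Fourier transform of the noise.\<close>
definition w where "w s = char centred_uniform (h * s)"

lemma w_measurable [measurable]: "w \<in> borel_measurable borel"
proof -
  interpret U: real_distribution centred_uniform by (rule real_distribution_centred_uniform)
  show ?thesis unfolding w_def[abs_def] by measurable
qed

lemma gaussian_edgeworth_char_measurable [measurable]: "gaussian_edgeworth_char \<kappa> \<in> borel_measurable borel"
  unfolding gaussian_edgeworth_char_def[abs_def] by measurable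

lemma norm_w_le_1: "norm (w s) \<le> 1"
  unfolding w_def using real_distribution.cmod_char_le_1[OF real_distribution_centred_uniform] .

lemma norm_w_minus_1: "norm (w s - 1) \<le> h\<^sup>2 * s\<^sup>2"
  unfolding w_def using char_centred_uniform_quadratic[of "h * s"] by (simp add: power_mult_distrib)

lemma norm_w_diff: "norm (w s - w t) \<le> h * \<bar>s - t\<bar>"
  unfolding w_def using char_centred_uniform_lipschitz[of "h * s" "h * t"] h_nonneg
  by (simp add: right_diff_distrib[symmetric] abs_mult)

definition char_error where
  "char_error n t = f (t / sqrt n) ^ n * w (t / sqrt n) - gaussian_edgeworth_char (\<alpha> / (6 * sqrt n)) t" for n :: nat

lemma char_error_measurable [measurable]: "char_error n \<in> borel_measurable borel"
  unfolding char_error_def[abs_def] by measurable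

lemma char_error_eq:
  assumes "n > 0"
  shows "sqrt n * char_error n t = sqrt n * (f (t / sqrt n) ^ n - complex_of_real (exp (- (t\<^sup>2) / 2))) * w (t / sqrt n)
     + of_real (exp (- (t\<^sup>2) / 2)) * (sqrt n * (w (t / sqrt n) - 1)) - \<alpha> * (\<i> * t) ^ 3 / 6 * of_real (exp (- (t\<^sup>2) / 2))"
proof -
  have k: "complex_of_real (sqrt n) * complex_of_real (\<alpha> / (6 * sqrt n)) = \<alpha> / 6"
  proof -
    have "sqrt n * (\<alpha> / (6 * sqrt n)) = \<alpha> / 6" using assms by simp
    then show ?thesis by (simp only: of_real_mult[symmetric])
  qed
  have "S * (A * W - E * (1 + K * C)) = S * (A - E) * W + E * (S * (W - 1)) - (S * K) * C * E" for S A W E K C :: complex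
    by (simp add: algebra_simps)
  from this[of "complex_of_real (sqrt n)" _ _ _ "complex_of_real (\<alpha> / (6 * sqrt n))", unfolded k] show ?thesis
    unfolding char_error_def gaussian_edgeworth_char_def by simp
qed

lemma sqrt_w_minus_1: "n > 0 \<Longrightarrow> norm (sqrt n * (w (t / sqrt n) - 1)) \<le> h\<^sup>2 * t\<^sup>2 * (1 / sqrt n)" for n :: nat
proof -
  assume n: "n > 0"
  have "norm (sqrt n * (w (t / sqrt n) - 1)) \<le> sqrt n * (h\<^sup>2 * (t / sqrt n)\<^sup>2)"
    unfolding norm_mult using norm_w_minus_1 by (intro mult_mono) auto
  also have "\<dots> = h\<^sup>2 * t\<^sup>2 * (1 / sqrt n)"
    using n by (simp add: power_divide real_div_sqrt field_simps)
  finally show ?thesis .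
qed

lemma char_error_limit: "(\<lambda>n. sqrt n * norm (char_error n t)) \<longlonglongrightarrow> 0"
proof -
  have w0: "(\<lambda>n. sqrt (real n) * (w (t / sqrt n) - 1)) \<longlonglongrightarrow> 0"
  proof (rule Lim_null_comparison)
    show "(\<lambda>n. h\<^sup>2 * t\<^sup>2 * (1 / sqrt (real n))) \<longlonglongrightarrow> 0"
      using tendsto_mult_left[OF inverse_sqrt_tendsto_0, of "h\<^sup>2 * t\<^sup>2"] by simp
    show "\<forall>\<^sub>F n in sequentially. norm (sqrt (real n) * (w (t / sqrt n) - 1)) \<le> h\<^sup>2 * t\<^sup>2 * (1 / sqrt (real n))"
      using eventually_gt_at_top[of 0] by eventually_elim (rule sqrt_w_minus_1)
  qed
  have w1: "(\<lambda>n. w (t / sqrt (real n))) \<longlonglongrightarrow> 1"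
  proof (rule LIM_zero_cancel, rule Lim_null_comparison)
    show "(\<lambda>n. h\<^sup>2 * (t * (1 / sqrt (real n)))\<^sup>2) \<longlonglongrightarrow> 0"
      using tendsto_mult_left[OF tendsto_power[OF tendsto_mult_left[OF inverse_sqrt_tendsto_0, of t], of 2], of "h\<^sup>2"] by simp
    show "\<forall>\<^sub>F n in sequentially. norm (w (t / sqrt (real n)) - 1) \<le> h\<^sup>2 * (t * (1 / sqrt (real n)))\<^sup>2"
      using norm_w_minus_1 by (intro always_eventually) simp
  qed
  have "(\<lambda>n. sqrt n * (f (t / sqrt n) ^ n - complex_of_real (exp (- (t\<^sup>2) / 2))) * w (t / sqrt n)
     + of_real (exp (- (t\<^sup>2) / 2)) * (sqrt n * (w (t / sqrt n) - 1)) - \<alpha> * (\<i> * t) ^ 3 / 6 * of_real (exp (- (t\<^sup>2) / 2)))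
     \<longlonglongrightarrow> \<alpha> * (\<i> * t) ^ 3 / 6 * of_real (exp (- (t\<^sup>2) / 2)) * 1 + of_real (exp (- (t\<^sup>2) / 2)) * 0 - \<alpha> * (\<i> * t) ^ 3 / 6 * of_real (exp (- (t\<^sup>2) / 2))"
    by (intro tendsto_diff tendsto_add tendsto_mult power_char_minus_gaussian_limit w1 w0 tendsto_const)
  then have "(\<lambda>n. sqrt n * (f (t / sqrt n) ^ n - complex_of_real (exp (- (t\<^sup>2) / 2))) * w (t / sqrt n)
     + of_real (exp (- (t\<^sup>2) / 2)) * (sqrt n * (w (t / sqrt n) - 1)) - \<alpha> * (\<i> * t) ^ 3 / 6 * of_real (exp (- (t\<^sup>2) / 2)))
     \<longlonglongrightarrow> 0" by (simp only: mult_1_right mult_zero_right add_0_right diff_self)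
  moreover have "\<forall>\<^sub>F n in sequentially. sqrt n * (f (t / sqrt n) ^ n - complex_of_real (exp (- (t\<^sup>2) / 2))) * w (t / sqrt n)
     + of_real (exp (- (t\<^sup>2) / 2)) * (sqrt n * (w (t / sqrt n) - 1)) - \<alpha> * (\<i> * t) ^ 3 / 6 * of_real (exp (- (t\<^sup>2) / 2)) = sqrt n * char_error n t"
    using eventually_gt_at_top[of 0] by eventually_elim (rule char_error_eq[symmetric])
  ultimately have "(\<lambda>n. sqrt n * char_error n t) \<longlonglongrightarrow> 0" by (rule Lim_transform_eventually)
  from tendsto_norm[OF this] show ?thesis by (simp add: norm_mult)
qed

definition error_const where "error_const = 2 * \<rho> + 1 + h\<^sup>2"

lemma char_error_bound:
  assumes n: "n \<ge> 2" and t: "\<bar>t\<bar> \<le> \<delta> * sqrt n" "t \<noteq> 0"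
  shows "sqrt n * norm (char_error n t) / \<bar>t\<bar> \<le> error_const * ((1 + \<bar>t\<bar> ^ 2) * exp (- (t\<^sup>2) / 8))"
proof -
  let ?E = "exp (- (t\<^sup>2) / 2)" and ?e = "exp (- (t\<^sup>2) / 8)"
  have E: "?E \<le> ?e" by simp
  have n0: "n > 0" using n by simp
  define X where "X = sqrt n * (f (t / sqrt n) ^ n - complex_of_real ?E) * w (t / sqrt n)"
  define Y where "Y = complex_of_real ?E * (sqrt n * (w (t / sqrt n) - 1))"
  define Z where "Z = \<alpha> * (\<i> * t) ^ 3 / 6 * complex_of_real ?E"
  have X: "norm X \<le> (\<rho> + 1) * \<bar>t\<bar> ^ 3 * ?e"
  proof -
    have "norm X \<le> norm (sqrt n * (f (t / sqrt n) ^ n - complex_of_real ?E)) * 1"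
      unfolding X_def norm_mult[of _ "w _"] using norm_w_le_1 by (intro mult_left_mono) auto
    also have "\<dots> = sqrt n * norm (f (t / sqrt n) ^ n - complex_of_real ?E)" by (simp only: norm_mult norm_of_real) simp
    also have "\<dots> \<le> (\<rho> + 1) * \<bar>t\<bar> ^ 3 * ?e" by (rule power_char_minus_gaussian_bound[OF n t(1)])
    finally show ?thesis .
  qed
  have Y: "norm Y \<le> h\<^sup>2 * \<bar>t\<bar> ^ 2 * ?e"
  proof -
    have "norm Y = ?E * norm (sqrt n * (w (t / sqrt n) - 1))" unfolding Y_def norm_mult[of "complex_of_real ?E"] norm_of_real by simp
    also have "\<dots> \<le> ?e * (h\<^sup>2 * t\<^sup>2 * (1 / sqrt n))"
      using E sqrt_w_minus_1[OF n0] by (intro mult_mono) auto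
    also have "\<dots> \<le> ?e * (h\<^sup>2 * t\<^sup>2 * 1)"
      using n0 by (intro mult_left_mono) auto
    finally show ?thesis by (simp add: mult.commute)
  qed
  have Z: "norm Z \<le> \<rho> * \<bar>t\<bar> ^ 3 * ?e"
  proof -
    have "norm Z = \<bar>\<alpha>\<bar> * \<bar>t\<bar> ^ 3 / 6 * ?E" unfolding Z_def norm_mult norm_divide norm_power norm_of_real by simp
    also have "\<dots> \<le> \<rho> * \<bar>t\<bar> ^ 3 * ?e"
    proof (intro mult_mono E)
      have "\<bar>\<alpha>\<bar> * \<bar>t\<bar> ^ 3 \<le> \<rho> * \<bar>t\<bar> ^ 3" by (intro mult_right_mono abs_\<alpha>_le) simp
      moreover have "0 \<le> \<bar>\<alpha>\<bar> * \<bar>t\<bar> ^ 3" by simp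
      ultimately show "\<bar>\<alpha>\<bar> * \<bar>t\<bar> ^ 3 / 6 \<le> \<rho> * \<bar>t\<bar> ^ 3" by argo
    qed (use \<rho>_nonneg in auto)
    finally show ?thesis .
  qed
  have "sqrt n * norm (char_error n t) = norm (sqrt n * char_error n t)" by (simp add: norm_mult)
  also have "\<dots> = norm (X + Y - Z)" unfolding char_error_eq[OF n0] X_def Y_def Z_def by simp
  also have "\<dots> \<le> norm X + norm Y + norm Z"
    using norm_triangle_ineq4[of "X + Y" Z] norm_triangle_ineq[of X Y] by linarith
  also have "\<dots> \<le> (\<rho> + 1) * \<bar>t\<bar> ^ 3 * ?e + h\<^sup>2 * \<bar>t\<bar> ^ 2 * ?e + \<rho> * \<bar>t\<bar> ^ 3 * ?e"
    using X Y Z by simp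
  also have "\<dots> = ((2 * \<rho> + 1) * \<bar>t\<bar> ^ 2 + h\<^sup>2 * \<bar>t\<bar>) * ?e * \<bar>t\<bar>"
    by (simp add: power3_eq_cube power2_eq_square algebra_simps)
  finally have "sqrt n * norm (char_error n t) / \<bar>t\<bar> \<le> ((2 * \<rho> + 1) * \<bar>t\<bar> ^ 2 + h\<^sup>2 * \<bar>t\<bar>) * ?e"
    using t(2) by (simp add: pos_divide_le_eq)
  also have "\<dots> \<le> ((2 * \<rho> + 1) * (1 + \<bar>t\<bar> ^ 2) + h\<^sup>2 * (1 + \<bar>t\<bar> ^ 2)) * ?e"
  proof (intro mult_right_mono add_mono mult_left_mono)
    have "2 * \<bar>t\<bar> \<le> 1 + \<bar>t\<bar> ^ 2" using sum_squares_bound[of 1 "\<bar>t\<bar>"] by simp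
    then show "\<bar>t\<bar> \<le> 1 + \<bar>t\<bar> ^ 2" by simp
  qed (use \<rho>_nonneg in auto)
  also have "\<dots> = error_const * ((1 + \<bar>t\<bar> ^ 2) * ?e)" unfolding error_const_def by (simp add: algebra_simps)
  finally show ?thesis .
qed

lemma error_const_pos: "error_const > 0"
  unfolding error_const_def using \<rho>_nonneg by (simp add: add_pos_nonneg)

text \<open>Dividing by \<open>\<bar>t\<bar>\<close> is harmless at the origin, since the deviation is at most of order \<open>t\<^sup>2\<close>. The shift by
two is due to the bound \<open>char_error_bound\<close>.\<close>
lemma central_limit:
  "(\<lambda>n. \<integral>\<^sup>+t. ennreal (sqrt n * norm (char_error n t) / \<bar>t\<bar>) * indicator {-(\<delta> * sqrt n)..\<delta> * sqrt n} t \<partial>lborel) \<longlonglongrightarrow> 0"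
proof -
  let ?u = "\<lambda>n t. ennreal (sqrt n * norm (char_error n t) / \<bar>t\<bar>) * indicator {-(\<delta> * sqrt n)..\<delta> * sqrt n} t"
  let ?b = "\<lambda>t. ennreal (error_const * ((1 + \<bar>t\<bar> ^ 2) * exp (- (t\<^sup>2) / 8)))"
  have "(\<lambda>n. \<integral>\<^sup>+t. ?u (n + 2) t \<partial>lborel) \<longlonglongrightarrow> (\<integral>\<^sup>+t. 0 \<partial>(lborel::real measure))"
  proof (rule nn_integral_dominated_convergence[where w = ?b])
    show "AE t in lborel. ?u (n + 2) t \<le> ?b t" for n
      using AE_lborel_singleton[of 0]
    proof eventually_elim
      case (elim t)
      show ?case
      proof (cases "t \<in> {-(\<delta> * sqrt (n + 2))..\<delta> * sqrt (n + 2)}")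
        case True
        then have "sqrt (n + 2) * norm (char_error (n + 2) t) / \<bar>t\<bar> \<le> error_const * ((1 + \<bar>t\<bar> ^ 2) * exp (- (t\<^sup>2) / 8))"
          using elim char_error_bound[of "n + 2" t] by auto
        from ennreal_leI[OF this] True show ?thesis by simp
      next
        case False
        then show ?thesis by (subst indicator_simps(2)[OF False]) simp
      qed
    qed
    have "integrable lborel (\<lambda>t. error_const * ((1 + \<bar>t\<bar> ^ 2) * exp (- (t\<^sup>2) / 8)))"
      using integrable_gaussian_moment8[of 0] integrable_gaussian_moment8[of 2] by (simp add: distrib_right)
    then show "(\<integral>\<^sup>+t. ?b t \<partial>lborel) < \<infinity>"
      using error_const_pos by (subst nn_integral_eq_integral) auto
    show "AE t in lborel. (\<lambda>n. ?u (n + 2) t) \<longlonglongrightarrow> 0"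
    proof (rule AE_I2)
      fix t :: real
      have 1: "(\<lambda>n. ennreal (sqrt n * norm (char_error n t) / \<bar>t\<bar>)) \<longlonglongrightarrow> ennreal (0 / \<bar>t\<bar>)"
        using tendsto_mult_right[OF char_error_limit[of t], of "1 / \<bar>t\<bar>"] by (intro tendsto_ennrealI) simp
      have "(\<lambda>n. ?u n t) \<longlonglongrightarrow> 0"
      proof (rule tendsto_sandwich[OF _ _ tendsto_const])
        show "(\<lambda>n. ennreal (sqrt n * norm (char_error n t) / \<bar>t\<bar>)) \<longlonglongrightarrow> 0" using 1 by simp
      qed (auto simp: indicator_def)
      then show "(\<lambda>n. ?u (n + 2) t) \<longlonglongrightarrow> 0" by (rule LIMSEQ_ignore_initial_segment)
    qed
  qed auto
  then have "(\<lambda>n. \<integral>\<^sup>+t. ?u (n + 2) t \<partial>lborel) \<longlonglongrightarrow> 0" by simp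
  then show ?thesis by (rule LIMSEQ_offset)
qed

lemma gaussian_tail_limit:
  "(\<lambda>n. \<integral>\<^sup>+t. ennreal (norm (gaussian_edgeworth_char (\<alpha> / (6 * sqrt n)) t)) * indicator {t. \<delta> * sqrt n \<le> \<bar>t\<bar>} t \<partial>lborel) \<longlonglongrightarrow> 0"
proof -
  let ?u = "\<lambda>(n::nat) t. ennreal (norm (gaussian_edgeworth_char (\<alpha> / (6 * sqrt n)) t)) * indicator {t. \<delta> * sqrt n \<le> \<bar>t\<bar>} t"
  let ?b = "\<lambda>t. ennreal ((1 + \<rho> * \<bar>t\<bar> ^ 3) * exp (- (t\<^sup>2) / 8))"
  have bd: "norm (gaussian_edgeworth_char (\<alpha> / (6 * sqrt n)) t) \<le> (1 + \<rho> * \<bar>t\<bar> ^ 3) * exp (- (t\<^sup>2) / 8)" for n :: nat and t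
  proof -
    have k: "\<bar>\<alpha> / (6 * sqrt n)\<bar> \<le> \<rho>"
    proof (cases "n = 0")
      case False
      then have "1 \<le> sqrt n" by simp
      then have "1 \<le> \<bar>6 * sqrt n\<bar>" by argo
      then have "\<bar>\<alpha> / (6 * sqrt n)\<bar> \<le> \<bar>\<alpha>\<bar> / 1" unfolding abs_divide using False by (intro divide_left_mono) auto
      then show ?thesis using abs_\<alpha>_le by simp
    qed (simp add: \<rho>_nonneg)
    have "norm (gaussian_edgeworth_char (\<alpha> / (6 * sqrt n)) t) = exp (- (t\<^sup>2) / 2) * norm (1 + complex_of_real (\<alpha> / (6 * sqrt n)) * (\<i> * t) ^ 3)"
      unfolding gaussian_edgeworth_char_def norm_mult norm_of_real by simp
    also have "\<dots> \<le> exp (- (t\<^sup>2) / 8) * (1 + \<rho> * \<bar>t\<bar> ^ 3)"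
    proof (rule mult_mono)
      have "norm (1 + complex_of_real (\<alpha> / (6 * sqrt n)) * (\<i> * t) ^ 3) \<le> norm (1::complex) + norm (complex_of_real (\<alpha> / (6 * sqrt n)) * (\<i> * t) ^ 3)"
        by (rule norm_triangle_ineq)
      also have "\<dots> = 1 + \<bar>\<alpha> / (6 * sqrt n)\<bar> * \<bar>t\<bar> ^ 3" unfolding norm_mult norm_power norm_of_real by simp
      also have "\<dots> \<le> 1 + \<rho> * \<bar>t\<bar> ^ 3" using k by (intro add_left_mono mult_right_mono) auto
      finally show "norm (1 + complex_of_real (\<alpha> / (6 * sqrt n)) * (\<i> * t) ^ 3) \<le> 1 + \<rho> * \<bar>t\<bar> ^ 3" .
    qed auto
    finally show ?thesis by (simp add: mult.commute)
  qed
  have "(\<lambda>n. \<integral>\<^sup>+t. ?u n t \<partial>lborel) \<longlonglongrightarrow> (\<integral>\<^sup>+t. 0 \<partial>(lborel::real measure))"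
  proof (rule nn_integral_dominated_convergence[where w = ?b])
    show "AE t in lborel. ?u n t \<le> ?b t" for n
      using bd by (intro AE_I2) (auto simp: indicator_def intro!: ennreal_leI)
    have "integrable lborel (\<lambda>t. (1 + \<rho> * \<bar>t\<bar> ^ 3) * exp (- (t\<^sup>2) / 8))"
      using integrable_gaussian_moment8[of 0] integrable_gaussian_moment8[of 3] by (simp add: distrib_right mult.assoc)
    then show "(\<integral>\<^sup>+t. ?b t \<partial>lborel) < \<infinity>"
      using \<rho>_nonneg by (subst nn_integral_eq_integral) auto
    show "AE t in lborel. (\<lambda>n. ?u n t) \<longlonglongrightarrow> 0"
    proof (rule AE_I2)
      fix t :: real
      have "filterlim (\<lambda>n. \<delta> * sqrt (real n)) at_top sequentially"
        by (rule filterlim_tendsto_pos_mult_at_top[OF tendsto_const \<delta>(1)]) real_asymp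
      then have "\<forall>\<^sub>F n in sequentially. \<bar>t\<bar> < \<delta> * sqrt (real n)" by (simp add: filterlim_at_top_dense)
      then have "\<forall>\<^sub>F n in sequentially. ?u n t = 0" by eventually_elim (simp add: indicator_def)
      then show "(\<lambda>n. ?u n t) \<longlonglongrightarrow> 0" by (rule tendsto_eventually)
    qed
  qed auto
  then show ?thesis by simp
qed

lemma norm_char_lt_1_AE: "AE s in lborel. norm (f s) < 1"
proof -
  have sub: "{s. norm (f s) = 1} \<subseteq> {0} \<union> range (\<lambda>k::int. 2 * pi * of_int k / h)"
  proof
    fix s assume "s \<in> {s. norm (f s) = 1}"
    then have s: "norm (f s) = 1" by simp
    show "s \<in> {0} \<union> range (\<lambda>k::int. 2 * pi * of_int k / h)"
    proof (cases "s = 0")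
      case False
      from span[OF this s] obtain k :: int where "k \<noteq> 0" "h * s = 2 * pi * of_int k" by blast
      moreover from this have "h \<noteq> 0" by auto
      ultimately have "s = 2 * pi * of_int k / h" by (simp add: field_simps)
      then show ?thesis by blast
    qed simp
  qed
  have "countable ({0} \<union> range (\<lambda>k::int. 2 * pi * of_int k / h))" by simp
  then have "countable {s. norm (f s) = 1}" using sub countable_subset by blast
  then have "AE s in lborel. s \<notin> {s. norm (f s) = 1}"
    by (intro AE_not_in countable_imp_null_set_lborel)
  then show ?thesis
  proof eventually_elim
    case (elim s)
    then show ?case using cmod_char_le_1[of s] by auto
  qed
qed

text \<open>Away from the origin there are two kinds of points. If \<open>\<bar>f s\<^sub>0\<bar> < 1\<close>, the powers decay geometrically around
\<open>s\<^sub>0\<close>. If \<open>\<bar>f s\<^sub>0\<bar> = 1\<close>, then \<open>\<bar>f s\<bar> ^ n \<le> exp (- n * x\<^sup>2 / 4)\<close> with \<open>x = \<bar>s - s\<^sub>0\<bar>\<close>, while the noise factor vanishes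
at \<open>s\<^sub>0\<close> and is at most \<open>h * x\<close>; their product with \<open>\<surd>n\<close> stays bounded because \<open>y * exp (- y\<^sup>2 / 4) \<le> 1\<close>.\<close>
lemma local_bound:
  assumes "s\<^sub>0 \<noteq> 0"
  shows "\<exists>r>0. \<exists>B. \<forall>s\<in>ball s\<^sub>0 r. \<forall>n. sqrt (real n) * norm (f s) ^ n * norm (w s) \<le> B"
proof (cases "norm (f s\<^sub>0) = 1")
  case True
  from span[OF assms True] obtain k :: int where k: "k \<noteq> 0" "h * s\<^sub>0 = 2 * pi * of_int k" by blast
  have w0: "w s\<^sub>0 = 0" unfolding w_def k(2) by (rule char_centred_uniform_zero[OF k(1)])
  show ?thesis
  proof (rule exI[of _ \<delta>], intro conjI \<delta>(1), rule exI[of _ h], intro ballI allI)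
    fix s n assume s: "s \<in> ball s\<^sub>0 \<delta>"
    define x where "x = \<bar>s - s\<^sub>0\<bar>"
    have x: "0 \<le> x" "x \<le> \<delta>" using s by (auto simp: x_def dist_real_def)
    have "norm (f s) \<le> exp (- (x\<^sup>2) / 4)"
      unfolding norm_char_shift[OF True, of s] using char_gaussian_bound[of "s - s\<^sub>0"] x by (simp add: x_def)
    then have "norm (f s) ^ n \<le> exp (- (x\<^sup>2) / 4) ^ n" by (intro power_mono) auto
    also have "\<dots> = exp (- ((sqrt n * x)\<^sup>2) / 4)"
      by (simp add: exp_of_nat_mult[symmetric] power_mult_distrib)
    finally have 1: "norm (f s) ^ n \<le> exp (- ((sqrt n * x)\<^sup>2) / 4)" .
    have "norm (w s) \<le> h * x" using norm_w_diff[of s s\<^sub>0] w0 by (simp add: x_def)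
    then have "sqrt (real n) * norm (f s) ^ n * norm (w s) \<le> sqrt (real n) * exp (- ((sqrt n * x)\<^sup>2) / 4) * (h * x)"
      using 1 by (intro mult_mono) auto
    also have "\<dots> = h * ((sqrt n * x) * exp (- ((sqrt n * x)\<^sup>2) / 4))" by simp
    also have "\<dots> \<le> h * 1"
    proof (intro mult_left_mono h_nonneg)
      define y where "y = sqrt n * x"
      have "0 \<le> (y / 2 - 1)\<^sup>2" by simp
      then have "y \<le> 1 + y\<^sup>2 / 4" by (simp add: power2_eq_square algebra_simps)
      also have "\<dots> \<le> exp (y\<^sup>2 / 4)" by (rule exp_ge_add_one_self)
      finally show "(sqrt n * x) * exp (- ((sqrt n * x)\<^sup>2) / 4) \<le> 1"
        unfolding y_def[symmetric] by (simp add: exp_minus field_simps)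
    qed
    finally show "sqrt (real n) * norm (f s) ^ n * norm (w s) \<le> h" by simp
  qed
next
  case False
  then have lt: "norm (f s\<^sub>0) < 1" using cmod_char_le_1[of s\<^sub>0] by simp
  define q where "q = (1 + norm (f s\<^sub>0)) / 2"
  have q: "0 \<le> q" "q < 1" "norm (f s\<^sub>0) < q" using lt by (auto simp: q_def add_nonneg_nonneg)
  have "isCont (\<lambda>s. norm (f s)) s\<^sub>0" by (intro continuous_intros isCont_char)
  then have "\<forall>\<^sub>F s in at s\<^sub>0. norm (f s) < q" using q(3) by (simp add: isCont_def order_tendstoD)
  then obtain r where r: "r > 0" "\<And>s. s \<noteq> s\<^sub>0 \<Longrightarrow> dist s s\<^sub>0 < r \<Longrightarrow> norm (f s) < q"
    unfolding eventually_at by auto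
  have "Bseq (\<lambda>n. sqrt (real n) * q ^ n)"
    using sqrt_mult_power_tendsto_0[OF q(1,2)] convergentI convergent_imp_Bseq by blast
  then obtain B where B: "\<And>n. norm (sqrt (real n) * q ^ n) \<le> B" by (auto simp: Bseq_def)
  show ?thesis
  proof (rule exI[of _ r], intro conjI r(1), rule exI[of _ B], intro ballI allI)
    fix s n assume "s \<in> ball s\<^sub>0 r"
    then have "norm (f s) \<le> q" using r(2)[of s] q(3) by (cases "s = s\<^sub>0") (auto simp: dist_commute)
    then have "sqrt (real n) * norm (f s) ^ n * norm (w s) \<le> sqrt (real n) * q ^ n * 1"
      using norm_w_le_1 q(1) by (intro mult_mono power_mono) auto
    also have "\<dots> \<le> B" using B[of n] by simp
    finally show "sqrt (real n) * norm (f s) ^ n * norm (w s) \<le> B" .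
  qed
qed

lemma compact_bound:
  assumes K: "compact K" "0 \<notin> K"
  obtains B where "B \<ge> 0" "\<And>s n. s \<in> K \<Longrightarrow> sqrt (real n) * norm (f s) ^ n * norm (w s) \<le> B"
proof -
  have "\<forall>s\<^sub>0\<in>K. \<exists>r>0. \<exists>B. \<forall>s\<in>ball s\<^sub>0 r. \<forall>n. sqrt (real n) * norm (f s) ^ n * norm (w s) \<le> B"
    using local_bound K(2) by metis
  then obtain r B where r: "\<And>s\<^sub>0. s\<^sub>0 \<in> K \<Longrightarrow> r s\<^sub>0 > 0"
    and B: "\<And>s\<^sub>0 s n. s\<^sub>0 \<in> K \<Longrightarrow> s \<in> ball s\<^sub>0 (r s\<^sub>0) \<Longrightarrow> sqrt (real n) * norm (f s) ^ n * norm (w s) \<le> B s\<^sub>0"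
    by metis
  have "K \<subseteq> (\<Union>s\<in>K. ball s (r s))" using r by force
  then obtain C where C: "C \<subseteq> K" "finite C" "K \<subseteq> (\<Union>s\<in>C. ball s (r s))"
    using compactE_image[OF K(1), of K "\<lambda>s. ball s (r s)"] by auto
  show ?thesis
  proof (rule that[of "\<Sum>s\<in>C. \<bar>B s\<bar>"])
    fix s n assume "s \<in> K"
    then obtain s\<^sub>0 where s0: "s\<^sub>0 \<in> C" "s \<in> ball s\<^sub>0 (r s\<^sub>0)" using C(3) by auto
    then have "sqrt (real n) * norm (f s) ^ n * norm (w s) \<le> B s\<^sub>0" using C(1) B by blast
    also have "\<dots> \<le> \<bar>B s\<^sub>0\<bar>" by simp
    also have "\<dots> \<le> (\<Sum>s\<in>C. \<bar>B s\<bar>)" using s0 C(2) member_le_sum[of s\<^sub>0 C "\<lambda>s. \<bar>B s\<bar>"] by simp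
    finally show "sqrt (real n) * norm (f s) ^ n * norm (w s) \<le> (\<Sum>s\<in>C. \<bar>B s\<bar>)" .
  qed (simp add: sum_nonneg)
qed

text \<open>Bounded convergence on a compact set: the bound comes from \<open>local_bound\<close> by finitely many balls, and the
integrand tends to \<open>0\<close> wherever \<open>\<bar>f s\<bar> < 1\<close>, that is outside a countable set.\<close>
lemma outer_limit:
  assumes K: "compact K" "0 \<notin> K"
  shows "(\<lambda>n. \<integral>\<^sup>+s. ennreal (sqrt n * norm (f s) ^ n * norm (w s)) * indicator K s \<partial>lborel) \<longlonglongrightarrow> 0"
proof -
  obtain B where B: "B \<ge> 0" "\<And>s n. s \<in> K \<Longrightarrow> sqrt (real n) * norm (f s) ^ n * norm (w s) \<le> B"
    using compact_bound[OF K] by metis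
  have [measurable]: "K \<in> sets borel" using K(1) by (simp add: compact_imp_closed)
  have "(\<lambda>n. \<integral>\<^sup>+s. ennreal (sqrt n * norm (f s) ^ n * norm (w s)) * indicator K s \<partial>lborel) \<longlonglongrightarrow> (\<integral>\<^sup>+s. 0 \<partial>(lborel::real measure))"
  proof (rule nn_integral_dominated_convergence[where w = "\<lambda>s. ennreal B * indicator K s"])
    show "AE s in lborel. ennreal (sqrt n * norm (f s) ^ n * norm (w s)) * indicator K s \<le> ennreal B * indicator K s" for n :: nat
      using B(2) by (intro AE_I2) (auto simp: indicator_def intro!: ennreal_leI)
    have "(\<integral>\<^sup>+s. ennreal B * indicator K s \<partial>lborel) = ennreal B * emeasure lborel K"
      by (rule nn_integral_cmult_indicator) simp
    also have "\<dots> < \<infinity>"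
      using emeasure_bounded_finite[of K] compact_imp_bounded[OF K(1)] by (simp add: ennreal_mult_less_top)
    finally show "(\<integral>\<^sup>+s. ennreal B * indicator K s \<partial>lborel) < \<infinity>" .
    show "AE s in lborel. (\<lambda>n. ennreal (sqrt n * norm (f s) ^ n * norm (w s)) * indicator K s) \<longlonglongrightarrow> 0"
      using norm_char_lt_1_AE
    proof eventually_elim
      case (elim s)
      have "(\<lambda>n. ennreal (sqrt n * norm (f s) ^ n * norm (w s))) \<longlonglongrightarrow> ennreal (0 * norm (w s))"
        by (intro tendsto_ennrealI tendsto_mult tendsto_const sqrt_mult_power_tendsto_0 elim) simp
      then show ?case
        by (cases "s \<in> K") auto
    qed
  qed auto
  then show ?thesis by simp
qed

text \<open>The range \<open>\<bar>t\<bar> \<le> a * \<surd>n\<close> is split at \<open>\<delta> * \<surd>n\<close>. Beyond that point \<open>\<surd>n / \<bar>t\<bar> \<le> 1 / \<delta>\<close>, and the two transforms are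
estimated separately.\<close>
theorem smoothing_error_limit:
  assumes a: "a > 0"
  shows "(\<lambda>n. ennreal (sqrt n) * smoothing_error (\<lambda>t. f (t / sqrt n) ^ n * w (t / sqrt n))
      (gaussian_edgeworth_char (\<alpha> / (6 * sqrt n))) (a * sqrt n)) \<longlonglongrightarrow> 0"
proof -
  define K where "K = {-a..a} \<inter> {s. \<delta> \<le> \<bar>s\<bar>}"
  have "closed {s::real. \<delta> \<le> \<bar>s\<bar>}" by (intro closed_Collect_le continuous_intros)
  then have K: "compact K" "0 \<notin> K" using \<delta>(1) by (auto simp: K_def compact_Int_closed)
  have [measurable]: "K \<in> sets borel" using K(1) by (simp add: compact_imp_closed)
  define A where "A n = (\<integral>\<^sup>+t. ennreal (sqrt n * norm (char_error n t) / \<bar>t\<bar>) * indicator {-(\<delta> * sqrt n)..\<delta> * sqrt n} t \<partial>lborel)" for n :: nat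
  define B where "B n = (\<integral>\<^sup>+t. ennreal (norm (gaussian_edgeworth_char (\<alpha> / (6 * sqrt n)) t)) * indicator {t. \<delta> * sqrt n \<le> \<bar>t\<bar>} t \<partial>lborel)" for n :: nat
  define J where "J n = (\<integral>\<^sup>+s. ennreal (sqrt n * norm (f s) ^ n * norm (w s)) * indicator K s \<partial>lborel)" for n :: nat
  have upper: "ennreal (sqrt n) * smoothing_error (\<lambda>t. f (t / sqrt n) ^ n * w (t / sqrt n))
      (gaussian_edgeworth_char (\<alpha> / (6 * sqrt n))) (a * sqrt n) \<le> A n + ennreal (1 / \<delta>) * (J n + B n)" if n: "n > 0" for n :: nat
  proof -
    let ?G = "gaussian_edgeworth_char (\<alpha> / (6 * sqrt n))"
    let ?F = "\<lambda>t. f (t / sqrt n) ^ n * w (t / sqrt n)"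
    have J: "J n = (\<integral>\<^sup>+t. ennreal (norm (?F t)) * indicator K (t / sqrt n) \<partial>lborel)"
    proof -
      have "(\<integral>\<^sup>+t. ennreal (norm (?F t)) * indicator K (t / sqrt n) \<partial>lborel)
        = \<bar>sqrt n\<bar> * (\<integral>\<^sup>+s. ennreal (norm (?F (0 + sqrt n * s))) * indicator K ((0 + sqrt n * s) / sqrt n) \<partial>lborel)"
        using n by (intro nn_integral_real_affine) auto
      also have "\<dots> = (\<integral>\<^sup>+s. \<bar>sqrt n\<bar> * (ennreal (norm (?F (0 + sqrt n * s))) * indicator K ((0 + sqrt n * s) / sqrt n)) \<partial>lborel)"
        by (rule nn_integral_cmult[symmetric]) measurable
      also have "\<dots> = J n"
        unfolding J_def using n
        by (intro nn_integral_cong) (simp add: ennreal_mult mult.assoc norm_mult norm_power)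
      finally show ?thesis ..
    qed
    have "ennreal (sqrt n) * smoothing_error ?F ?G (a * sqrt n)
      = (\<integral>\<^sup>+t. ennreal (sqrt n) * (ennreal (norm (?F t - ?G t) / \<bar>t\<bar>) * indicator {-(a * sqrt n)..a * sqrt n} t) \<partial>lborel)"
      using a n by (subst smoothing_error_eq) (auto simp: nn_integral_cmult)
    also have "\<dots> \<le> (\<integral>\<^sup>+t. ennreal (sqrt n * norm (char_error n t) / \<bar>t\<bar>) * indicator {-(\<delta> * sqrt n)..\<delta> * sqrt n} t
         + ennreal (1 / \<delta>) * (ennreal (norm (?F t)) * indicator K (t / sqrt n)
           + ennreal (norm (?G t)) * indicator {t. \<delta> * sqrt n \<le> \<bar>t\<bar>} t) \<partial>lborel)"
    proof (rule nn_integral_mono)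
      fix t :: real
      have e: "?F t - ?G t = char_error n t" by (simp add: char_error_def)
      show "ennreal (sqrt n) * (ennreal (norm (?F t - ?G t) / \<bar>t\<bar>) * indicator {-(a * sqrt n)..a * sqrt n} t)
        \<le> ennreal (sqrt n * norm (char_error n t) / \<bar>t\<bar>) * indicator {-(\<delta> * sqrt n)..\<delta> * sqrt n} t
         + ennreal (1 / \<delta>) * (ennreal (norm (?F t)) * indicator K (t / sqrt n)
           + ennreal (norm (?G t)) * indicator {t. \<delta> * sqrt n \<le> \<bar>t\<bar>} t)"
      proof (cases "t \<in> {-(a * sqrt n)..a * sqrt n}")
        case False
        then show ?thesis by (subst indicator_simps(2)[OF False]) simp
      next
        case in_a: True
        show ?thesis
        proof (cases "\<bar>t\<bar> \<le> \<delta> * sqrt n")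
          case True
          then have "t \<in> {-(\<delta> * sqrt n)..\<delta> * sqrt n}" by auto
          then have "ennreal (sqrt n) * (ennreal (norm (?F t - ?G t) / \<bar>t\<bar>) * indicator {-(a * sqrt n)..a * sqrt n} t)
             = ennreal (sqrt n * norm (char_error n t) / \<bar>t\<bar>) * indicator {-(\<delta> * sqrt n)..\<delta> * sqrt n} t"
            using in_a unfolding e by (simp add: ennreal_mult[symmetric])
          then show ?thesis by simp
        next
          case False
          have inK: "t / sqrt n \<in> K"
            using in_a False n unfolding K_def by (auto simp: field_simps)
          have t: "\<delta> * sqrt n \<le> \<bar>t\<bar>" using False by simp
          then have t0: "\<bar>t\<bar> > 0" using \<delta>(1) n by (smt (verit) mult_pos_pos of_nat_0_less_iff real_sqrt_gt_zero)
          have "sqrt n / \<bar>t\<bar> \<le> 1 / \<delta>" using t t0 \<delta>(1) by (simp add: field_simps)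
          then have "sqrt n / \<bar>t\<bar> * norm (?F t - ?G t) \<le> 1 / \<delta> * (norm (?F t) + norm (?G t))"
            using \<delta>(1) norm_triangle_ineq4 by (intro mult_mono) auto
          from ennreal_leI[OF this] show ?thesis
            using in_a inK t \<delta>(1) by (simp add: ennreal_mult[symmetric] ennreal_plus[symmetric] add_increasing del: ennreal_plus)
        qed
      qed
    qed
    also have "\<dots> = A n + ennreal (1 / \<delta>) * (J n + B n)"
      unfolding A_def B_def J by (simp add: nn_integral_add nn_integral_cmult)
    finally show ?thesis .
  qed
  have lim: "A \<longlonglongrightarrow> 0" "B \<longlonglongrightarrow> 0" "J \<longlonglongrightarrow> 0"
    unfolding A_def[abs_def] B_def[abs_def] J_def[abs_def]
    by (rule central_limit gaussian_tail_limit outer_limit[OF K])+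
  have "(\<lambda>n. A n + ennreal (1 / \<delta>) * (J n + B n)) \<longlonglongrightarrow> 0 + ennreal (1 / \<delta>) * (0 + 0)"
    by (intro tendsto_add ennreal_tendsto_cmult lim) simp
  then have lim0: "(\<lambda>n. A n + ennreal (1 / \<delta>) * (J n + B n)) \<longlonglongrightarrow> 0" by simp
  show ?thesis
  proof (rule tendsto_sandwich[OF _ _ tendsto_const lim0])
    show "\<forall>\<^sub>F n in sequentially. ennreal (sqrt n) * smoothing_error (\<lambda>t. f (t / sqrt n) ^ n * w (t / sqrt n))
      (gaussian_edgeworth_char (\<alpha> / (6 * sqrt n))) (a * sqrt n) \<le> A n + ennreal (1 / \<delta>) * (J n + B n)"
      using eventually_gt_at_top[of 0] by eventually_elim (rule upper)
  qed simp
qed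

end

section \<open>Dithering a lattice law\<close>

definition dithered :: "real \<Rightarrow> real measure \<Rightarrow> real measure" where
  "dithered \<eta> M = distr (M \<Otimes>\<^sub>M centred_uniform) borel (\<lambda>(x, u). x + \<eta> * u)"

text \<open>A node is a point whose open neighbourhood of radius \<open>\<eta>\<close> carries mass at most at the point itself. For a law on a
lattice of step \<open>\<eta>\<close> the lattice points are nodes; for \<open>\<eta> = 0\<close> every point is a node, and this degenerate case stands for
the laws without lattice.\<close>
definition node :: "real \<Rightarrow> real measure \<Rightarrow> real \<Rightarrow> bool" where
  "node \<eta> M g \<longleftrightarrow> (AE y in M. (y < g \<longrightarrow> y \<le> g - \<eta>) \<and> (g < y \<longrightarrow> g + \<eta> \<le> y))"

text \<open>Every point can be moved to a node on its left or on its right, by at most \<open>\<eta>\<close> and without crossing mass.\<close>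
definition gridded :: "real \<Rightarrow> real measure \<Rightarrow> bool" where
  "gridded \<eta> M \<longleftrightarrow> (\<forall>x.
     (\<exists>g. node \<eta> M g \<and> x - \<eta> \<le> g \<and> g \<le> x \<and> (AE y in M. \<not> (g < y \<and> y \<le> x))) \<and>
     (\<exists>g. node \<eta> M g \<and> x \<le> g \<and> g \<le> x + \<eta> \<and> (AE y in M. \<not> (x \<le> y \<and> y < g))))"

lemma sets_centred_uniform [simp, measurable_cong]: "sets centred_uniform = sets borel"
  by (simp add: centred_uniform_def)

context real_distribution
begin

lemma real_distribution_dithered: "real_distribution (dithered \<eta> M)"
proof -
  interpret U: real_distribution centred_uniform by (rule real_distribution_centred_uniform)
  interpret pair_prob_space M centred_uniform ..
  show ?thesis unfolding dithered_def by (intro real_distribution_distr) measurable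
qed

lemma char_dithered: "char (dithered \<eta> M) t = char M t * char centred_uniform (\<eta> * t)"
proof -
  interpret U: real_distribution centred_uniform by (rule real_distribution_centred_uniform)
  interpret pair_prob_space M centred_uniform ..
  have "char (dithered \<eta> M) t = (\<integral>p. iexp (t * (fst p + \<eta> * snd p)) \<partial>(M \<Otimes>\<^sub>M centred_uniform))"
    unfolding char_def dithered_def by (subst integral_distr) (auto simp: case_prod_beta)
  also have "\<dots> = (\<integral>p. iexp (t * fst p) * iexp (\<eta> * t * snd p) \<partial>(M \<Otimes>\<^sub>M centred_uniform))"
    by (intro Bochner_Integration.integral_cong refl) (simp add: exp_add[symmetric] algebra_simps)
  also have "\<dots> = (\<integral>x. \<integral>u. iexp (t * x) * iexp (\<eta> * t * u) \<partial>centred_uniform \<partial>M)"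
    by (subst integral_fst'[symmetric]) (auto intro!: integrable_const_bound[of _ 1] simp: norm_mult simp del: of_real_mult)
  also have "\<dots> = char M t * char centred_uniform (\<eta> * t)"
    by (simp add: char_def)
  finally show ?thesis .
qed

lemma measure_dithered:
  assumes [measurable]: "A \<in> sets borel" "B \<in> sets borel"
    and ae: "AE x in M. \<forall>u. \<bar>u\<bar> < 1/2 \<longrightarrow> (x + \<eta> * u \<in> A \<longleftrightarrow> x \<in> B)"
  shows "measure (dithered \<eta> M) A = measure M B"
proof -
  interpret U: real_distribution centred_uniform by (rule real_distribution_centred_uniform)
  interpret pair_prob_space M centred_uniform ..
  have "measure (dithered \<eta> M) A = measure (M \<Otimes>\<^sub>M centred_uniform) {p. fst p + \<eta> * snd p \<in> A}"
    unfolding dithered_def by (subst measure_distr) (auto intro!: arg_cong[where f = "measure _"] simp: space_pair_measure)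
  also have "\<dots> = measure (M \<Otimes>\<^sub>M centred_uniform) {p. fst p \<in> B}"
  proof (rule finite_measure_eq_AE)
    have "AE p in M \<Otimes>\<^sub>M centred_uniform. (\<forall>u. \<bar>u\<bar> < 1/2 \<longrightarrow> (fst p + \<eta> * u \<in> A \<longleftrightarrow> fst p \<in> B)) \<and> \<bar>snd p\<bar> < 1/2"
    proof -
      have "AE p in M \<Otimes>\<^sub>M centred_uniform. \<forall>u. \<bar>u\<bar> < 1/2 \<longrightarrow> (fst p + \<eta> * u \<in> A \<longleftrightarrow> fst p \<in> B)"
      proof (rule AE_distrD[of fst _ M])
        show "AE x in distr (M \<Otimes>\<^sub>M centred_uniform) M fst. \<forall>u. \<bar>u\<bar> < 1/2 \<longrightarrow> (x + \<eta> * u \<in> A \<longleftrightarrow> x \<in> B)"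
          unfolding U.distr_pair_fst by (rule ae)
      qed simp
      moreover have "AE p in M \<Otimes>\<^sub>M centred_uniform. \<bar>snd p\<bar> < 1/2"
      proof -
        have "{u. \<not> \<bar>u\<bar> < 1/2} \<in> null_sets centred_uniform"
          using AE_centred_uniform by (subst AE_iff_null_sets) auto
        then have "UNIV \<times> {u. \<not> \<bar>u\<bar> < 1/2} \<in> null_sets (M \<Otimes>\<^sub>M centred_uniform)"
          by (intro U.times_in_null_sets2) auto
        from AE_not_in[OF this] show ?thesis by eventually_elim auto
      qed
      ultimately show ?thesis by eventually_elim auto
    qed
    then show "AE p in M \<Otimes>\<^sub>M centred_uniform. (p \<in> {p. fst p + \<eta> * snd p \<in> A}) = (p \<in> {p. fst p \<in> B})"
      by eventually_elim auto
    have "{p \<in> space (M \<Otimes>\<^sub>M centred_uniform). fst p + \<eta> * snd p \<in> A} \<in> sets (M \<Otimes>\<^sub>M centred_uniform)" by measurable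
    then show "{p. fst p + \<eta> * snd p \<in> A} \<in> sets (M \<Otimes>\<^sub>M centred_uniform)" by (simp add: space_pair_measure)
    have "{p \<in> space (M \<Otimes>\<^sub>M centred_uniform). fst p \<in> B} \<in> sets (M \<Otimes>\<^sub>M centred_uniform)" by measurable
    then show "{p. fst p \<in> B} \<in> sets (M \<Otimes>\<^sub>M centred_uniform)" by (simp add: space_pair_measure)
  qed
  also have "\<dots> = measure (distr (M \<Otimes>\<^sub>M centred_uniform) M fst) B"
    by (subst measure_distr) (auto intro!: arg_cong[where f = "measure _"] simp: space_pair_measure)
  finally show ?thesis unfolding U.distr_pair_fst .
qed

text \<open>The noise is almost surely smaller than half a step in modulus, so it carries no mass across the midpoints
between consecutive lattice points.\<close>
lemma dithered_node:
  assumes g: "node \<eta> M g" and \<eta>: "\<eta> \<ge> 0"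
  shows "measure (dithered \<eta> M) {..g + \<eta> / 2} = measure M {..g}"
    and "measure (dithered \<eta> M) {..<g - \<eta> / 2} = measure M {..<g}"
proof -
  have u: "\<bar>\<eta> * u\<bar> \<le> \<eta> / 2 \<and> (\<eta> > 0 \<longrightarrow> \<bar>\<eta> * u\<bar> < \<eta> / 2)" if "\<bar>u\<bar> < 1/2" for u
  proof -
    have "\<bar>\<eta> * u\<bar> = \<eta> * \<bar>u\<bar>" using \<eta> by (simp add: abs_mult)
    moreover have "\<eta> * \<bar>u\<bar> \<le> \<eta> * (1/2)" using that \<eta> by (intro mult_left_mono) auto
    moreover have "\<eta> > 0 \<Longrightarrow> \<eta> * \<bar>u\<bar> < \<eta> * (1/2)" using that by (intro mult_strict_left_mono) auto
    ultimately show ?thesis by auto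
  qed
  have ae: "AE y in M. (y < g \<longrightarrow> y \<le> g - \<eta>) \<and> (g < y \<longrightarrow> g + \<eta> \<le> y)"
    using g by (simp add: node_def)
  show "measure (dithered \<eta> M) {..g + \<eta> / 2} = measure M {..g}"
  proof (rule measure_dithered)
    show "AE x in M. \<forall>u. \<bar>u\<bar> < 1/2 \<longrightarrow> (x + \<eta> * u \<in> {..g + \<eta> / 2} \<longleftrightarrow> x \<in> {..g})"
      using ae
    proof eventually_elim
      case (elim x)
      show ?case
      proof (intro allI impI)
        fix u :: real assume "\<bar>u\<bar> < 1/2"
        from u[OF this] elim \<eta> show "x + \<eta> * u \<in> {..g + \<eta> / 2} \<longleftrightarrow> x \<in> {..g}"
          by (cases "\<eta> = 0"; cases "x \<le> g") (auto simp: not_le)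
      qed
    qed
  qed auto
  show "measure (dithered \<eta> M) {..<g - \<eta> / 2} = measure M {..<g}"
  proof (rule measure_dithered)
    show "AE x in M. \<forall>u. \<bar>u\<bar> < 1/2 \<longrightarrow> (x + \<eta> * u \<in> {..<g - \<eta> / 2} \<longleftrightarrow> x \<in> {..<g})"
      using ae
    proof eventually_elim
      case (elim x)
      show ?case
      proof (intro allI impI)
        fix u :: real assume "\<bar>u\<bar> < 1/2"
        from u[OF this] elim \<eta> show "x + \<eta> * u \<in> {..<g - \<eta> / 2} \<longleftrightarrow> x \<in> {..<g}"
          by (cases "\<eta> = 0"; cases "x < g") (auto simp: not_less)
      qed
    qed
  qed auto
qed

lemma gridded_half_lines:
  assumes gr: "gridded \<eta> M" and \<eta>: "\<eta> \<ge> 0"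
  shows "\<exists>y. \<bar>y - x\<bar> \<le> \<eta> / 2 \<and> measure M {..x} = measure (dithered \<eta> M) {..y}"
    and "\<exists>y. \<bar>y - x\<bar> \<le> \<eta> / 2 \<and> measure M {..<x} = measure (dithered \<eta> M) {..<y}"
proof -
  obtain g where g: "node \<eta> M g" "x - \<eta> \<le> g" "g \<le> x" "AE y in M. \<not> (g < y \<and> y \<le> x)"
    using gr unfolding gridded_def by blast
  have "measure M {..x} = measure M {..g}"
  proof (rule finite_measure_eq_AE)
    show "AE y in M. (y \<in> {..x}) = (y \<in> {..g})"
      using g(4) by eventually_elim (use g(3) in auto)
  qed auto
  then have "measure M {..x} = measure (dithered \<eta> M) {..g + \<eta> / 2}"
    using dithered_node(1)[OF g(1) \<eta>] by simp
  moreover have "\<bar>g + \<eta> / 2 - x\<bar> \<le> \<eta> / 2" using g(2,3) unfolding abs_le_iff by argo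
  ultimately show "\<exists>y. \<bar>y - x\<bar> \<le> \<eta> / 2 \<and> measure M {..x} = measure (dithered \<eta> M) {..y}" by blast
next
  obtain g where g: "node \<eta> M g" "x \<le> g" "g \<le> x + \<eta>" "AE y in M. \<not> (x \<le> y \<and> y < g)"
    using gr unfolding gridded_def by blast
  have "measure M {..<x} = measure M {..<g}"
  proof (rule finite_measure_eq_AE)
    show "AE y in M. (y \<in> {..<x}) = (y \<in> {..<g})"
      using g(4) by eventually_elim (use g(2) in auto)
  qed auto
  then have "measure M {..<x} = measure (dithered \<eta> M) {..<g - \<eta> / 2}"
    using dithered_node(2)[OF g(1) \<eta>] by simp
  moreover have "\<bar>g - \<eta> / 2 - x\<bar> \<le> \<eta> / 2" using g(2,3) unfolding abs_le_iff by argo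
  ultimately show "\<exists>y. \<bar>y - x\<bar> \<le> \<eta> / 2 \<and> measure M {..<x} = measure (dithered \<eta> M) {..<y}" by blast
qed

lemma gridded_zero: "gridded 0 M"
  unfolding gridded_def node_def by (auto intro!: exI)

text \<open>If the modulus is one, then \<open>iexp (s * x)\<close> is constant almost everywhere, that is, \<open>s * x\<close> is determined modulo
\<open>2 * \<pi>\<close>.\<close>
lemma AE_lattice_of_char:
  assumes s: "s \<noteq> 0" and c: "norm (char M s) = 1"
  obtains a where "AE x in M. x \<in> lattice_points a (2 * pi / s)"
proof -
  define a where "a = Arg2pi (char M s) / s"
  have "iexp (s * a) = char M s"
    using s c complex_norm_eq_1_exp[of "char M s"] by (simp add: a_def)
  then have "AE x in M. iexp (s * x) = iexp (s * a)" using AE_iexp_eq_char[OF c] by simp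
  then have "AE x in M. x \<in> lattice_points a (2 * pi / s)"
  proof eventually_elim
    case (elim x)
    then obtain k :: int where "\<i> * complex_of_real (s * x) = \<i> * complex_of_real (s * a) + of_int (2 * k) * pi * \<i>"
      by (auto simp: exp_eq)
    then have "s * x = s * a + 2 * of_int k * pi" by (simp add: complex_eq_iff)
    then have "x = a + 2 * pi / s * of_int k" using s by (simp add: field_simps)
    then show ?case by (auto simp: lattice_points_def)
  qed
  then show ?thesis by (rule that)
qed

lemma gridded_lattice:
  assumes \<eta>: "\<eta> > 0" and ae: "AE x in M. x \<in> lattice_points b \<eta>"
  shows "gridded \<eta> M"
proof -
  have lat: "j \<le> k - 1 \<Longrightarrow> b + \<eta> * of_int j \<le> b + \<eta> * of_int k - \<eta>" for j k :: int
  proof -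
    assume "j \<le> k - 1"
    then have "\<eta> * of_int j \<le> \<eta> * (of_int k - 1)"
      using \<eta> of_int_le_iff[of j "k - 1", where 'a = real] by (intro mult_left_mono) auto
    then show ?thesis by (simp add: algebra_simps)
  qed
  have lt: "b + \<eta> * of_int j < b + \<eta> * of_int k \<longleftrightarrow> j < k" for j k :: int using \<eta> by simp
  have node: "node \<eta> M (b + \<eta> * of_int k)" for k :: int
    unfolding node_def using ae
  proof eventually_elim
    case (elim y)
    then obtain j :: int where y: "y = b + \<eta> * of_int j" by (auto simp: lattice_points_def)
    show ?case unfolding y lt using lat[of j k] lat[of k j] by auto
  qed
  show ?thesis unfolding gridded_def
  proof (intro allI conjI)
    fix x
    define k where "k = \<lfloor>(x - b) / \<eta>\<rfloor>"
    have "of_int k \<le> (x - b) / \<eta>" "(x - b) / \<eta> < of_int k + 1" unfolding k_def by linarith+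
    then have k: "b + \<eta> * of_int k \<le> x" "x < b + \<eta> * of_int k + \<eta>" using \<eta> by (auto simp: field_simps)
    have "AE y in M. \<not> (b + \<eta> * of_int k < y \<and> y \<le> x)"
      using node[of k] unfolding node_def by eventually_elim (use k in auto)
    then show "\<exists>g. node \<eta> M g \<and> x - \<eta> \<le> g \<and> g \<le> x \<and> (AE y in M. \<not> (g < y \<and> y \<le> x))"
      using node[of k] k by (intro exI[of _ "b + \<eta> * of_int k"]) auto
  next
    fix x
    define k where "k = \<lceil>(x - b) / \<eta>\<rceil>"
    have "(x - b) / \<eta> \<le> of_int k" "of_int k < (x - b) / \<eta> + 1" unfolding k_def by linarith+
    then have k: "x \<le> b + \<eta> * of_int k" "b + \<eta> * of_int k < x + \<eta>" using \<eta> by (auto simp: field_simps)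
    have "AE y in M. \<not> (x \<le> y \<and> y < b + \<eta> * of_int k)"
      using node[of k] unfolding node_def by eventually_elim (use k in auto)
    then show "\<exists>g. node \<eta> M g \<and> x \<le> g \<and> g \<le> x + \<eta> \<and> (AE y in M. \<not> (x \<le> y \<and> y < g))"
      using node[of k] k by (intro exI[of _ "b + \<eta> * of_int k"]) auto
  qed
qed

end

section \<open>Errors on intervals and on half-lines\<close>

lemma downset_cases:
  fixes S :: "real set"
  assumes "\<And>x y. y \<in> S \<Longrightarrow> x \<le> y \<Longrightarrow> x \<in> S"
  obtains "S = {}" | "S = UNIV" | b where "S = {..b}" | b where "S = {..<b}"
proof (cases "S = {} \<or> S = UNIV")
  case False
  then obtain y z where y: "y \<in> S" and z: "z \<notin> S" by auto
  have bdd: "x < z" if "x \<in> S" for x using assms[OF that, of z] z by force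
  then have bdd': "bdd_above S" by (auto intro!: bdd_aboveI[of _ z] less_imp_le)
  have lt: "x \<in> S" if "x < Sup S" for x
    using that less_cSup_iff[of S x] y bdd' assms by (metis empty_iff less_imp_le)
  have le: "x \<le> Sup S" if "x \<in> S" for x using that bdd' by (rule cSup_upper)
  show ?thesis
  proof (cases "Sup S \<in> S")
    case True
    then have "S = {..Sup S}" using lt le by (auto simp: le_less)
    then show ?thesis using that(3) by blast
  next
    case False
    then have "S = {..<Sup S}" using lt le by (auto simp: less_le)
    then show ?thesis using that(4) by blast
  qed
qed (use that in auto)

text \<open>An interval is the difference of two sets that are closed downwards, namely the points below some and the
points strictly below all of its elements. Sets closed downwards are half-lines or trivial.\<close>
lemma interval_diff_bound:
  assumes M: "real_distribution M" and N: "real_distribution N"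
    and le: "\<And>x. measure M {..x} - measure N {..x} \<in> {a..b}" "\<And>x. measure M {..<x} - measure N {..<x} \<in> {a..b}"
    and ab: "a \<le> 0" "0 \<le> b" and I: "is_interval I"
  shows "\<bar>measure M I - measure N I\<bar> \<le> b - a"
proof -
  interpret M: real_distribution M by fact
  interpret N: real_distribution N by fact
  define U where "U = {x. \<exists>y\<in>I. x \<le> y}"
  define L where "L = {x. \<forall>y\<in>I. x < y}"
  have down: "measure M S - measure N S \<in> {a..b} \<and> S \<in> sets borel" if "\<And>x y. y \<in> S \<Longrightarrow> x \<le> y \<Longrightarrow> x \<in> S" for S
    using le ab M.prob_space N.prob_space by (cases rule: downset_cases[OF that]) auto
  have U: "measure M U - measure N U \<in> {a..b}" "U \<in> sets borel"
    using down[of U] by (auto simp: U_def intro: order.trans)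
  have L: "measure M L - measure N L \<in> {a..b}" "L \<in> sets borel"
    using down[of L] by (auto simp: L_def intro: order.strict_trans1)
  show ?thesis
  proof (cases "I = {}")
    case False
    then have LU: "L \<subseteq> U" by (force simp: L_def U_def)
    have "I = U - L"
    proof (intro set_eqI iffI)
      fix x assume "x \<in> U - L"
      then obtain y z where "y \<in> I" "x \<le> y" "z \<in> I" "z \<le> x" by (auto simp: U_def L_def not_less)
      then show "x \<in> I" using I unfolding is_interval_1 by blast
    qed (auto simp: U_def L_def)
    then have "measure M I = measure M U - measure M L" "measure N I = measure N U - measure N L"
      using LU U(2) L(2) by (auto intro!: M.finite_measure_Diff N.finite_measure_Diff)
    then show ?thesis using U(1) L(1) by auto
  qed (use ab in simp)
qed

section \<open>The expansion of the distribution functions\<close>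
interpretation N01: real_distribution std_normal_distribution
  by (rule real_dist_normal_dist)

lemma std_normal_singleton: "measure std_normal_distribution {x} = 0"
proof -
  have "AE y in std_normal_distribution. y \<noteq> x"
    using AE_lborel_singleton[of x] by (subst AE_density) auto
  then have "{x} \<in> null_sets std_normal_distribution"
    by (subst AE_iff_null_sets) auto
  then show ?thesis by (simp add: measure_eq_0_null_sets)
qed

lemma std_normal_lessThan: "measure std_normal_distribution {..<x} = cdf std_normal_distribution x"
proof -
  have "{..x} = {..<x} \<union> {x}" by auto
  then have "cdf std_normal_distribution x = measure std_normal_distribution {..<x} + measure std_normal_distribution {x}"
    unfolding cdf_def by (subst N01.finite_measure_Union[symmetric]) auto
  then show ?thesis by (simp add: std_normal_singleton)
qed

context standardized_law
begin

definition edgeworth_term where "edgeworth_term x = \<alpha> / 6 * ((1 - x\<^sup>2) * std_normal_density x)"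

lemma edgeworth_term_uniform_lipschitz: "\<bar>edgeworth_term x - edgeworth_term y\<bar> \<le> 6 * \<rho> * \<bar>x - y\<bar>"
proof -
  have "\<bar>edgeworth_term x - edgeworth_term y\<bar> = \<bar>\<alpha>\<bar> / 6 * \<bar>(1 - x\<^sup>2) * std_normal_density x - (1 - y\<^sup>2) * std_normal_density y\<bar>"
    unfolding edgeworth_term_def right_diff_distrib[symmetric] by (simp add: abs_mult)
  also have "\<dots> \<le> \<rho> / 6 * (36 * \<bar>x - y\<bar>)"
    using abs_\<alpha>_le \<rho>_nonneg by (intro mult_mono edgeworth_term_lipschitz) auto
  finally show ?thesis by simp
qed

lemma isCont_edgeworth_term: "isCont edgeworth_term x"
proof -
  have "isCont std_normal_density x" using DERIV_std_normal_density DERIV_isCont by blast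
  then show ?thesis unfolding edgeworth_term_def[abs_def] by (intro continuous_intros) auto
qed

end

text \<open>The span condition of \<open>spanned_law\<close> makes \<open>h\<close> large enough for the noise; the condition \<open>lattice\<close> makes it small
enough, so that the laws \<open>M n\<close> live on lattices of step \<open>h / \<surd>n\<close> and dithering can be undone.\<close>
locale normalized_sums = spanned_law +
  fixes M :: "nat \<Rightarrow> real measure"
  assumes M: "\<And>n. real_distribution (M n)"
    and char_M: "\<And>n t. n > 0 \<Longrightarrow> char (M n) t = f (t / sqrt n) ^ n"
    and lattice: "h > 0 \<Longrightarrow> norm (f (2 * pi / h)) = 1"
begin

abbreviation \<Phi> where "\<Phi> \<equiv> cdf std_normal_distribution"
definition \<eta> where "\<eta> n = h / sqrt (real n)"
definition N where "N n = dithered (\<eta> n) (M n)"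

lemma \<eta>_nonneg: "\<eta> n \<ge> 0"
  using h_nonneg by (simp add: \<eta>_def)

lemma real_distribution_N: "real_distribution (N n)"
  unfolding N_def by (rule real_distribution.real_distribution_dithered[OF M])

lemma char_N: "n > 0 \<Longrightarrow> char (N n) = (\<lambda>t. f (t / sqrt n) ^ n * w (t / sqrt n))"
  unfolding N_def by (simp add: fun_eq_iff real_distribution.char_dithered[OF M] char_M w_def \<eta>_def)

lemma gridded_M:
  assumes n: "n > 0"
  shows "gridded (\<eta> n) (M n)"
proof -
  interpret Mn: real_distribution "M n" by (rule M)
  show ?thesis
  proof (cases "h = 0")
    case True
    then show ?thesis unfolding \<eta>_def by (simp add: Mn.gridded_zero)
  next
    case False
    then have h: "h > 0" using h_nonneg by simp
    \<comment> \<open>The point \<open>2 * \<pi> / h\<close> in the scale of the normalized sum; the lattice step there is \<open>2 * \<pi> / s = \<eta> n\<close>.\<close>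
    define s where "s = 2 * pi * sqrt n / h"
    have s: "s \<noteq> 0" using n h by (simp add: s_def)
    have "norm (char (M n) s) = 1"
      using n lattice[OF h] by (simp add: char_M s_def norm_power)
    from Mn.AE_lattice_of_char[OF s this] obtain b where "AE x in M n. x \<in> lattice_points b (2 * pi / s)" .
    moreover have "2 * pi / s = \<eta> n" using h n by (simp add: s_def \<eta>_def)
    moreover have "\<eta> n > 0" using h n by (simp add: \<eta>_def)
    ultimately show ?thesis by (intro Mn.gridded_lattice) auto
  qed
qed

text \<open>With cut-off \<open>a * \<surd>n\<close> the Lipschitz term of the smoothing inequality contributes \<open>C * m / a\<close> after
multiplication by \<open>\<surd>n\<close>; the constant \<open>a\<close> makes this \<open>\<epsilon> / 2\<close>.\<close>
lemma edgeworth_N: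
  assumes \<epsilon>: "\<epsilon> > 0"
  shows "\<forall>\<^sub>F n in sequentially. \<forall>x. \<bar>sqrt n * (cdf (N n) x - \<Phi> x) - edgeworth_term x\<bar> \<le> \<epsilon>"
proof (rule esseen_smoothing)
  fix C :: real assume C: "C > 0" and esseen: "\<And>M N w m T x.
     real_distribution M \<Longrightarrow> sigma_finite_measure N \<Longrightarrow> sets N = sets borel \<Longrightarrow> integrable N w \<Longrightarrow>
     (\<And>x y. \<bar>wcdf N w x - wcdf N w y\<bar> \<le> m * \<bar>x - y\<bar>) \<Longrightarrow> T > 0 \<Longrightarrow>
     ennreal \<bar>cdf M x - wcdf N w x\<bar> \<le> C * smoothing_error (char M) (wchar N w) T + ennreal (C * m / T)"
  define m where "m = 1 + 36 * \<rho>"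
  have m: "m > 0" using \<rho>_nonneg by (simp add: m_def)
  define a where "a = 2 * C * m / \<epsilon>"
  have a: "a > 0" using C m \<epsilon> by (simp add: a_def)
  let ?E = "\<lambda>n::nat. smoothing_error (\<lambda>t. f (t / sqrt n) ^ n * w (t / sqrt n)) (gaussian_edgeworth_char (\<alpha> / (6 * sqrt n))) (a * sqrt n)"
  have "(\<lambda>n. ennreal C * (ennreal (sqrt n) * ?E n)) \<longlonglongrightarrow> ennreal C * 0"
    by (intro ennreal_tendsto_cmult smoothing_error_limit a) simp
  then have "\<forall>\<^sub>F n in sequentially. ennreal C * (ennreal (sqrt n) * ?E n) < ennreal (\<epsilon> / 2)"
    using \<epsilon> by (intro order_tendstoD(2)[of _ 0]) auto
  then show "\<forall>\<^sub>F n in sequentially. \<forall>x. \<bar>sqrt n * (cdf (N n) x - \<Phi> x) - edgeworth_term x\<bar> \<le> \<epsilon>"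
    using eventually_gt_at_top[of 0]
  proof eventually_elim
    case (elim n)
    show ?case
    proof
      fix x
      define \<kappa> where "\<kappa> = \<alpha> / (6 * sqrt n)"
      have s1: "1 \<le> sqrt n" using elim by simp
      then have "1 \<le> \<bar>6 * sqrt n\<bar>" by argo
      then have "\<bar>\<kappa>\<bar> \<le> \<bar>\<alpha>\<bar> / 1" unfolding \<kappa>_def abs_divide using elim by (intro divide_left_mono) auto
      then have \<kappa>: "\<bar>\<kappa>\<bar> \<le> \<rho>" using abs_\<alpha>_le by simp
      have "\<bar>edgeworth_density \<kappa> u\<bar> \<le> m" for u
        using edgeworth_density_bound[of \<kappa> u] \<kappa> by (simp add: m_def)
      then have lip: "\<And>x y. \<bar>wcdf lborel (edgeworth_density \<kappa>) x - wcdf lborel (edgeworth_density \<kappa>) y\<bar> \<le> m * \<bar>x - y\<bar>"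
        by (intro wcdf_lipschitz integrable_edgeworth_density)
      have T: "a * sqrt n > 0" using a elim by simp
      have "ennreal \<bar>cdf (N n) x - wcdf lborel (edgeworth_density \<kappa>) x\<bar>
         \<le> C * smoothing_error (char (N n)) (wchar lborel (edgeworth_density \<kappa>)) (a * sqrt n) + ennreal (C * m / (a * sqrt n))"
        by (rule esseen[OF real_distribution_N lborel.sigma_finite_measure_axioms _ integrable_edgeworth_density lip T]) simp
      then have "ennreal \<bar>cdf (N n) x - wcdf lborel (edgeworth_density \<kappa>) x\<bar> \<le> C * ?E n + ennreal (C * m / (a * sqrt n))"
        using elim by (simp add: char_N wchar_edgeworth \<kappa>_def)
      then have "ennreal (sqrt n) * ennreal \<bar>cdf (N n) x - wcdf lborel (edgeworth_density \<kappa>) x\<bar>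
         \<le> ennreal (sqrt n) * (C * ?E n + ennreal (C * m / (a * sqrt n)))"
        by (rule mult_left_mono) simp
      also have "\<dots> = ennreal C * (ennreal (sqrt n) * ?E n) + ennreal (sqrt n * (C * m / (a * sqrt n)))"
      proof -
        have nonneg: "0 \<le> C * m / (a * sqrt n)" using C m T by simp
        show ?thesis
          unfolding distrib_left ennreal_mult[OF real_sqrt_ge_zero[OF of_nat_0_le_iff] nonneg] by (simp only: mult.left_commute)
      qed
      also have "\<dots> \<le> ennreal (\<epsilon> / 2) + ennreal (\<epsilon> / 2)"
      proof (intro add_mono ennreal_leI)
        show "sqrt n * (C * m / (a * sqrt n)) \<le> \<epsilon> / 2"
          using elim C m \<epsilon> by (simp add: a_def)
      qed (use elim in auto)
      also have "\<dots> = ennreal \<epsilon>" using \<epsilon> by (simp flip: ennreal_plus)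
      finally have "sqrt n * \<bar>cdf (N n) x - wcdf lborel (edgeworth_density \<kappa>) x\<bar> \<le> \<epsilon>"
        using \<epsilon> by (simp flip: ennreal_mult)
      moreover have "sqrt n * (cdf (N n) x - wcdf lborel (edgeworth_density \<kappa>) x) = sqrt n * (cdf (N n) x - \<Phi> x) - edgeworth_term x"
        unfolding wcdf_edgeworth edgeworth_term_def \<kappa>_def using elim by (simp add: algebra_simps)
      moreover have "\<bar>sqrt n * z\<bar> = sqrt n * \<bar>z\<bar>" for z by (simp add: abs_mult)
      ultimately show "\<bar>sqrt n * (cdf (N n) x - \<Phi> x) - edgeworth_term x\<bar> \<le> \<epsilon>" by metis
    qed
  qed
qed

lemma left_limit_bound:
  assumes "\<forall>x. \<bar>sqrt n * (cdf (N n) x - \<Phi> x) - edgeworth_term x\<bar> \<le> \<epsilon>"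
  shows "\<bar>sqrt n * (measure (N n) {..<x} - \<Phi> x) - edgeworth_term x\<bar> \<le> \<epsilon>"
proof (rule tendsto_upperbound)
  have "isCont \<Phi> x" using N01.isCont_cdf std_normal_singleton by blast
  then have \<Phi>: "(\<Phi> \<longlongrightarrow> \<Phi> x) (at_left x)" by (simp add: isCont_def filterlim_at_split)
  have edgeworth_term: "(edgeworth_term \<longlongrightarrow> edgeworth_term x) (at_left x)" using isCont_edgeworth_term[of x] by (simp add: isCont_def filterlim_at_split)
  show "((\<lambda>y. \<bar>sqrt n * (cdf (N n) y - \<Phi> y) - edgeworth_term y\<bar>) \<longlongrightarrow> \<bar>sqrt n * (measure (N n) {..<x} - \<Phi> x) - edgeworth_term x\<bar>) (at_left x)"
    by (intro tendsto_intros \<Phi> edgeworth_term finite_borel_measure.cdf_at_left real_distribution.finite_borel_measure_M real_distribution_N)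
  show "\<forall>\<^sub>F y in at_left x. \<bar>sqrt n * (cdf (N n) y - \<Phi> y) - edgeworth_term y\<bar> \<le> \<epsilon>"
    using assms by (intro always_eventually) auto
qed simp

text \<open>An expansion at a point at distance at most \<open>\<eta> / 2\<close> from \<open>x\<close>, rewritten at \<open>x\<close>. The displacement enters to first
order through \<open>\<Phi>\<close> only; this is the saw-tooth.\<close>
lemma recentre:
  assumes v: "\<bar>sqrt n * (v - \<Phi> y) - edgeworth_term y\<bar> \<le> \<epsilon>" and y: "\<bar>y - x\<bar> \<le> \<eta> n / 2" and n: "n > 0"
  shows "\<bar>sqrt n * (v - \<Phi> x) - (edgeworth_term x + sqrt n * (y - x) * std_normal_density x)\<bar> \<le> \<epsilon> + (3 * \<rho> * h + h\<^sup>2) / sqrt n"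
proof -
  have s: "sqrt n > 0" using n by simp
  have edgeworth_term: "\<bar>edgeworth_term y - edgeworth_term x\<bar> \<le> 3 * \<rho> * h / sqrt n"
  proof -
    have "\<bar>edgeworth_term y - edgeworth_term x\<bar> \<le> 6 * \<rho> * (\<eta> n / 2)"
      using edgeworth_term_uniform_lipschitz[of y x] mult_left_mono[OF y, of "6 * \<rho>"] \<rho>_nonneg by simp
    then show ?thesis by (simp add: \<eta>_def ac_simps)
  qed
  have \<Phi>: "\<bar>sqrt n * (\<Phi> y - \<Phi> x - std_normal_density x * (y - x))\<bar> \<le> h\<^sup>2 / sqrt n"
  proof -
    have "\<bar>\<Phi> y - \<Phi> x - std_normal_density x * (y - x)\<bar> \<le> \<bar>y - x\<bar>\<^sup>2"
      using cdf_std_normal_linearisation[of y x] by simp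
    also have "\<dots> \<le> (\<eta> n)\<^sup>2"
      using y \<eta>_nonneg[of n] by (intro power_mono) auto
    finally have "\<bar>sqrt n * (\<Phi> y - \<Phi> x - std_normal_density x * (y - x))\<bar> \<le> sqrt n * (\<eta> n)\<^sup>2"
      unfolding abs_mult using s by (intro mult_mono) auto
    also have "\<dots> = h\<^sup>2 / sqrt n" using n by (simp add: \<eta>_def power_divide real_div_sqrt field_simps)
    finally show ?thesis .
  qed
  have "sqrt n * (v - \<Phi> x) - (edgeworth_term x + sqrt n * (y - x) * std_normal_density x)
    = (sqrt n * (v - \<Phi> y) - edgeworth_term y) + (edgeworth_term y - edgeworth_term x) + sqrt n * (\<Phi> y - \<Phi> x - std_normal_density x * (y - x))"
    by (simp add: algebra_simps)
  also have "\<bar>\<dots>\<bar> \<le> \<epsilon> + 3 * \<rho> * h / sqrt n + h\<^sup>2 / sqrt n"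
    using v edgeworth_term \<Phi> by (intro order.trans[OF abs_triangle_ineq] add_mono) auto
  finally show ?thesis by (simp add: add_divide_distrib)
qed

text \<open>The largest possible contributions, in the limit, of an upper and of a lower endpoint at \<open>x\<close>.\<close>
definition upper_profile where "upper_profile x = edgeworth_term x + h / 2 * std_normal_density x"
definition lower_profile where "lower_profile x = - edgeworth_term x + h / 2 * std_normal_density x"

text \<open>The profiles bound the normalized errors on all half-lines, and both bounds are approached simultaneously
at nodes, which become dense: there the distribution function jumps by \<open>h * \<phi> g / \<surd>n\<close>.\<close>
lemma half_line_bounds:
  assumes \<epsilon>: "\<epsilon> > 0"
  shows "\<forall>\<^sub>F n in sequentially. \<forall>x.
     sqrt n * (measure (M n) {..x} - \<Phi> x) \<in> {- lower_profile x - \<epsilon>..upper_profile x + \<epsilon>} \<and>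
     sqrt n * (measure (M n) {..<x} - \<Phi> x) \<in> {- lower_profile x - \<epsilon>..upper_profile x + \<epsilon>} \<and>
     (\<exists>g. \<bar>g - x\<bar> \<le> \<eta> n \<and> sqrt n * (measure (M n) {..g} - \<Phi> g) \<ge> upper_profile g - \<epsilon> \<and>
        sqrt n * (measure (M n) {..<g} - \<Phi> g) \<le> - lower_profile g + \<epsilon>)"
proof -
  define c where "c = 3 * \<rho> * h + h\<^sup>2"
  have "(\<lambda>n. c * (1 / sqrt (real n))) \<longlonglongrightarrow> c * 0"
    by (intro tendsto_intros inverse_sqrt_tendsto_0)
  then have "\<forall>\<^sub>F n in sequentially. c * (1 / sqrt (real n)) < \<epsilon> / 2"
    using \<epsilon> by (intro order_tendstoD) auto
  moreover have "\<forall>\<^sub>F n in sequentially. \<forall>x. \<bar>sqrt n * (cdf (N n) x - \<Phi> x) - edgeworth_term x\<bar> \<le> \<epsilon> / 2"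
    using \<epsilon> by (intro edgeworth_N) simp
  ultimately show ?thesis using eventually_gt_at_top[of 0]
  proof eventually_elim
    case (elim n)
    interpret Mn: real_distribution "M n" by (rule M)
    have n: "n > 0" and cn: "c / sqrt n < \<epsilon> / 2" using elim by auto
    have le: "\<bar>sqrt n * (measure (N n) {..y} - \<Phi> y) - edgeworth_term y\<bar> \<le> \<epsilon> / 2" for y
      using elim(2) by (simp add: cdf_def)
    have lt: "\<bar>sqrt n * (measure (N n) {..<y} - \<Phi> y) - edgeworth_term y\<bar> \<le> \<epsilon> / 2" for y
      by (rule left_limit_bound[OF elim(2)])
    have step: "\<bar>sqrt n * (v - \<Phi> x) - (edgeworth_term x + sqrt n * (y - x) * std_normal_density x)\<bar> \<le> \<epsilon>"
      if "\<bar>sqrt n * (v - \<Phi> y) - edgeworth_term y\<bar> \<le> \<epsilon> / 2" "\<bar>y - x\<bar> \<le> \<eta> n / 2" for v x y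
      using recentre[OF that n] cn unfolding c_def by argo
    have sd: "\<bar>sqrt n * (y - x) * std_normal_density x\<bar> \<le> h / 2 * std_normal_density x"
      if "\<bar>y - x\<bar> \<le> \<eta> n / 2" for x y
    proof -
      have "\<bar>sqrt n * (y - x)\<bar> \<le> sqrt n * (\<eta> n / 2)"
        unfolding abs_mult using that by (intro mult_mono) auto
      also have "\<dots> = h / 2" using n by (simp add: \<eta>_def)
      finally show ?thesis unfolding abs_mult[of "_ * _"] by (intro mult_mono) auto
    qed
    have between: "sqrt n * (v - \<Phi> x) \<in> {- lower_profile x - \<epsilon>..upper_profile x + \<epsilon>}"
      if "\<bar>sqrt n * (v - \<Phi> y) - edgeworth_term y\<bar> \<le> \<epsilon> / 2" "\<bar>y - x\<bar> \<le> \<eta> n / 2" for v x y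
      using step[OF that] sd[OF that(2)] unfolding upper_profile_def lower_profile_def atLeastAtMost_iff abs_le_iff by argo
    show ?case
    proof (intro allI conjI)
      fix x
      obtain y where "\<bar>y - x\<bar> \<le> \<eta> n / 2" "measure (M n) {..x} = measure (N n) {..y}"
        unfolding N_def using Mn.gridded_half_lines(1)[OF gridded_M[OF n] \<eta>_nonneg] by blast
      then show "sqrt n * (measure (M n) {..x} - \<Phi> x) \<in> {- lower_profile x - \<epsilon>..upper_profile x + \<epsilon>}"
        using between[OF le] by simp
      obtain y where "\<bar>y - x\<bar> \<le> \<eta> n / 2" "measure (M n) {..<x} = measure (N n) {..<y}"
        unfolding N_def using Mn.gridded_half_lines(2)[OF gridded_M[OF n] \<eta>_nonneg] by blast
      then show "sqrt n * (measure (M n) {..<x} - \<Phi> x) \<in> {- lower_profile x - \<epsilon>..upper_profile x + \<epsilon>}"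
        using between[OF lt] by simp
      obtain g where g: "node (\<eta> n) (M n) g" "x - \<eta> n \<le> g" "g \<le> x"
        using gridded_M[OF n] unfolding gridded_def by blast
      have h: "sqrt n * (g + \<eta> n / 2 - g) = h / 2" "sqrt n * (g - \<eta> n / 2 - g) = - (h / 2)"
        using n by (simp_all add: \<eta>_def)
      have "\<bar>sqrt n * (measure (M n) {..g} - \<Phi> g) - upper_profile g\<bar> \<le> \<epsilon>"
        using step[OF le, of "g + \<eta> n / 2" g] \<eta>_nonneg[of n] unfolding h upper_profile_def
        by (simp add: N_def Mn.dithered_node(1)[OF g(1) \<eta>_nonneg])
      moreover have "\<bar>sqrt n * (measure (M n) {..<g} - \<Phi> g) + lower_profile g\<bar> \<le> \<epsilon>"
        using step[OF lt, of "g - \<eta> n / 2" g] \<eta>_nonneg[of n] unfolding h lower_profile_def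
        by (simp add: N_def Mn.dithered_node(2)[OF g(1) \<eta>_nonneg] algebra_simps)
      moreover have "\<bar>g - x\<bar> \<le> \<eta> n" using g by auto
      ultimately show "\<exists>g. \<bar>g - x\<bar> \<le> \<eta> n \<and> sqrt n * (measure (M n) {..g} - \<Phi> g) \<ge> upper_profile g - \<epsilon> \<and>
        sqrt n * (measure (M n) {..<g} - \<Phi> g) \<le> - lower_profile g + \<epsilon>"
        by (intro exI[of _ g]) (auto simp: abs_le_iff)
    qed
  qed
qed

end

section \<open>The extremal endpoints\<close>

text \<open>With \<open>u = x\<^sup>2 / 2\<close> this is \<open>(A + H) - 2 * A * u \<le> (A + H) * exp u\<close>, which follows from \<open>- 2 * A \<le> A + H\<close> and
\<open>1 + u \<le> exp u\<close>.\<close>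
lemma normal_quadratic_max_at_0:
  assumes "0 \<le> A + H" "- 2 * A \<le> A + H"
  shows "std_normal_density x * (A * (1 - x\<^sup>2) + H) \<le> std_normal_density 0 * (A + H)"
proof -
  have e: "1 + x\<^sup>2 / 2 \<le> exp (x\<^sup>2 / 2)" by (rule exp_ge_add_one_self)
  have "A * (1 - x\<^sup>2) + H = (A + H) + (- 2 * A) * (x\<^sup>2 / 2)" by (simp add: algebra_simps)
  also have "\<dots> \<le> (A + H) + (A + H) * (x\<^sup>2 / 2)"
    using assms(2) by (intro add_left_mono mult_right_mono) auto
  also have "\<dots> = (A + H) * (1 + x\<^sup>2 / 2)" by (simp add: algebra_simps)
  also have "\<dots> \<le> (A + H) * exp (x\<^sup>2 / 2)" using e assms(1) by (intro mult_left_mono) auto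
  finally have "std_normal_density x * (A * (1 - x\<^sup>2) + H) \<le> std_normal_density x * ((A + H) * exp (x\<^sup>2 / 2))"
    by (rule mult_left_mono) simp
  also have "\<dots> = std_normal_density 0 * (A + H)"
    by (simp add: std_normal_density_def exp_minus)
  finally show ?thesis .
qed

text \<open>With \<open>u = x\<^sup>2 / 2\<close> and \<open>v = p\<^sup>2 / 2\<close> the quadratic factor is \<open>2 * B * (1 + u - v)\<close>, which is at most
\<open>2 * B * exp (u - v)\<close>, with equality at \<open>u = v\<close>.\<close>
lemma normal_quadratic_max_off_0:
  fixes B H :: real
  assumes B: "B > 0" and H: "H \<le> 3 * B"
  defines "p \<equiv> sqrt (3 - H / B)"
  shows "std_normal_density x * (- B * (1 - x\<^sup>2) + H) \<le> std_normal_density p * (- B * (1 - p\<^sup>2) + H)"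
    and "std_normal_density p * (- B * (1 - p\<^sup>2) + H) = std_normal_density 0 * (2 * B * exp (- (3 - H / B) / 2))"
proof -
  have p2: "p\<^sup>2 = 3 - H / B" unfolding p_def using B H by (intro real_sqrt_pow2) (simp add: field_simps)
  have Hp: "H = B * (3 - p\<^sup>2)" using B by (simp add: p2)
  have dens: "std_normal_density x = std_normal_density 0 * exp (- (x\<^sup>2 / 2))" for x
    by (simp add: std_normal_density_def)
  show 2: "std_normal_density p * (- B * (1 - p\<^sup>2) + H) = std_normal_density 0 * (2 * B * exp (- (3 - H / B) / 2))"
  proof -
    have "- B * (1 - p\<^sup>2) + H = 2 * B" unfolding Hp by (simp add: algebra_simps)
    moreover have "- (p\<^sup>2 / 2) = - (3 - H / B) / 2" unfolding p2 by argo
    ultimately show ?thesis unfolding dens[of p] by (simp only: mult.assoc mult.commute[of "exp _"])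
  qed
  have "- B * (1 - x\<^sup>2) + H = 2 * B * (1 + (x\<^sup>2 / 2 - p\<^sup>2 / 2))" unfolding Hp by (simp add: algebra_simps)
  also have "\<dots> \<le> 2 * B * exp (x\<^sup>2 / 2 - p\<^sup>2 / 2)" using B by (intro mult_left_mono exp_ge_add_one_self) auto
  finally have "std_normal_density x * (- B * (1 - x\<^sup>2) + H) \<le> std_normal_density x * (2 * B * exp (x\<^sup>2 / 2 - p\<^sup>2 / 2))"
    by (rule mult_left_mono) simp
  also have "\<dots> = std_normal_density 0 * (2 * B * (exp (- (x\<^sup>2 / 2)) * exp (x\<^sup>2 / 2 - p\<^sup>2 / 2)))"
    unfolding dens[of x] by simp
  also have "exp (- (x\<^sup>2 / 2)) * exp (x\<^sup>2 / 2 - p\<^sup>2 / 2) = exp (- (3 - H / B) / 2)"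
    unfolding exp_add[symmetric] p2[symmetric] by simp
  finally show "std_normal_density x * (- B * (1 - x\<^sup>2) + H) \<le> std_normal_density p * (- B * (1 - p\<^sup>2) + H)"
    unfolding 2 .
qed

text \<open>The limit for laws with standard deviation one.\<close>
definition interval_constant :: "real \<Rightarrow> real \<Rightarrow> real" where
  "interval_constant \<alpha> h = 1 / sqrt (2 * pi) *
     (if \<bar>\<alpha>\<bar> \<le> h then h else h / 2 + \<bar>\<alpha>\<bar> / 6 + \<bar>\<alpha>\<bar> / 3 * exp (- (3 / 2) * (1 - h / \<bar>\<alpha>\<bar>)))"

context normalized_sums
begin

lemma profiles_eq: "upper_profile x = std_normal_density x * (\<alpha> / 6 * (1 - x\<^sup>2) + h / 2)"
  "lower_profile x = std_normal_density x * (- \<alpha> / 6 * (1 - x\<^sup>2) + h / 2)"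
  unfolding upper_profile_def lower_profile_def edgeworth_term_def by (simp_all add: field_simps)

text \<open>If \<open>\<bar>\<alpha>\<bar> > h\<close>, the skewness favours the upper end at \<open>0\<close> and a lower end away from \<open>0\<close>, or conversely. The profiles are even,
so the sign of the extremal point off \<open>0\<close> can be chosen such that the endpoints are ordered.\<close>
lemma extremal_points:
  obtains m p where "m \<le> p" "\<And>x. upper_profile x \<le> upper_profile p" "\<And>x. lower_profile x \<le> lower_profile m" "upper_profile p + lower_profile m = interval_constant \<alpha> h" "0 \<le> upper_profile p" "0 \<le> lower_profile m"
proof -
  have s0: "std_normal_density 0 = 1 / sqrt (2 * pi)" by (simp add: std_normal_density_def)
  note h0 = h_nonneg
  consider "\<bar>\<alpha>\<bar> \<le> h" | "\<bar>\<alpha>\<bar> > h" "\<alpha> > 0" | "\<bar>\<alpha>\<bar> > h" "\<alpha> < 0"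
    using h_nonneg by fastforce
  then show ?thesis
  proof cases
    case 1
    show ?thesis
    proof (rule that[of 0 0])
      show "upper_profile x \<le> upper_profile 0" for x
        unfolding profiles_eq using normal_quadratic_max_at_0[of "\<alpha> / 6" "h / 2" x] 1 h0 by (simp add: abs_le_iff)
      show "lower_profile x \<le> lower_profile 0" for x
        unfolding profiles_eq using normal_quadratic_max_at_0[of "- \<alpha> / 6" "h / 2" x] 1 h0 by (simp add: abs_le_iff)
      show "upper_profile 0 + lower_profile 0 = interval_constant \<alpha> h" unfolding profiles_eq interval_constant_def using 1 by (simp add: s0 algebra_simps)
      show "0 \<le> upper_profile 0" "0 \<le> lower_profile 0" unfolding profiles_eq using 1 h0 by (auto simp: abs_le_iff)
    qed simp
  next
    case 2
    define B where "B = \<alpha> / 6"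
    have B: "B > 0" "h / 2 \<le> 3 * B" using 2 by (auto simp: B_def)
    define p where "p = sqrt (3 - h / 2 / B)"
    note off = normal_quadratic_max_off_0[OF B, folded p_def]
    have low: "lower_profile x = std_normal_density x * (- B * (1 - x\<^sup>2) + h / 2)" for x by (simp add: profiles_eq B_def)
    have ex: "- (3 - h / 2 / B) / 2 = - (3 / 2) * (1 - h / \<bar>\<alpha>\<bar>)" using 2 by (simp add: B_def field_simps)
    show ?thesis
    proof (rule that[of "- p" 0])
      show "- p \<le> 0" using B by (simp add: p_def field_simps)
      show "upper_profile x \<le> upper_profile 0" for x
        unfolding profiles_eq using normal_quadratic_max_at_0[of "\<alpha> / 6" "h / 2" x] 2 h0 by simp
      show "lower_profile x \<le> lower_profile (- p)" for x
        unfolding low using off(1)[of x] by (simp add: std_normal_density_def)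
      have lower_profile: "lower_profile (- p) = std_normal_density 0 * (2 * B * exp (- (3 / 2) * (1 - h / \<bar>\<alpha>\<bar>)))"
        unfolding low ex[symmetric] off(2)[symmetric] by (simp add: std_normal_density_def)
      show "upper_profile 0 + lower_profile (- p) = interval_constant \<alpha> h"
        unfolding profiles_eq(1) lower_profile interval_constant_def using 2 by (simp add: s0 B_def algebra_simps)
      show "0 \<le> upper_profile 0" unfolding profiles_eq using 2 h0 by simp
      show "0 \<le> lower_profile (- p)" unfolding lower_profile using B by simp
    qed
  next
    case 3
    define B where "B = - \<alpha> / 6"
    have B: "B > 0" "h / 2 \<le> 3 * B" using 3 by (auto simp: B_def)
    define p where "p = sqrt (3 - h / 2 / B)"
    note off = normal_quadratic_max_off_0[OF B, folded p_def]
    have upp: "upper_profile x = std_normal_density x * (- B * (1 - x\<^sup>2) + h / 2)" for x by (simp add: profiles_eq B_def)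
    have ex: "- (3 - h / 2 / B) / 2 = - (3 / 2) * (1 - h / \<bar>\<alpha>\<bar>)" using 3 by (simp add: B_def field_simps)
    show ?thesis
    proof (rule that[of 0 p])
      show "0 \<le> p" using B by (simp add: p_def field_simps)
      show "lower_profile x \<le> lower_profile 0" for x
        unfolding profiles_eq using normal_quadratic_max_at_0[of "- \<alpha> / 6" "h / 2" x] 3 h0 by simp
      show "upper_profile x \<le> upper_profile p" for x
        unfolding upp by (rule off(1))
      have upper_profile: "upper_profile p = std_normal_density 0 * (2 * B * exp (- (3 / 2) * (1 - h / \<bar>\<alpha>\<bar>)))"
        unfolding upp ex[symmetric] by (rule off(2))
      show "upper_profile p + lower_profile 0 = interval_constant \<alpha> h"
        unfolding profiles_eq(2) upper_profile interval_constant_def using 3 by (simp add: s0 B_def algebra_simps)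
      show "0 \<le> lower_profile 0" unfolding profiles_eq using 3 h0 by simp
      show "0 \<le> upper_profile p" unfolding upper_profile using B by simp
    qed
  qed
qed

lemma profiles_lipschitz:
  "\<bar>upper_profile x - upper_profile y\<bar> \<le> (6 * \<rho> + h) * \<bar>x - y\<bar>" "\<bar>lower_profile x - lower_profile y\<bar> \<le> (6 * \<rho> + h) * \<bar>x - y\<bar>"
proof -
  have "\<bar>h / 2 * std_normal_density x - h / 2 * std_normal_density y\<bar> \<le> h / 2 * \<bar>x - y\<bar>"
    unfolding right_diff_distrib[symmetric] abs_mult using std_normal_density_lipschitz[of x y] h_nonneg
    by (intro mult_mono) auto
  moreover have "h / 2 * \<bar>x - y\<bar> \<le> h * \<bar>x - y\<bar>" using h_nonneg by (intro mult_right_mono) auto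
  ultimately show "\<bar>upper_profile x - upper_profile y\<bar> \<le> (6 * \<rho> + h) * \<bar>x - y\<bar>" "\<bar>lower_profile x - lower_profile y\<bar> \<le> (6 * \<rho> + h) * \<bar>x - y\<bar>"
    using edgeworth_term_uniform_lipschitz[of x y] unfolding upper_profile_def lower_profile_def distrib_right by linarith+
qed

text \<open>The upper bound follows from the profiles and \<open>interval_diff_bound\<close>. For the lower bound take the closed
interval between nodes near \<open>m\<close> and \<open>p\<close>; if \<open>m = p\<close>, it is a single node.\<close>
theorem interval_sup_limit:
  "(\<lambda>n. sqrt (real n) * (SUP I\<in>{I. is_interval I}. \<bar>measure (M n) I - measure std_normal_distribution I\<bar>))
     \<longlonglongrightarrow> interval_constant \<alpha> h"
proof -
  obtain m p where mp: "m \<le> p" and upper_profile: "\<And>x. upper_profile x \<le> upper_profile p" and lower_profile: "\<And>x. lower_profile x \<le> lower_profile m"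
    and sum: "upper_profile p + lower_profile m = interval_constant \<alpha> h" and nonneg: "0 \<le> upper_profile p" "0 \<le> lower_profile m"
    using extremal_points by metis
  define d where "d n I = \<bar>measure (M n) I - measure std_normal_distribution I\<bar>" for n I
  define S where "S n = (SUP I\<in>{I. is_interval I}. d n I)" for n
  have bdd: "bdd_above (d n ` {I. is_interval I})" for n
  proof -
    interpret Mn: real_distribution "M n" by (rule M)
    have "d n I \<le> 1" for I
      unfolding d_def abs_le_iff using Mn.prob_le_1[of I] N01.prob_le_1[of I] measure_nonneg[of "M n" I] measure_nonneg[of std_normal_distribution I]
      by argo
    then show ?thesis by (auto intro!: bdd_aboveI)
  qed
  have upper: "\<forall>\<^sub>F n in sequentially. sqrt n * S n \<le> interval_constant \<alpha> h + 2 * \<epsilon>" if \<epsilon>: "\<epsilon> > 0" for \<epsilon>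
    using half_line_bounds[OF \<epsilon>] eventually_gt_at_top[of 0]
  proof eventually_elim
    case (elim n)
    have s: "sqrt n > 0" using elim by simp
    have sv: "v \<in> {- (lower_profile m + \<epsilon>) / sqrt n..(upper_profile p + \<epsilon>) / sqrt n}" if "sqrt n * v \<in> {- lower_profile x - \<epsilon>..upper_profile x + \<epsilon>}" for v x
    proof -
      have "sqrt n * v \<le> upper_profile p + \<epsilon>" "- (lower_profile m + \<epsilon>) \<le> sqrt n * v" using that upper_profile[of x] lower_profile[of x] by auto
      then show ?thesis using s by (auto simp: field_simps)
    qed
    have "S n \<le> (upper_profile p + \<epsilon>) / sqrt n - (- (lower_profile m + \<epsilon>) / sqrt n)"
      unfolding S_def
    proof (rule cSUP_least)
      fix I :: "real set" assume "I \<in> {I. is_interval I}"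
      then show "d n I \<le> (upper_profile p + \<epsilon>) / sqrt n - (- (lower_profile m + \<epsilon>) / sqrt n)"
        unfolding d_def
      proof (intro interval_diff_bound M real_dist_normal_dist)
        fix x
        show "measure (M n) {..x} - measure std_normal_distribution {..x} \<in> {- (lower_profile m + \<epsilon>) / sqrt n..(upper_profile p + \<epsilon>) / sqrt n}"
          using elim(1) sv[of _ x] unfolding cdf_def by blast
        show "measure (M n) {..<x} - measure std_normal_distribution {..<x} \<in> {- (lower_profile m + \<epsilon>) / sqrt n..(upper_profile p + \<epsilon>) / sqrt n}"
          using elim(1) sv[of _ x] unfolding std_normal_lessThan by blast
      qed (use s nonneg \<epsilon> in \<open>auto intro!: divide_nonpos_pos\<close>)
    qed auto
    also have "\<dots> = (interval_constant \<alpha> h + 2 * \<epsilon>) / sqrt n"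
      unfolding sum[symmetric] by (simp add: add_divide_distrib diff_divide_distrib)
    finally show ?case using s by (simp add: pos_le_divide_eq mult.commute)
  qed
  have lower: "\<forall>\<^sub>F n in sequentially. interval_constant \<alpha> h - 4 * \<epsilon> \<le> sqrt n * S n" if \<epsilon>: "\<epsilon> > 0" for \<epsilon>
  proof -
    have \<eta>lim: "\<eta> \<longlonglongrightarrow> 0"
      using tendsto_mult_left[OF inverse_sqrt_tendsto_0, of h] by (simp add: \<eta>_def[abs_def])
    have e1: "\<forall>\<^sub>F n in sequentially. (6 * \<rho> + h) * \<eta> n < \<epsilon>"
      using tendsto_mult_left[OF \<eta>lim, of "6 * \<rho> + h"] \<epsilon> by (intro order_tendstoD) auto
    have e2: "\<forall>\<^sub>F n in sequentially. m < p \<longrightarrow> \<eta> n < (p - m) / 2"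
    proof (cases "m < p")
      case True
      then have "\<forall>\<^sub>F n in sequentially. \<eta> n < (p - m) / 2" using \<eta>lim by (intro order_tendstoD) auto
      then show ?thesis by eventually_elim simp
    qed simp
    show ?thesis using half_line_bounds[OF \<epsilon>] eventually_gt_at_top[of 0] e1 e2
    proof eventually_elim
      case (elim n)
      interpret Mn: real_distribution "M n" by (rule M)
      have s: "sqrt n > 0" using elim by simp
      obtain g where g: "\<bar>g - m\<bar> \<le> \<eta> n" "sqrt n * (measure (M n) {..g} - \<Phi> g) \<ge> upper_profile g - \<epsilon>"
          "sqrt n * (measure (M n) {..<g} - \<Phi> g) \<le> - lower_profile g + \<epsilon>"
        using elim(1) by blast
      \<comment> \<open>The nodes must be in the right order: distinct targets are far apart compared to \<open>\<eta> n\<close>, equal ones share a node.\<close>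
      obtain k where k: "\<bar>k - p\<bar> \<le> \<eta> n" "sqrt n * (measure (M n) {..k} - \<Phi> k) \<ge> upper_profile k - \<epsilon>" and gk: "g \<le> k"
      proof (cases "m < p")
        case True
        obtain k where k: "\<bar>k - p\<bar> \<le> \<eta> n" "sqrt n * (measure (M n) {..k} - \<Phi> k) \<ge> upper_profile k - \<epsilon>"
          using elim(1) by blast
        moreover have "g \<le> k" using k(1) g(1) elim(4) True by (auto simp: abs_le_iff field_simps)
        ultimately show ?thesis by (rule that)
      next
        case False
        then show ?thesis using that[of g] g mp by simp
      qed
      have lip: "upper_profile k \<ge> upper_profile p - \<epsilon>" "lower_profile g \<ge> lower_profile m - \<epsilon>"
      proof -
        have "(6 * \<rho> + h) * \<bar>k - p\<bar> \<le> (6 * \<rho> + h) * \<eta> n" "(6 * \<rho> + h) * \<bar>g - m\<bar> \<le> (6 * \<rho> + h) * \<eta> n"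
          using k(1) g(1) \<rho>_nonneg h_nonneg by (auto intro!: mult_left_mono)
        then show "upper_profile k \<ge> upper_profile p - \<epsilon>" "lower_profile g \<ge> lower_profile m - \<epsilon>"
          using profiles_lipschitz(1)[of k p] profiles_lipschitz(2)[of g m] elim(3) by (auto simp: abs_le_iff)
      qed
      have "{g..k} = {..k} - {..<g}" by auto
      then have "measure (M n) {g..k} = measure (M n) {..k} - measure (M n) {..<g}"
         "measure std_normal_distribution {g..k} = measure std_normal_distribution {..k} - measure std_normal_distribution {..<g}"
        using gk by (simp_all add: Mn.finite_measure_Diff N01.finite_measure_Diff subset_eq)
      then have "measure (M n) {g..k} - measure std_normal_distribution {g..k}
         = (measure (M n) {..k} - \<Phi> k) - (measure (M n) {..<g} - \<Phi> g)"
        unfolding std_normal_lessThan cdf_def by simp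
      then have "sqrt n * (measure (M n) {g..k} - measure std_normal_distribution {g..k})
         = sqrt n * (measure (M n) {..k} - \<Phi> k) - sqrt n * (measure (M n) {..<g} - \<Phi> g)"
        by (simp only: right_diff_distrib)
      also have "\<dots> \<ge> interval_constant \<alpha> h - 4 * \<epsilon>"
        using g(3) k(2) lip sum by argo
      finally have "interval_constant \<alpha> h - 4 * \<epsilon> \<le> sqrt n * (measure (M n) {g..k} - measure std_normal_distribution {g..k})" .
      also have "\<dots> \<le> sqrt n * d n {g..k}" unfolding d_def using s by (intro mult_left_mono) auto
      also have "d n {g..k} \<le> S n" unfolding S_def by (rule cSUP_upper[OF _ bdd]) (simp add: is_interval_cc)
      finally show ?case using s by simp
    qed
  qed
  have "(\<lambda>n. sqrt (real n) * S n) \<longlonglongrightarrow> interval_constant \<alpha> h"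
  proof (rule tendstoI)
    fix e :: real assume e: "e > 0"
    then have e8: "e / 8 > 0" by simp
    show "\<forall>\<^sub>F n in sequentially. dist (sqrt (real n) * S n) (interval_constant \<alpha> h) < e"
      using upper[OF e8] lower[OF e8]
      by eventually_elim (use e in \<open>auto simp: dist_real_def abs_less_iff\<close>)
  qed
  then show ?thesis unfolding S_def d_def .
qed

end

section \<open>The lattice span in terms of the characteristic function\<close>

lemma lattice_points_measurable [measurable]: "lattice_points a \<eta> \<in> sets borel"
proof -
  have "lattice_points a \<eta> = range (\<lambda>k::int. a + \<eta> * of_int k)" by (auto simp: lattice_points_def)
  then have "countable (lattice_points a \<eta>)" by simp
  then show ?thesis by (rule sets.countable[rotated]) auto
qed

context real_distribution
begin

lemma char_eq_1_iff_lattice: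
  assumes s: "s > 0"
  shows "norm (char M s) = 1 \<longleftrightarrow> (\<exists>a. measure M (lattice_points a (2 * pi / s)) = 1)"
proof
  assume "norm (char M s) = 1"
  from AE_lattice_of_char[OF _ this] s obtain a where "AE x in M. x \<in> lattice_points a (2 * pi / s)" by auto
  then have "measure M (lattice_points a (2 * pi / s)) = 1" by (subst prob_eq_1) auto
  then show "\<exists>a. measure M (lattice_points a (2 * pi / s)) = 1" ..
next
  assume "\<exists>a. measure M (lattice_points a (2 * pi / s)) = 1"
  then obtain a where "measure M (lattice_points a (2 * pi / s)) = 1" ..
  then have ae: "AE x in M. x \<in> lattice_points a (2 * pi / s)" by (subst (asm) prob_eq_1) auto
  have "char M s = (\<integral>x. iexp (s * a) \<partial>M)"
    unfolding char_def
  proof (rule integral_cong_AE)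
    show "AE x in M. iexp (s * x) = iexp (s * a)"
      using ae
    proof eventually_elim
      case (elim x)
      then obtain k :: int where "x = a + 2 * pi / s * of_int k" by (auto simp: lattice_points_def)
      then have "s * x = s * a + 2 * pi * of_int k" using s by (simp add: field_simps)
      then have "iexp (s * x) = iexp (s * a) * iexp (2 * pi * of_int k)"
        by (simp only: of_real_add ring_distribs exp_add)
      moreover have "iexp (2 * pi * of_int k) = 1" using exp_integer_2pi[of "of_int k"] by (simp add: mult_ac)
      ultimately show ?case by simp
    qed
  qed auto
  then show "norm (char M s) = 1" by (simp add: prob_space del: space_eq_univ of_real_mult)
qed

lemma norm_char_minus: "norm (char M (- s)) = norm (char M s)"
proof -
  have int: "integrable M (\<lambda>x. iexp (s * x))" by (intro integrable_const_bound[of _ 1]) auto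
  have "char M (- s) = (\<integral>x. cnj (iexp (s * x)) \<partial>M)" unfolding char_def by (simp add: exp_cnj)
  also have "\<dots> = cnj (char M s)" unfolding char_def by (rule integral_bounded_linear[OF bounded_linear_cnj int])
  finally show ?thesis by simp
qed

text \<open>The positive \<open>s\<close> with \<open>\<bar>char M s\<bar> = 1\<close> correspond to the lattice steps \<open>2 * \<pi> / s\<close>. Together with their negatives
and \<open>0\<close> they form a closed subgroup of the reals. If it has no small positive elements, it is generated by its
least positive element \<open>c\<close>, and the largest step is \<open>2 * \<pi> / c\<close>. For laws without lattice the subgroup is trivial
and the span is \<open>0\<close> by definition.\<close>
lemma lattice_span_char:
  assumes \<delta>: "\<delta> > 0" and small: "\<And>s. 0 < s \<Longrightarrow> s < \<delta> \<Longrightarrow> norm (char M s) \<noteq> 1"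
  shows "lattice_span M \<ge> 0"
    and "s \<noteq> 0 \<Longrightarrow> norm (char M s) = 1 \<Longrightarrow> \<exists>k::int. k \<noteq> 0 \<and> lattice_span M * s = 2 * pi * of_int k"
    and "lattice_span M > 0 \<Longrightarrow> norm (char M (2 * pi / lattice_span M)) = 1"
proof -
  define L where "L = {s. s > 0 \<and> norm (char M s) = 1}"
  have E: "(\<Union>a. {\<eta>. \<eta> > 0 \<and> measure M (lattice_points a \<eta>) = 1}) = (\<lambda>s. 2 * pi / s) ` L"
  proof (intro set_eqI iffI)
    fix \<eta> assume "\<eta> \<in> (\<Union>a. {\<eta>. \<eta> > 0 \<and> measure M (lattice_points a \<eta>) = 1})"
    then obtain a where a: "\<eta> > 0" "measure M (lattice_points a \<eta>) = 1" by auto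
    then have "2 * pi / \<eta> \<in> L" using char_eq_1_iff_lattice[of "2 * pi / \<eta>"] by (auto simp: L_def)
    moreover have "\<eta> = 2 * pi / (2 * pi / \<eta>)" by simp
    ultimately show "\<eta> \<in> (\<lambda>s. 2 * pi / s) ` L" by blast
  next
    fix \<eta> assume "\<eta> \<in> (\<lambda>s. 2 * pi / s) ` L"
    then show "\<eta> \<in> (\<Union>a. {\<eta>. \<eta> > 0 \<and> measure M (lattice_points a \<eta>) = 1})"
      using char_eq_1_iff_lattice by (auto simp: L_def)
  qed
  have lat: "lattice_law M \<longleftrightarrow> L \<noteq> {}"
    using E unfolding lattice_law_def by blast
  have sgn: "\<bar>s\<bar> \<in> L" if "s \<noteq> 0" "norm (char M s) = 1" for s
    using that norm_char_minus[of s] by (auto simp: L_def abs_if)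
  have "lattice_span M \<ge> 0
    \<and> (\<forall>s. s \<noteq> 0 \<longrightarrow> norm (char M s) = 1 \<longrightarrow> (\<exists>k::int. k \<noteq> 0 \<and> lattice_span M * s = 2 * pi * of_int k))
    \<and> (lattice_span M > 0 \<longrightarrow> norm (char M (2 * pi / lattice_span M)) = 1)"
  proof (cases "L = {}")
    case True
    then have "lattice_span M = 0" using lat by (simp add: lattice_span_def)
    then show ?thesis using sgn True by auto
  next
    case False
    define c where "c = Inf L"
    have L\<delta>: "\<delta> \<le> s" if "s \<in> L" for s using small[of s] that by (force simp: L_def)
    have bdd: "bdd_below L" using L\<delta> by (auto intro!: bdd_belowI)
    have "L = {s. \<delta> \<le> s} \<inter> {s. norm (char M s) = 1}" using L\<delta> \<delta> by (auto simp: L_def)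
    moreover have "closed {s. norm (char M s) = 1}"
      by (intro closed_Collect_eq continuous_intros continuous_at_imp_continuous_on ballI isCont_char)
    ultimately have "closed L" by (auto intro!: closed_Int closed_Collect_le continuous_intros)
    then have cL: "c \<in> L" unfolding c_def using False bdd by (intro closed_contains_Inf)
    then have c: "c > 0" "norm (char M c) = 1" by (auto simp: L_def)
    have min: "c \<le> s" if "s \<in> L" for s unfolding c_def using that bdd by (rule cInf_lower)
    have shift: "norm (char M (s - real k * c)) = norm (char M s)" for s k
    proof (induction k)
      case (Suc k)
      have "norm (char M (s - real k * c)) = norm (char M (s - real k * c - c))"
        by (rule norm_char_shift[OF c(2)])
      moreover have "s - real k * c - c = s - real (Suc k) * c" by (simp add: algebra_simps)
      ultimately show ?case using Suc by simp
    qed simp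
    have mult: "\<exists>k::nat. k > 0 \<and> s = real k * c" if s: "s \<in> L" for s
    proof -
      define k where "k = nat \<lfloor>s / c\<rfloor>"
      have s0: "s > 0" "norm (char M s) = 1" using s by (auto simp: L_def)
      have "0 \<le> s / c" using s0 c by simp
      then have "real k \<le> s / c" "s / c < real k + 1" unfolding k_def by linarith+
      then have k: "real k * c \<le> s" "s < real k * c + c" using c by (auto simp: field_simps)
      have "s - real k * c = 0"
      proof (rule ccontr)
        assume "s - real k * c \<noteq> 0"
        then have "s - real k * c \<in> L" using k s0 shift[of s k] by (auto simp: L_def)
        from min[OF this] k show False by simp
      qed
      then show ?thesis using s0 by (intro exI[of _ k]) (auto intro: Suc_leI simp: gr0_conv_Suc[symmetric] zero_less_mult_iff)
    qed
    have h: "lattice_span M = 2 * pi / c"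
    proof -
      have "Sup ((\<lambda>s. 2 * pi / s) ` L) = 2 * pi / c"
        using cL min c by (intro cSup_eq_maximum) (auto intro!: divide_left_mono mult_pos_pos simp: L_def)
      then show ?thesis using False lat by (simp add: lattice_span_def E)
    qed
    show ?thesis
    proof (intro conjI allI impI)
      show "lattice_span M \<ge> 0" using c by (simp add: h)
      show "norm (char M (2 * pi / lattice_span M)) = 1" using c by (simp add: h)
    next
      fix s assume s: "s \<noteq> 0" "norm (char M s) = 1"
      obtain k where k: "k > 0" "\<bar>s\<bar> = real k * c" using mult[OF sgn[OF s]] by blast
      define j where "j = (if s > 0 then int k else - int k)"
      have "s = of_int j * c" using k by (auto simp: j_def abs_if split: if_splits)
      then have "lattice_span M * s = 2 * pi * of_int j" using c by (simp add: h)
      moreover have "j \<noteq> 0" using k by (simp add: j_def)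
      ultimately show "\<exists>k::int. k \<noteq> 0 \<and> lattice_span M * s = 2 * pi * of_int k" by blast
    qed
  qed
  then show "lattice_span M \<ge> 0"
    and "s \<noteq> 0 \<Longrightarrow> norm (char M s) = 1 \<Longrightarrow> \<exists>k::int. k \<noteq> 0 \<and> lattice_span M * s = 2 * pi * of_int k"
    and "lattice_span M > 0 \<Longrightarrow> norm (char M (2 * pi / lattice_span M)) = 1"
    by blast+
qed

lemma char_affine: "char (distr M borel (\<lambda>x. (x - b) / c)) t = iexp (- (t * b / c)) * char M (t / c)"
proof -
  have "char (distr M borel (\<lambda>x. (x - b) / c)) t = (\<integral>x. iexp (t * ((x - b) / c)) \<partial>M)"
    unfolding char_def by (subst integral_distr) auto
  also have "\<dots> = (\<integral>x. iexp (- (t * b / c)) * iexp (t / c * x) \<partial>M)"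
    by (intro Bochner_Integration.integral_cong refl) (simp add: exp_add[symmetric] diff_divide_distrib algebra_simps)
  also have "\<dots> = iexp (- (t * b / c)) * char M (t / c)" unfolding char_def by simp
  finally show ?thesis .
qed

lemma char_convolution:
  assumes "real_distribution N"
  shows "real_distribution (M \<star> N)" and "char (M \<star> N) t = char M t * char N t"
proof -
  interpret N: real_distribution N by fact
  interpret pair_prob_space M N ..
  show "real_distribution (M \<star> N)"
    unfolding convolution_def by (intro real_distribution_distr) measurable
  have "char (M \<star> N) t = (\<integral>p. iexp (t * (fst p + snd p)) \<partial>(M \<Otimes>\<^sub>M N))"
    unfolding char_def convolution_def by (subst integral_distr) (auto simp: case_prod_beta)
  also have "\<dots> = (\<integral>p. iexp (t * fst p) * iexp (t * snd p) \<partial>(M \<Otimes>\<^sub>M N))"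
    by (intro Bochner_Integration.integral_cong refl) (simp add: exp_add[symmetric] algebra_simps)
  also have "\<dots> = (\<integral>x. \<integral>u. iexp (t * x) * iexp (t * u) \<partial>N \<partial>M)"
    by (subst integral_fst'[symmetric]) (auto intro!: integrable_const_bound[of _ 1] simp: norm_mult simp del: of_real_mult)
  also have "\<dots> = char M t * char N t" by (simp add: char_def)
  finally show "char (M \<star> N) t = char M t * char N t" .
qed

lemma conv_power_char:
  "real_distribution (conv_power M n) \<and> char (conv_power M n) t = char M t ^ n"
proof (induction n)
  case 0
  have "real_distribution (return borel (0::real))"
    unfolding real_distribution_def real_distribution_axioms_def by (simp add: prob_space_return)
  then show ?case by (simp add: char_def integral_return)
next
  case (Suc n)
  then show ?case using char_convolution(1)[of "conv_power M n"] char_convolution(2)[of "conv_power M n" t] by simp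
qed

end

text \<open>A positive third absolute central moment excludes Dirac laws, hence the standard deviation is positive.\<close>
lemma P3_moments:
  assumes "P \<in> P3"
  shows "real_distribution P"
    and "integrable P (\<lambda>x. x)"
    and "integrable P (\<lambda>x. \<bar>x - law_mean P\<bar> ^ 3)"
    and "integrable P (\<lambda>x. (x - law_mean P)\<^sup>2)"
    and "(std_dev P)\<^sup>2 = (\<integral>x. (x - law_mean P)\<^sup>2 \<partial>P)"
    and "std_dev P > 0"
proof -
  let ?m = "law_mean P"
  show P: "real_distribution P" using assms by (simp add: P3_def)
  interpret real_distribution P by fact
  have p3: "\<bar>x\<bar> powr 3 = \<bar>x\<bar> ^ 3" and p2: "\<bar>x\<bar> powr 2 = x\<^sup>2" for x :: real
    by (simp_all add: powr_numeral)
  have fin: "(\<integral>\<^sup>+x. ennreal \<bar>x\<bar> \<partial>P) < \<infinity>"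
    using assms by (auto simp: P3_def abs_central_moment_def split: if_splits)
  then have acm: "abs_central_moment s P = (\<integral>\<^sup>+x. ennreal (\<bar>x - ?m\<bar> powr s) \<partial>P)" for s
    by (simp add: abs_central_moment_def)
  show "integrable P (\<lambda>x. x)" using fin by (intro integrableI_bounded) auto
  have a3: "abs_central_moment 3 P = (\<integral>\<^sup>+x. ennreal (\<bar>x - ?m\<bar> ^ 3) \<partial>P)"
    unfolding acm p3 ..
  have pos3: "0 < (\<integral>\<^sup>+x. ennreal (\<bar>x - ?m\<bar> ^ 3) \<partial>P)" and fin3: "(\<integral>\<^sup>+x. ennreal (\<bar>x - ?m\<bar> ^ 3) \<partial>P) < \<infinity>"
    using assms unfolding P3_def a3[symmetric] by auto
  show i3: "integrable P (\<lambda>x. \<bar>x - ?m\<bar> ^ 3)"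
    using fin3 by (intro integrableI_bounded) auto
  show i2: "integrable P (\<lambda>x. (x - ?m)\<^sup>2)"
  proof (rule Bochner_Integration.integrable_bound[of _ "\<lambda>x. 1 + \<bar>x - ?m\<bar> ^ 3"])
    show "AE x in P. norm ((x - ?m)\<^sup>2) \<le> norm (1 + \<bar>x - ?m\<bar> ^ 3)"
    proof (rule AE_I2)
      fix x
      have "\<bar>y\<bar>\<^sup>2 \<le> 1 + \<bar>y\<bar> ^ 3" for y :: real
      proof (cases "\<bar>y\<bar> \<le> 1")
        case True
        then have "\<bar>y\<bar>\<^sup>2 \<le> 1" by (intro power_le_one) auto
        then show ?thesis by (simp add: add_increasing2)
      next
        case False
        then have "\<bar>y\<bar> ^ 2 \<le> \<bar>y\<bar> ^ 3" by (intro power_increasing) auto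
        then show ?thesis by simp
      qed
      then show "norm ((x - ?m)\<^sup>2) \<le> norm (1 + \<bar>x - ?m\<bar> ^ 3)" by simp
    qed
  qed (use i3 in auto)
  have "abs_central_moment 2 P = ennreal (\<integral>x. (x - ?m)\<^sup>2 \<partial>P)"
    unfolding acm p2 by (rule nn_integral_eq_integral[OF i2]) simp
  then have sd: "std_dev P = sqrt (\<integral>x. (x - ?m)\<^sup>2 \<partial>P)" by (simp add: std_dev_def)
  then show "(std_dev P)\<^sup>2 = (\<integral>x. (x - ?m)\<^sup>2 \<partial>P)" by simp
  have "(\<integral>x. (x - ?m)\<^sup>2 \<partial>P) \<noteq> 0"
  proof
    assume "(\<integral>x. (x - ?m)\<^sup>2 \<partial>P) = 0"
    then have "AE x in P. (x - ?m)\<^sup>2 = 0"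
      by (subst (asm) integral_nonneg_eq_0_iff_AE[OF i2]) auto
    then have "AE x in P. ennreal (\<bar>x - ?m\<bar> ^ 3) = 0" by eventually_elim simp
    then have "(\<integral>\<^sup>+x. ennreal (\<bar>x - ?m\<bar> ^ 3) \<partial>P) = 0" by (subst nn_integral_0_iff_AE) auto
    then show False using pos3 by simp
  qed
  moreover have "(\<integral>x. (x - ?m)\<^sup>2 \<partial>P) \<ge> 0" by simp
  ultimately have "(\<integral>x. (x - ?m)\<^sup>2 \<partial>P) > 0" by argo
  then show "std_dev P > 0" unfolding sd by simp
qed

text \<open>Everything is applied to the law \<open>Q\<close> of \<open>(X - \<mu>) / \<sigma>\<close>, which has span \<open>h / \<sigma>\<close> and third moment \<open>\<alpha> / \<sigma> ^ 3\<close>. The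
small-frequency bound for \<open>Q\<close> provides the gap at \<open>0\<close> required by \<open>lattice_span_char\<close>.\<close>
theorem theorem2p1:
  fixes P :: "real measure" and \<sigma> \<alpha> h :: real
  assumes "P \<in> P3"
  defines "\<sigma> \<equiv> std_dev P"
    and "\<alpha> \<equiv> third_central_moment P"
    and "h \<equiv> lattice_span P"
  shows "(\<lambda>n. sqrt (real n) *
            (SUP I\<in>{I :: real set. is_interval I}.
               \<bar>measure (standardized_sum_law P n) I - measure std_normal_distribution I\<bar>))
         \<longlonglongrightarrow>
         1 / sqrt (2 * pi) *
           (if \<bar>\<alpha>\<bar> \<le> h * \<sigma>\<^sup>2 then h / \<sigma>
            else h / (2 * \<sigma>) + \<bar>\<alpha>\<bar> / (6 * \<sigma> ^ 3)
                 + \<bar>\<alpha>\<bar> / (3 * \<sigma> ^ 3) * exp (- (3 / 2) * (1 - h * \<sigma>\<^sup>2 / \<bar>\<alpha>\<bar>)))"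
proof -
  note mom = P3_moments[OF assms(1), folded \<sigma>_def]
  interpret P: real_distribution P by (rule mom(1))
  let ?m = "law_mean P"
  note \<sigma> = mom(6)
  define Q where "Q = distr P borel (\<lambda>x. (x - ?m) / \<sigma>)"
  have distr: "(\<integral>x. g x \<partial>Q) = (\<integral>x. g ((x - ?m) / \<sigma>) \<partial>P)" if "g \<in> borel_measurable borel" for g :: "real \<Rightarrow> real"
    unfolding Q_def using that by (subst integral_distr) auto
  have charQ: "char Q t = iexp (- (t * ?m / \<sigma>)) * char P (t / \<sigma>)" for t
    unfolding Q_def by (rule P.char_affine)
  have nQ: "norm (char Q t) = norm (char P (t / \<sigma>))" for t
    unfolding charQ norm_mult by (simp del: of_real_minus)
  interpret Q: standardized_law Q
  proof (intro standardized_law.intro standardized_law_axioms.intro)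
    show "real_distribution Q" unfolding Q_def by (rule P.real_distribution_distr) simp
    have "integrable P (\<lambda>x. \<bar>x - ?m\<bar> ^ 3 / \<sigma> ^ 3)" using mom(3) by simp
    then show "integrable Q (\<lambda>x. \<bar>x\<bar> ^ 3)"
      unfolding Q_def using \<sigma> by (subst integrable_distr_eq) (auto simp: power_divide)
    show "(\<integral>x. x \<partial>Q) = 0"
    proof -
      have "(\<integral>x. (x - ?m) / \<sigma> \<partial>P) = ((\<integral>x. x \<partial>P) - ?m) / \<sigma>"
        using mom(2) by (simp add: P.prob_space del: P.space_eq_univ)
      then show ?thesis by (subst distr) (simp_all add: law_mean_def)
    qed
    show "(\<integral>x. x\<^sup>2 \<partial>Q) = 1"
    proof -
      have "(\<integral>x. ((x - ?m) / \<sigma>)\<^sup>2 \<partial>P) = 1"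
        using \<sigma> by (simp add: power_divide mom(5)[symmetric])
      then show ?thesis by (subst distr) simp_all
    qed
  qed
  have \<alpha>Q: "Q.\<alpha> = \<alpha> / \<sigma> ^ 3"
    unfolding Q.\<alpha>_def \<alpha>_def third_central_moment_def by (subst distr) (auto simp: power_divide)
  have small: "norm (char P s) \<noteq> 1" if s: "0 < s" "s < Q.\<delta> / \<sigma>" for s
  proof -
    have "\<bar>s * \<sigma>\<bar> \<le> Q.\<delta>" using s \<sigma> by (simp add: field_simps abs_mult)
    then have "norm (char Q (s * \<sigma>)) \<le> exp (- ((s * \<sigma>)\<^sup>2) / 4)" by (rule Q.char_gaussian_bound)
    also have "\<dots> < 1" using s \<sigma> by simp
    finally show ?thesis unfolding nQ using \<sigma> by simp
  qed
  have "Q.\<delta> / \<sigma> > 0" using Q.\<delta>(1) \<sigma> by simp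
  note span = P.lattice_span_char[OF this small, folded h_def]
  interpret normalized_sums Q "h / \<sigma>" "standardized_sum_law P"
  proof (intro normalized_sums.intro normalized_sums_axioms.intro spanned_law.intro spanned_law_axioms.intro Q.standardized_law_axioms)
    show "0 \<le> h / \<sigma>" using span(1) \<sigma> by simp
    show "\<exists>k::int. k \<noteq> 0 \<and> h / \<sigma> * s = 2 * pi * of_int k" if "s \<noteq> 0" "norm (char Q s) = 1" for s
      using span(2)[of "s / \<sigma>"] that \<sigma> by (simp add: nQ)
    show "norm (char Q (2 * pi / (h / \<sigma>))) = 1" if "h / \<sigma> > 0"
      using span(3) that \<sigma> by (simp add: nQ zero_less_divide_iff)
    show "real_distribution (standardized_sum_law P n)" for n
    proof -
      interpret C: real_distribution "conv_power P n" using P.conv_power_char by blast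
      show ?thesis unfolding standardized_sum_law_def by (rule C.real_distribution_distr) simp
    qed
    show "char (standardized_sum_law P n) t = char Q (t / sqrt n) ^ n" if n: "n > 0" for n t
    proof -
      interpret C: real_distribution "conv_power P n" using P.conv_power_char by blast
      have "char (standardized_sum_law P n) t = iexp (- (t * (real n * ?m) / (\<sigma> * sqrt n))) * char P (t / (\<sigma> * sqrt n)) ^ n"
        unfolding standardized_sum_law_def \<sigma>_def[symmetric] C.char_affine using P.conv_power_char by simp
      also have "iexp (- (t * (real n * ?m) / (\<sigma> * sqrt n))) = iexp (- (t / sqrt n * ?m / \<sigma>)) ^ n"
        by (simp add: exp_of_nat_mult[symmetric] mult_ac)
      finally show ?thesis by (simp add: charQ power_mult_distrib mult.commute)
    qed
  qed
  have "interval_constant Q.\<alpha> (h / \<sigma>) = 1 / sqrt (2 * pi) *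
           (if \<bar>\<alpha>\<bar> \<le> h * \<sigma>\<^sup>2 then h / \<sigma>
            else h / (2 * \<sigma>) + \<bar>\<alpha>\<bar> / (6 * \<sigma> ^ 3)
                 + \<bar>\<alpha>\<bar> / (3 * \<sigma> ^ 3) * exp (- (3 / 2) * (1 - h * \<sigma>\<^sup>2 / \<bar>\<alpha>\<bar>)))"
  proof -
    have a: "\<bar>Q.\<alpha>\<bar> = \<bar>\<alpha>\<bar> / \<sigma> ^ 3" using \<sigma> by (simp add: \<alpha>Q)
    have c: "\<bar>Q.\<alpha>\<bar> \<le> h / \<sigma> \<longleftrightarrow> \<bar>\<alpha>\<bar> \<le> h * \<sigma>\<^sup>2"
      unfolding a using \<sigma> by (simp add: field_simps power3_eq_cube power2_eq_square)
    have d: "h / \<sigma> / \<bar>Q.\<alpha>\<bar> = h * \<sigma>\<^sup>2 / \<bar>\<alpha>\<bar>"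
      unfolding a using \<sigma> by (simp add: power3_eq_cube power2_eq_square)
    show ?thesis unfolding interval_constant_def c d unfolding a by (simp add: mult.commute)
  qed
  with interval_sup_limit show ?thesis by simp
qed

end
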